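(* Let $F\equiv0$, $\delta=0$, $S>0$, $m,n,i,k\in\mathbb{N}$ (positive integers), $P<\min\{\Lambda_{m,i},\Lambda_{n,k}\}$, and set $\gamma=\frac{n^2}{m^2}$. (i) If $\gamma\in I_j$ for some $j\in\mathbb{N}\cup\{0\}$, then any $(m,i)$-simple mode with sufficiently large energy $E_0$ is $(n,k)$ linearly stable (i.e. there is $\overline E>0$ such that every $(m,i)$-simple mode with energy $E_0\ge\overline E$ is $(n,k)$ linearly stable). (ii) If $\gamma\in K_j$ for some $j\in\mathbb{N}\cup\{0\}$, then any $(m,i)$-simple mode with sufficiently large energy $E_0$ is $(n,k)$ linearly unstable (i.e. there is $\overline E>0$ such that every $(m,i)$-simple mode with energy $E_0\ge\overline E$ is $(n,k)$ linearly unstable).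
   Context: Let $0<\sigma<\frac12$, $l>0$ and $\Omega=(0,\pi)\times(-l,l)$. Consider the undamped, unforced plate equation $U_{tt}+\Delta^2U-\phi(U)U_{xx}=0$ in $\Omega\times(0,\infty)$, $\phi(U)=-P+S\int_\Omega U_x^2$, with boundary conditions $U=U_{xx}=0$ on $\{0,\pi\}\times[-l,l]$, $U_{yy}+\sigma U_{xx}=U_{yyy}+(2-\sigma)U_{xxy}=0$ on $[0,\pi]\times\{-l,l\}$. Let $w_{mi}(x,y)=\varphi_{m,i}(y)\sin(mx)$, $m,i\ge1$, be the complete orthogonal system of eigenfunctions of the buckling problem $\Delta^2w+\Lambda w_{xx}=0$ in $\Omega$ with the same boundary conditions, with eigenvalues $\Lambda_{m,i}>0$, so that $\Delta^2w_{mi}=-\Lambda_{m,i}(w_{mi})_{xx}=m^2\Lambda_{m,i}w_{mi}$, normalized by $\int_\Omega w_{mi}^2=1$. An $(m,i)$-simple mode is a solution of the plate equation of the form $U(x,y,t)=\varphi(t)w_{mi}(x,y)$ with $\varphi\in C^2([0,\infty),\mathbb{R})$; equivalently, its coordinate $\varphi$ solves $\varphi''+m^2(\Lambda_{m,i}-P)\varphi+Sm^4\varphi^3=0$. Its (conserved) energy is $E_0=\frac{(\varphi')^2}{2}+m^2(\Lambda_{m,i}-P)\frac{\varphi^2}{2}+S\frac{m^4\varphi^4}{4}$. The $(m,i)$-simple mode $\varphi(t)w_{mi}$ is $(n,k)$ linearly stable if $\xi\equiv0$ is a stable solution of the linear Hill equation $\xi''+a(t)\xi=0$, $a(t)=n^2(\Lambda_{n,k}-P)+Sm^2n^2\varphi(t)^2$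 (equivalently, all its solutions are bounded); it is $(n,k)$ linearly unstable if $\xi\equiv0$ is unstable for this equation. For $j\in\mathbb{N}\cup\{0\}$: $I_j=\big(j(2j+1),(j+1)(2j+1)\big)$ and $K_j=\big((j+1)(2j+1),(j+1)(2j+3)\big)$ (open intervals). *)

theory Defs
  imports "HOL-Analysis.Analysis"
begin

text \<open>Derivatives are taken within the given set, so they are one-sided at the
  endpoints of a closed interval and do not see values outside it.\<close>

definition deriv_on :: "real set \<Rightarrow> (real \<Rightarrow> real) \<Rightarrow> real \<Rightarrow> real" where
  "deriv_on T f t = vector_derivative f (at t within T)"

fun C_on :: "nat \<Rightarrow> real set \<Rightarrow> (real \<Rightarrow> real) \<Rightarrow> bool" where
  "C_on 0 T f \<longleftrightarrow> continuous_on T f"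
| "C_on (Suc k) T f \<longleftrightarrow> continuous_on T f \<and> f differentiable_on T \<and> C_on k T (deriv_on T f)"

definition plate :: "real \<Rightarrow> (real \<times> real) set" where
  "plate l = {0<..<pi} \<times> {-l<..<l}"

definition closed_plate :: "real \<Rightarrow> (real \<times> real) set" where
  "closed_plate l = {0..pi} \<times> {-l..l}"

definition dx :: "(real \<times> real \<Rightarrow> real) \<Rightarrow> real \<times> real \<Rightarrow> real" where
  "dx u z = deriv_on {0..pi} (\<lambda>s. u (s, snd z)) (fst z)"

definition dy :: "real \<Rightarrow> (real \<times> real \<Rightarrow> real) \<Rightarrow> real \<times> real \<Rightarrow> real" where
  "dy l u z = deriv_on {-l..l} (\<lambda>s. u (fst z, s)) (snd z)"

text \<open>Functions of class \<open>C\<^sup>k\<close> up to the boundary of the plate.\<close>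

fun C_plate :: "nat \<Rightarrow> real \<Rightarrow> (real \<times> real \<Rightarrow> real) \<Rightarrow> bool" where
  "C_plate 0 l u \<longleftrightarrow> continuous_on (closed_plate l) u"
| "C_plate (Suc k) l u \<longleftrightarrow>
     continuous_on (closed_plate l) u \<and>
     (\<forall>y\<in>{-l..l}. (\<lambda>x. u (x, y)) differentiable_on {0..pi}) \<and>
     (\<forall>x\<in>{0..pi}. (\<lambda>y. u (x, y)) differentiable_on {-l..l}) \<and>
     C_plate k l (dx u) \<and> C_plate k l (dy l u)"

definition laplacian :: "real \<Rightarrow> (real \<times> real \<Rightarrow> real) \<Rightarrow> real \<times> real \<Rightarrow> real" where
  "laplacian l u z = dx (dx u) z + dy l (dy l u) z"

definition plate_boundary_conditions :: "real \<Rightarrow> real \<Rightarrow> (real \<times> real \<Rightarrow> real) \<Rightarrow> bool" where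
  "plate_boundary_conditions \<sigma> l u \<longleftrightarrow>
     (\<forall>z \<in> {0, pi} \<times> {-l..l}. u z = 0 \<and> dx (dx u) z = 0) \<and>
     (\<forall>z \<in> {0..pi} \<times> {-l, l}.
        dy l (dy l u) z + \<sigma> * dx (dx u) z = 0 \<and>
        dy l (dy l (dy l u)) z + (2 - \<sigma>) * dy l (dx (dx u)) z = 0)"

definition buckling_eigenfunction ::
  "real \<Rightarrow> real \<Rightarrow> real \<Rightarrow> (real \<times> real \<Rightarrow> real) \<Rightarrow> bool" where
  "buckling_eigenfunction \<sigma> l \<Lambda> w \<longleftrightarrow>
     C_plate 4 l w \<and> (\<exists>z\<in>plate l. w z \<noteq> 0) \<and>
     plate_boundary_conditions \<sigma> l w \<and>
     (\<forall>z\<in>plate l. laplacian l (laplacian l w) z + \<Lambda> * dx (dx w) z = 0)"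

definition mode_shape :: "(nat \<Rightarrow> nat \<Rightarrow> real \<Rightarrow> real) \<Rightarrow> nat \<Rightarrow> nat \<Rightarrow> real \<times> real \<Rightarrow> real" where
  "mode_shape \<psi> m i z = \<psi> m i (snd z) * sin (real m * fst z)"

text \<open>Orthogonality and completeness refer to \<open>L\<^sup>2\<close> of the plate: the only square-integrable
  function orthogonal to all eigenfunctions is zero. Modes are indexed by positive integers;
  the values at index \<open>0\<close> are irrelevant.\<close>

definition buckling_system ::
  "real \<Rightarrow> real \<Rightarrow> (nat \<Rightarrow> nat \<Rightarrow> real \<Rightarrow> real) \<Rightarrow> (nat \<Rightarrow> nat \<Rightarrow> real) \<Rightarrow> bool" where
  "buckling_system \<sigma> l \<psi> \<Lambda> \<longleftrightarrow>
     (\<forall>m\<ge>1. \<forall>i\<ge>1. \<Lambda> m i > 0 \<and>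
        buckling_eigenfunction \<sigma> l (\<Lambda> m i) (mode_shape \<psi> m i) \<and>
        (LINT z:plate l|lborel. (mode_shape \<psi> m i z)\<^sup>2) = 1) \<and>
     (\<forall>m\<ge>1. \<forall>i\<ge>1. \<forall>n\<ge>1. \<forall>k\<ge>1. (m, i) \<noteq> (n, k) \<longrightarrow>
        (LINT z:plate l|lborel. mode_shape \<psi> m i z * mode_shape \<psi> n k z) = 0) \<and>
     (\<forall>f. set_borel_measurable lborel (plate l) f \<longrightarrow>
        set_integrable lborel (plate l) (\<lambda>z. (f z)\<^sup>2) \<longrightarrow>
        (\<forall>m\<ge>1. \<forall>i\<ge>1. (LINT z:plate l|lborel. f z * mode_shape \<psi> m i z) = 0) \<longrightarrow>
        (AE z in lborel. z \<in> plate l \<longrightarrow> f z = 0))"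

text \<open>The nonlocal coefficient \<open>\<phi>(U)\<close> of the plate equation.\<close>

definition nonlocal_coeff :: "real \<Rightarrow> real \<Rightarrow> real \<Rightarrow> (real \<times> real \<Rightarrow> real) \<Rightarrow> real" where
  "nonlocal_coeff l P S u = - P + S * (LINT z:plate l|lborel. (dx u z)\<^sup>2)"

text \<open>Classical solutions of the undamped, unforced plate equation; the first argument of
  \<open>U\<close> is the time.\<close>

definition plate_solution ::
  "real \<Rightarrow> real \<Rightarrow> real \<Rightarrow> real \<Rightarrow> (real \<Rightarrow> real \<times> real \<Rightarrow> real) \<Rightarrow> bool" where
  "plate_solution \<sigma> l P S U \<longleftrightarrow>
     (\<forall>t\<ge>0. C_plate 4 l (U t) \<and> plate_boundary_conditions \<sigma> l (U t)) \<and>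
     (\<forall>z\<in>closed_plate l. C_on 2 {0..} (\<lambda>t. U t z)) \<and>
     (\<forall>t>0. \<forall>z\<in>plate l.
        deriv_on {0..} (deriv_on {0..} (\<lambda>s. U s z)) t
        + laplacian l (laplacian l (U t)) z
        - nonlocal_coeff l P S (U t) * dx (dx (U t)) z = 0)"

definition simple_mode ::
  "real \<Rightarrow> real \<Rightarrow> real \<Rightarrow> real \<Rightarrow> (real \<times> real \<Rightarrow> real) \<Rightarrow> (real \<Rightarrow> real) \<Rightarrow> bool" where
  "simple_mode \<sigma> l P S w \<phi> \<longleftrightarrow>
     C_on 2 {0..} \<phi> \<and> plate_solution \<sigma> l P S (\<lambda>t z. \<phi> t * w z)"

definition mode_energy ::
  "real \<Rightarrow> real \<Rightarrow> nat \<Rightarrow> real \<Rightarrow> (real \<Rightarrow> real) \<Rightarrow> real \<Rightarrow> real" where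
  "mode_energy P S m \<Lambda> \<phi> t =
     (deriv_on {0..} \<phi> t)\<^sup>2 / 2 + (real m)\<^sup>2 * (\<Lambda> - P) * (\<phi> t)\<^sup>2 / 2
     + S * (real m) ^ 4 * (\<phi> t) ^ 4 / 4"

definition hill_solution :: "(real \<Rightarrow> real) \<Rightarrow> (real \<Rightarrow> real) \<Rightarrow> bool" where
  "hill_solution a \<xi> \<longleftrightarrow>
     C_on 2 {0..} \<xi> \<and> (\<forall>t\<ge>0. deriv_on {0..} (deriv_on {0..} \<xi>) t + a t * \<xi> t = 0)"

text \<open>Lyapunov stability of the zero solution in the phase space \<open>(\<xi>, \<xi>')\<close>.\<close>

definition hill_zero_stable :: "(real \<Rightarrow> real) \<Rightarrow> bool" where
  "hill_zero_stable a \<longleftrightarrow>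
     (\<forall>\<epsilon>>0. \<exists>\<delta>>0. \<forall>\<xi>. hill_solution a \<xi> \<longrightarrow>
        norm (\<xi> 0, deriv_on {0..} \<xi> 0) < \<delta> \<longrightarrow>
        (\<forall>t\<ge>0. norm (\<xi> t, deriv_on {0..} \<xi> t) < \<epsilon>))"

definition hill_coeff ::
  "real \<Rightarrow> real \<Rightarrow> nat \<Rightarrow> nat \<Rightarrow> real \<Rightarrow> (real \<Rightarrow> real) \<Rightarrow> real \<Rightarrow> real" where
  "hill_coeff P S m n \<Lambda>nk \<phi> t =
     (real n)\<^sup>2 * (\<Lambda>nk - P) + S * (real m)\<^sup>2 * (real n)\<^sup>2 * (\<phi> t)\<^sup>2"

definition linearly_stable ::
  "real \<Rightarrow> real \<Rightarrow> nat \<Rightarrow> nat \<Rightarrow> real \<Rightarrow> (real \<Rightarrow> real) \<Rightarrow> bool" where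
  "linearly_stable P S m n \<Lambda>nk \<phi> \<longleftrightarrow> hill_zero_stable (hill_coeff P S m n \<Lambda>nk \<phi>)"

definition linearly_unstable ::
  "real \<Rightarrow> real \<Rightarrow> nat \<Rightarrow> nat \<Rightarrow> real \<Rightarrow> (real \<Rightarrow> real) \<Rightarrow> bool" where
  "linearly_unstable P S m n \<Lambda>nk \<phi> \<longleftrightarrow> \<not> hill_zero_stable (hill_coeff P S m n \<Lambda>nk \<phi>)"

definition I_interval :: "nat \<Rightarrow> real set" where
  "I_interval j = {real (j * (2*j + 1)) <..< real ((j + 1) * (2*j + 1))}"

definition K_interval :: "nat \<Rightarrow> real set" where
  "K_interval j = {real ((j + 1) * (2*j + 1)) <..< real ((j + 1) * (2*j + 3))}"

end

theory Submission
  imports Defs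
begin

text \<open>Separating variables in the plate equation shows that the coordinate \<open>\<phi>\<close> of a simple mode solves the
  Duffing equation \<open>\<phi>'' + A \<phi> + B \<phi>\<^sup>3 = 0\<close> with \<open>A, B > 0\<close>, and that the Hill equation of the mode
  \<open>(n, k)\<close> is \<open>\<xi>'' + (A' + \<gamma> B \<phi>\<^sup>2) \<xi> = 0\<close>. Let \<open>R\<close> be the amplitude of \<open>\<phi>\<close> and put \<open>\<kappa>\<^sup>2 = B R\<^sup>2\<close>.
  Writing \<open>\<phi> = R cos \<theta>\<close>, energy conservation becomes
  \<open>\<theta>' = \<kappa> \<surd>(\<epsilon> + (1 + cos\<^sup>2 \<theta>) / 2)\<close> with \<open>\<epsilon> = A / \<kappa>\<^sup>2\<close>, and with \<open>\<theta>\<close> as independent variable the Hill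
  equation turns into an explicit \<open>\<pi>\<close>-periodic planar system that depends only on \<open>\<gamma>\<close>, \<open>\<epsilon>\<close> and
  \<open>\<epsilon>' = A' / \<kappa>\<^sup>2\<close> (lemmas \<open>duffing_phase\<close> and \<open>solution_in_time\<close>). Floquet theory decides
  stability by the trace of the monodromy matrix, the discriminant: the solutions are bounded if its
  modulus is below 2, and some solution is unbounded if it is above 2. For large energy both \<open>\<epsilon>\<close> and
  \<open>\<epsilon>'\<close> tend to 0, so by continuity of the discriminant everything is decided by the limit system, as soon
  as its discriminant does not have modulus 2.

  The limit system is the Lame-type equation \<open>\<xi>'' + \<gamma> u\<^sup>2 \<xi> = 0\<close> along \<open>u'' + u\<^sup>3 = 0\<close>. In the
  variable \<open>u\<^sup>4 = cos\<^sup>4 \<theta>\<close> it is a hypergeometric equation, whose parameters are \<open>\<alpha> = - N / 4\<close> and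
  \<open>\<beta> = (N + 1) / 4\<close> where \<open>\<gamma> = N (N + 1) / 2\<close>. By reflection symmetry the discriminant over a full
  period is \<open>4 p - 2\<close>, where \<open>p\<close> is the product of two entries of the fundamental matrix at \<open>\<pi> / 2\<close>.
  These two entries are values at 1 of hypergeometric series, which Gauss's summation theorem
  expresses by Gamma functions, and Euler's reflection formula collapses the product to
  \<open>p = (1 + \<surd>2 sin (\<pi> / 4 - \<pi> N / 2)) / 2\<close>. Hence the squared limit discriminant is
  \<open>4 (1 - sin (\<pi> N))\<close> (lemma \<open>limit_discriminant\<close>). It is below 4 exactly if \<open>sin (\<pi> N) > 0\<close>. The
  endpoints of the intervals \<open>I\<^sub>j\<close> and \<open>K\<^sub>j\<close> are the triangular numbers \<open>N (N + 1) / 2\<close> with integer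
  \<open>N\<close>: on \<open>I\<^sub>j\<close> one has \<open>2 j < N < 2 j + 1\<close>, which gives stability, and on \<open>K\<^sub>j\<close> one has
  \<open>2 j + 1 < N < 2 j + 2\<close>, which gives instability.\<close>

section \<open>Global solutions of Lipschitz differential equations\<close>

text \<open>Picard iteration on the whole half line at once. With a Lipschitz constant \<open>L\<close>, the increments of the
  iterates decay like \<open>2\<^sup>-\<^sup>n exp (2 L t)\<close>; the weight \<open>exp (2 L t)\<close> makes the integral operator a
  contraction with factor \<open>1/2\<close>, so that no short time steps need to be glued together.\<close>

theorem global_lipschitz_ode_exists:
  fixes f :: "real \<Rightarrow> 'a::banach \<Rightarrow> 'a"
  assumes cont: "\<And>g S. S \<subseteq> {0..} \<Longrightarrow> continuous_on S g \<Longrightarrow> continuous_on S (\<lambda>t. f t (g t))"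
    and lip: "\<And>t x y. t \<ge> 0 \<Longrightarrow> norm (f t x - f t y) \<le> K * norm (x - y)"
  obtains Y where "Y 0 = y0"
    "\<And>t. t \<ge> 0 \<Longrightarrow> (Y has_vector_derivative f t (Y t)) (at t within {0..})"
proof -
  \<comment> \<open>A strictly positive Lipschitz constant is needed to divide by.\<close>
  define L where "L = \<bar>K\<bar> + 1"
  have L: "L > 0" "\<And>t x y. t \<ge> 0 \<Longrightarrow> norm (f t x - f t y) \<le> L * norm (x - y)"
  proof -
    show "L > 0" by (simp add: L_def add_pos_nonneg add_nonneg_pos)
    fix t x y assume "(t::real) \<ge> 0"
    then have "norm (f t x - f t y) \<le> K * norm (x - y)" by (rule lip)
    also have "\<dots> \<le> L * norm (x - y)" by (intro mult_right_mono) (auto simp: L_def)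
    finally show "norm (f t x - f t y) \<le> L * norm (x - y)" .
  qed
  define Z where "Z = rec_nat (\<lambda>t. y0) (\<lambda>n g t. y0 + integral {0..t} (\<lambda>s. f s (g s)))"
  have Z0: "Z 0 = (\<lambda>t. y0)" and ZS: "Z (Suc n) = (\<lambda>t. y0 + integral {0..t} (\<lambda>s. f s (Z n s)))" for n
    by (simp_all add: Z_def)
  have Zc: "continuous_on {0..b} (Z n)" for n b
  proof (induction n)
    case (Suc n)
    have "continuous_on {0..b} (\<lambda>t. f t (Z n t))" using Suc by (intro cont) auto
    then show ?case unfolding ZS
      by (intro continuous_intros indefinite_integral_continuous_1 integrable_continuous_real)
  qed (simp add: Z0)
  have fZc: "continuous_on {0..b} (\<lambda>t. f t (Z n t))" for n b using Zc by (intro cont) auto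
  have conv: "\<exists>g. uniform_limit {0..b} Z g sequentially" if b: "b \<ge> 0" for b
  proof -
    have "continuous_on {0..b} (\<lambda>t. norm (Z 1 t - Z 0 t))" by (intro continuous_intros Zc)
    then have "bounded ((\<lambda>t. norm (Z 1 t - Z 0 t)) ` {0..b})"
      by (intro compact_imp_bounded compact_continuous_image) auto
    then have "\<exists>M. \<forall>t\<in>{0..b}. norm (Z 1 t - Z 0 t) \<le> M"
      by (simp add: bounded_iff)
    then obtain M where M: "\<And>t. t \<in> {0..b} \<Longrightarrow> norm (Z 1 t - Z 0 t) \<le> M"
      by blast
    have M0: "M \<ge> 0" using M[of 0] b norm_ge_zero order_trans by (metis atLeastAtMost_iff order_refl)
    have bd: "norm (Z (Suc n) t - Z n t) \<le> M * (1/2)^n * exp (2 * L * t)" if "t \<in> {0..b}" for n t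
      using that
    proof (induction n arbitrary: t)
      case 0
      have "M * 1 \<le> M * exp (2 * L * t)" using 0 L M0 by (intro mult_left_mono) auto
      then show ?case using M[OF 0] by simp
    next
      case (Suc n)
      have "((\<lambda>s. L * (M * (1/2)^n * exp (2 * L * s))) has_integral
          M * (1/2)^Suc n * exp (2 * L * t) - M * (1/2)^Suc n * exp (2 * L * 0)) {0..t}"
        using Suc.prems
        by (intro fundamental_theorem_of_calculus)
           (auto simp flip: has_real_derivative_iff_has_vector_derivative intro!: derivative_eq_intros)
      then have I: "(\<lambda>s. L * (M * (1/2)^n * exp (2 * L * s))) integrable_on {0..t}"
          "integral {0..t} (\<lambda>s. L * (M * (1/2)^n * exp (2 * L * s))) \<le> M * (1/2)^Suc n * exp (2 * L * t)"
        using M0 by (auto simp: has_integral_iff)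
      have "Z (Suc (Suc n)) t - Z (Suc n) t = integral {0..t} (\<lambda>s. f s (Z (Suc n) s) - f s (Z n s))"
        unfolding ZS[of "Suc n"] fun_cong[OF ZS[of n], of t]
        by (simp add: fZc integrable_continuous_real integral_diff del: ZS)
      also have "norm \<dots> \<le> integral {0..t} (\<lambda>s. L * (M * (1/2)^n * exp (2 * L * s)))"
      proof (intro integral_norm_bound_integral I(1))
        show "(\<lambda>s. f s (Z (Suc n) s) - f s (Z n s)) integrable_on {0..t}"
          by (intro integrable_continuous_real continuous_intros fZc)
        fix s assume s: "s \<in> {0..t}"
        have "norm (f s (Z (Suc n) s) - f s (Z n s)) \<le> L * norm (Z (Suc n) s - Z n s)"
          using s by (intro L) auto
        also have "\<dots> \<le> L * (M * (1/2)^n * exp (2 * L * s))"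
          using s Suc.prems L by (intro mult_left_mono Suc.IH) auto
        finally show "norm (f s (Z (Suc n) s) - f s (Z n s)) \<le> L * (M * (1/2)^n * exp (2 * L * s))" .
      qed
      also note I(2)
      finally show ?case .
    qed
    have "uniform_limit {0..b} (\<lambda>n t. \<Sum>i<n. Z (Suc i) t - Z i t) (\<lambda>t. \<Sum>i. Z (Suc i) t - Z i t) sequentially"
    proof (rule Weierstrass_m_test)
      fix n t assume t: "t \<in> {0..b}"
      have "norm (Z (Suc n) t - Z n t) \<le> M * (1/2)^n * exp (2 * L * t)" by (rule bd[OF t])
      also have "\<dots> \<le> M * (1/2)^n * exp (2 * L * b)" using t L M0 by (intro mult_left_mono) auto
      finally show "norm (Z (Suc n) t - Z n t) \<le> M * (1/2)^n * exp (2 * L * b)" .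
    qed (auto intro!: summable_mult summable_mult2 summable_geometric)
    then have "uniform_limit {0..b} (\<lambda>n t. Z 0 t + (\<Sum>i<n. Z (Suc i) t - Z i t)) (\<lambda>t. Z 0 t + (\<Sum>i. Z (Suc i) t - Z i t)) sequentially"
      by (intro uniform_limit_intros)
    moreover have "(\<lambda>n t. Z 0 t + (\<Sum>i<n. Z (Suc i) t - Z i t)) = Z"
    proof (intro ext)
      fix n t show "Z 0 t + (\<Sum>i<n. Z (Suc i) t - Z i t) = Z n t"
        by (simp add: sum_lessThan_telescope[of "\<lambda>i. Z i t" n])
    qed
    ultimately show ?thesis by auto
  qed
  define Y where "Y t = lim (\<lambda>n. Z n t)" for t
  have uY: "uniform_limit {0..b} Z Y sequentially" if b0: "b \<ge> 0" for b
  proof -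
    obtain g where g: "uniform_limit {0..b} Z g sequentially" using conv[OF b0] by blast
    have "g t = Y t" if "t \<in> {0..b}" for t
      using tendsto_uniform_limitI[OF g that] unfolding Y_def by (simp add: limI)
    then show ?thesis using g uniform_limit_cong'[of "{0..b}" Z Z g Y] by auto
  qed
  have Yc: "continuous_on {0..b} Y" if "b \<ge> 0" for b
    by (rule uniform_limit_theorem[OF _ uY[OF that]]) (auto simp: Zc)
  have fYc: "continuous_on {0..b} (\<lambda>t. f t (Y t))" if "b \<ge> 0" for b
    using Yc[OF that] by (intro cont) auto
  have eq: "Y t = y0 + integral {0..t} (\<lambda>s. f s (Y s))" if t: "t \<ge> 0" for t
  proof -
    have u: "uniform_limit {0..t} (\<lambda>n s. f s (Z n s)) (\<lambda>s. f s (Y s)) sequentially"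
    proof (rule uniform_limitI)
      fix e :: real assume "e > 0"
      then have "\<forall>\<^sub>F n in sequentially. \<forall>x\<in>{0..t}. dist (Z n x) (Y x) < e / L"
        using uY[OF t] L by (auto simp: uniform_limit_iff)
      then show "\<forall>\<^sub>F n in sequentially. \<forall>x\<in>{0..t}. dist (f x (Z n x)) (f x (Y x)) < e"
      proof (rule eventually_mono, intro ballI)
        fix n x assume "\<forall>x\<in>{0..t}. dist (Z n x) (Y x) < e / L" and x: "x \<in> {0..t}"
        then have "L * norm (Z n x - Y x) < e" using L by (simp add: dist_norm field_simps)
        moreover have "norm (f x (Z n x) - f x (Y x)) \<le> L * norm (Z n x - Y x)" using x by (intro L) auto
        ultimately show "dist (f x (Z n x)) (f x (Y x)) < e" by (simp add: dist_norm)
      qed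
    qed
    obtain I J where IJ: "\<And>n. ((\<lambda>s. f s (Z n s)) has_integral I n) {0..t}"
        "((\<lambda>s. f s (Y s)) has_integral J) {0..t}" "I \<longlonglongrightarrow> J"
      by (rule uniform_limit_integral[OF u fZc]) auto
    have "(\<lambda>n. y0 + I n) \<longlonglongrightarrow> y0 + J" using IJ(3) by (intro tendsto_intros)
    moreover have "(\<lambda>n. y0 + I n) = (\<lambda>n. Z (Suc n) t)" using integral_unique[OF IJ(1)] by (simp add: ZS)
    moreover have "(\<lambda>n. Z (Suc n) t) \<longlonglongrightarrow> Y t"
      using tendsto_uniform_limitI[OF uY[OF t], of t] t by (intro LIMSEQ_Suc) auto
    ultimately have "Y t = y0 + J" using LIMSEQ_unique by fastforce
    then show ?thesis using IJ(2) by (simp add: integral_unique)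
  qed
  show ?thesis
  proof (rule that)
    show "Y 0 = y0" using eq[of 0] by simp
    fix t :: real assume t: "t \<ge> 0"
    have "((\<lambda>t. y0 + integral {0..t} (\<lambda>s. f s (Y s))) has_vector_derivative 0 + f t (Y t)) (at t within {0..t+1})"
      using t by (intro has_vector_derivative_add has_vector_derivative_const integral_has_vector_derivative fYc) auto
    then have "(Y has_vector_derivative f t (Y t)) (at t within {0..t+1})"
      using t by (intro has_vector_derivative_transform[of t "{0..t+1}" Y
          "\<lambda>t. y0 + integral {0..t} (\<lambda>s. f s (Y s))"]) (auto intro: eq)
    moreover have "at t within {0..t+1} = at t within {0..}"
      by (rule at_within_nhd[of _ "{..<t+1}"]) auto
    ultimately show "(Y has_vector_derivative f t (Y t)) (at t within {0..})" by simp
  qed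
qed

section \<open>Planar linear systems\<close>

text \<open>The linear system \<open>X' = k Y\<close>, \<open>Y' = - q X\<close>. Its matrix has trace 0, so that all monodromy matrices
  have determinant 1. For \<open>k = 1\<close> it is the Hill equation \<open>X'' + q X = 0\<close>.\<close>

definition planar_solution ::
  "(real \<Rightarrow> real) \<Rightarrow> (real \<Rightarrow> real) \<Rightarrow> real set \<Rightarrow> (real \<Rightarrow> real) \<Rightarrow> (real \<Rightarrow> real) \<Rightarrow> bool" where
  "planar_solution k q I X Y \<longleftrightarrow>
     (\<forall>t\<in>I. (X has_real_derivative k t * Y t) (at t within I) \<and>
            (Y has_real_derivative - q t * X t) (at t within I))"

lemma planar_solution_subset:
  "planar_solution k q I X Y \<Longrightarrow> J \<subseteq> I \<Longrightarrow> planar_solution k q J X Y"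
  by (auto simp: planar_solution_def intro: DERIV_subset)

lemma planar_solution_continuous_on:
  "planar_solution k q I X Y \<Longrightarrow> continuous_on I X"
  "planar_solution k q I X Y \<Longrightarrow> continuous_on I Y"
  unfolding planar_solution_def by (rule DERIV_continuous_on, blast)+

lemma planar_solution_lincomb:
  assumes "planar_solution k q I X Y" "planar_solution k q I U V"
  shows "planar_solution k q I (\<lambda>t. a * X t + b * U t) (\<lambda>t. a * Y t + b * V t)"
  using assms unfolding planar_solution_def
  by (auto intro!: derivative_eq_intros simp: algebra_simps)

lemma wronskian_constant:
  assumes "planar_solution k q I X Y" "planar_solution k q I U V" "convex I" "s \<in> I" "t \<in> I"
  shows "X t * V t - U t * Y t = X s * V s - U s * Y s"
proof -
  have "\<exists>c. \<forall>t\<in>I. X t * V t - U t * Y t = c"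
  proof (rule has_field_derivative_zero_constant[OF assms(3)])
    fix t assume "t \<in> I"
    then show "((\<lambda>t. X t * V t - U t * Y t) has_real_derivative 0) (at t within I)"
      using assms(1,2) unfolding planar_solution_def
      by (auto intro!: derivative_eq_intros simp: algebra_simps)
  qed
  then show ?thesis using assms(4,5) by metis
qed

text \<open>The function \<open>(N + \<delta> / L) exp (- L t)\<close> is nonincreasing.\<close>

lemma gronwall:
  fixes N N' :: "real \<Rightarrow> real"
  assumes L: "L > 0" and cont: "continuous_on {a..b} N"
    and der: "\<And>t. a < t \<Longrightarrow> t < b \<Longrightarrow> (N has_real_derivative N' t) (at t)"
    and le: "\<And>t. a < t \<Longrightarrow> t < b \<Longrightarrow> N' t \<le> L * N t + \<delta>"
    and t: "t \<in> {a..b}"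
  shows "N t + \<delta> / L \<le> (N a + \<delta> / L) * exp (L * (t - a))"
proof -
  define G where "G s = (N s + \<delta> / L) * exp (- L * (s - a))" for s
  have "G t \<le> G a"
  proof (cases "a < t")
    case True
    show ?thesis
    proof (rule DERIV_nonpos_imp_decreasing_open[OF less_imp_le[OF True]])
      fix s assume s: "a < s" "s < t"
      then have "s < b" using t by auto
      have "(G has_real_derivative (N' s - (L * N s + \<delta>)) * exp (- L * (s - a))) (at s)"
        unfolding G_def using der[OF s(1) \<open>s < b\<close>] L
        by (auto intro!: derivative_eq_intros simp: field_simps)
      moreover have "(N' s - (L * N s + \<delta>)) * exp (- L * (s - a)) \<le> 0"
        using le[OF s(1) \<open>s < b\<close>] by (intro mult_nonpos_nonneg) auto
      ultimately show "\<exists>y. (G has_real_derivative y) (at s) \<and> y \<le> 0" by blast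
    next
      show "continuous_on {a..t} G"
        unfolding G_def using t
        by (intro continuous_intros continuous_on_subset[OF cont]) auto
    qed
  qed (use t in auto)
  then have "G t * exp (L * (t - a)) \<le> G a * exp (L * (t - a))" by (intro mult_right_mono) auto
  moreover have "G t * exp (L * (t - a)) = N t + \<delta> / L"
    by (simp add: G_def mult.assoc flip: exp_add) 
  ultimately have "N t + \<delta> / L \<le> G a * exp (L * (t - a))" by linarith
  then show ?thesis by (simp add: G_def)
qed

lemma planar_solution_at_interior:
  assumes "planar_solution k q {a..b} X Y" "a < t" "t < b"
  shows "(X has_real_derivative k t * Y t) (at t)" "(Y has_real_derivative - q t * X t) (at t)"
proof -
  have "at t within {a..b} = at t" using assms by (intro at_within_interior) auto
  then show "(X has_real_derivative k t * Y t) (at t)" "(Y has_real_derivative - q t * X t) (at t)"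
    using assms unfolding planar_solution_def by (auto dest!: bspec[of "{a..b}" _ t])
qed

text \<open>Since \<open>(X\<^sup>2 + Y\<^sup>2)' = 2 (k - q) X Y\<close>, Gronwall applies to \<open>X\<^sup>2 + Y\<^sup>2\<close>.\<close>

lemma planar_solution_zero_forward:
  assumes sol: "planar_solution k q {a..b} X Y"
    and cont: "continuous_on {a..b} k" "continuous_on {a..b} q"
    and zero: "X a = 0" "Y a = 0" and t: "t \<in> {a..b}"
  shows "X t = 0 \<and> Y t = 0"
proof -
  have "bounded ((\<lambda>t. k t - q t) ` {a..b})"
    by (intro compact_imp_bounded compact_continuous_image continuous_intros cont) auto
  then obtain L where L: "L > 0" "\<And>t. t \<in> {a..b} \<Longrightarrow> \<bar>k t - q t\<bar> \<le> L"
    by (auto simp: bounded_pos)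
  have "(X t)\<^sup>2 + (Y t)\<^sup>2 + 0 / L \<le> ((X a)\<^sup>2 + (Y a)\<^sup>2 + 0 / L) * exp (L * (t - a))"
  proof (rule gronwall[where N' = "\<lambda>t. (k t - q t) * (2 * X t * Y t)" and b = b, OF L(1) _ _ _ t])
    show "continuous_on {a..b} (\<lambda>t. (X t)\<^sup>2 + (Y t)\<^sup>2)"
      by (intro continuous_intros planar_solution_continuous_on[OF sol])
    fix s assume s: "a < s" "s < b"
    show "((\<lambda>t. (X t)\<^sup>2 + (Y t)\<^sup>2) has_real_derivative (k s - q s) * (2 * X s * Y s)) (at s)"
      using planar_solution_at_interior[OF sol s]
      by (auto intro!: derivative_eq_intros simp: algebra_simps)
    have "(k s - q s) * (2 * X s * Y s) \<le> \<bar>k s - q s\<bar> * \<bar>2 * X s * Y s\<bar>"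
      by (metis abs_ge_self abs_mult)
    also have "\<dots> \<le> L * ((X s)\<^sup>2 + (Y s)\<^sup>2)"
      using L s sum_squares_bound[of "\<bar>X s\<bar>" "\<bar>Y s\<bar>"] by (intro mult_mono) (auto simp: abs_mult)
    finally show "(k s - q s) * (2 * X s * Y s) \<le> L * ((X s)\<^sup>2 + (Y s)\<^sup>2) + 0" by simp
  qed
  then have "(X t)\<^sup>2 + (Y t)\<^sup>2 \<le> 0" by (simp add: zero)
  then show ?thesis using sum_power2_le_zero_iff by blast
qed

text \<open>Time reversal preserves the class of systems if the sign of \<open>Y\<close> is changed as well. This gives
  backward uniqueness here, and later the half-period formula for the discriminant.\<close>

lemma planar_solution_reflect:
  assumes "planar_solution k q {a..b} X Y"
  shows "planar_solution (\<lambda>t. k (d - t)) (\<lambda>t. q (d - t)) {d - b..d - a} (\<lambda>t. X (d - t)) (\<lambda>t. - Y (d - t))"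
  unfolding planar_solution_def
proof (intro ballI conjI)
  fix t assume "t \<in> {d - b..d - a}"
  then have "d - t \<in> {a..b}" by auto
  moreover have "(\<lambda>t. d - t) ` {d - b..d - a} = {a..b}"
    by (force simp: image_iff intro: bexI[of _ "d - x" for x])
  moreover have "((\<lambda>t. d - t) has_real_derivative - 1) (at t within {d - b..d - a})"
    by (auto intro!: derivative_eq_intros)
  ultimately have "((\<lambda>t. X (d - t)) has_real_derivative (k (d - t) * Y (d - t)) * - 1) (at t within {d - b..d - a})"
    and Y: "((\<lambda>t. Y (d - t)) has_real_derivative (- q (d - t) * X (d - t)) * - 1) (at t within {d - b..d - a})"
    using assms unfolding planar_solution_def
    by (metis DERIV_image_chain[unfolded o_def])+
  then show "((\<lambda>t. X (d - t)) has_real_derivative k (d - t) * - Y (d - t)) (at t within {d - b..d - a})"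
    "((\<lambda>t. - Y (d - t)) has_real_derivative - q (d - t) * X (d - t)) (at t within {d - b..d - a})"
    by (auto dest: DERIV_minus)
qed

lemma planar_solution_zero:
  assumes sol: "planar_solution k q {a..b} X Y"
    and cont: "continuous_on {a..b} k" "continuous_on {a..b} q"
    and c: "c \<in> {a..b}" and zero: "X c = 0" "Y c = 0" and t: "t \<in> {a..b}"
  shows "X t = 0 \<and> Y t = 0"
proof (cases "c \<le> t")
  case True
  then show ?thesis using c t
    by (intro planar_solution_zero_forward[of k q c b] planar_solution_subset[OF sol]
        continuous_on_subset[OF cont(1)] continuous_on_subset[OF cont(2)] zero) auto
next
  case False
  have s: "planar_solution k q {a..c} X Y" using c by (intro planar_solution_subset[OF sol]) auto
  have "X (0 - (- t)) = 0 \<and> - Y (0 - (- t)) = 0"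
    using c t False zero
    by (intro planar_solution_zero_forward[OF planar_solution_reflect[OF s, of 0]]
        continuous_on_compose2[OF cont(1)] continuous_on_compose2[OF cont(2)] continuous_intros) auto
  then show ?thesis by simp
qed

lemma planar_solution_unique:
  assumes "planar_solution k q {a..b} X Y" "planar_solution k q {a..b} U V"
    and "continuous_on {a..b} k" "continuous_on {a..b} q"
    and "c \<in> {a..b}" "X c = U c" "Y c = V c" "t \<in> {a..b}"
  shows "X t = U t \<and> Y t = V t"
  using planar_solution_zero[OF planar_solution_lincomb[OF assms(1,2), of 1 "-1"] assms(3-5) _ _ assms(8)] assms(6,7)
  by simp

lemma planar_solution_exists:
  assumes "continuous_on {0..} k" "continuous_on {0..} q"
    and "\<And>t. t \<ge> 0 \<Longrightarrow> \<bar>k t\<bar> \<le> K" "\<And>t. t \<ge> 0 \<Longrightarrow> \<bar>q t\<bar> \<le> K"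
  obtains X Y where "planar_solution k q {0..} X Y" "X 0 = x0" "Y 0 = y0"
proof -
  define f where "f t z = (k t * snd z, - q t * fst z)" for t and z :: "real \<times> real"
  obtain Z where Z: "Z 0 = (x0, y0)"
      "\<And>t. t \<ge> 0 \<Longrightarrow> (Z has_vector_derivative f t (Z t)) (at t within {0..})"
  proof (rule global_lipschitz_ode_exists[of f K "(x0, y0)"])
    fix g S assume "S \<subseteq> {0..}" "continuous_on S (g :: real \<Rightarrow> real \<times> real)"
    then show "continuous_on S (\<lambda>t. f t (g t))"
      unfolding f_def using assms(1,2)
      by (intro continuous_intros) (auto intro: continuous_on_subset)
  next
    fix t :: real and x y :: "real \<times> real" assume t: "t \<ge> 0"
    have sq: "(k t * a)\<^sup>2 \<le> K\<^sup>2 * a\<^sup>2" "(q t * a)\<^sup>2 \<le> K\<^sup>2 * a\<^sup>2" for a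
      using assms(3,4)[OF t] by (auto simp: power_mult_distrib intro!: mult_right_mono abs_le_square_iff[THEN iffD1])
    have "K \<ge> 0" using assms(3)[OF t] by linarith
    have "norm (f t x - f t y) = sqrt ((k t * (snd x - snd y))\<^sup>2 + (q t * (fst x - fst y))\<^sup>2)"
      by (simp add: f_def norm_Pair algebra_simps power2_commute)
    also have "\<dots> \<le> sqrt (K\<^sup>2 * (snd x - snd y)\<^sup>2 + K\<^sup>2 * (fst x - fst y)\<^sup>2)"
      by (intro real_sqrt_le_mono add_mono sq)
    also have "\<dots> = sqrt (K\<^sup>2) * sqrt ((fst x - fst y)\<^sup>2 + (snd x - snd y)\<^sup>2)"
      unfolding real_sqrt_mult[symmetric] by (simp add: algebra_simps)
    also have "\<dots> = K * norm (x - y)" using \<open>K \<ge> 0\<close> by (simp add: norm_prod_def)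
    finally show "norm (f t x - f t y) \<le> K * norm (x - y)" .
  qed blast
  show ?thesis
  proof (rule that[of "\<lambda>t. fst (Z t)" "\<lambda>t. snd (Z t)"])
    show "planar_solution k q {0..} (\<lambda>t. fst (Z t)) (\<lambda>t. snd (Z t))"
      unfolding planar_solution_def has_real_derivative_iff_has_vector_derivative
    proof (intro ballI conjI)
      fix t :: real assume "t \<in> {0..}"
      then have d: "(Z has_vector_derivative f t (Z t)) (at t within {0..})" using Z by simp
      show "((\<lambda>t. fst (Z t)) has_vector_derivative k t * snd (Z t)) (at t within {0..})"
        using bounded_linear.has_vector_derivative[OF bounded_linear_fst d] by (simp add: f_def)
      show "((\<lambda>t. snd (Z t)) has_vector_derivative - q t * fst (Z t)) (at t within {0..})"
        using bounded_linear.has_vector_derivative[OF bounded_linear_snd d] by (simp add: f_def)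
    qed
  qed (simp_all add: Z)
qed

text \<open>A quantitative form of continuous dependence on the coefficients, from Gronwall applied to the squared
  distance of the two solutions; squaring keeps the quantity differentiable.\<close>

lemma planar_solution_perturb:
  assumes sol0: "planar_solution k q {0..b} X Y" and sol1: "planar_solution k1 q1 {0..b} X1 Y1"
    and init: "X1 0 = X 0" "Y1 0 = Y 0" and b: "b \<ge> 0"
    and K: "K > 0" "\<And>t. t \<in> {0..b} \<Longrightarrow> \<bar>k1 t\<bar> \<le> K" "\<And>t. t \<in> {0..b} \<Longrightarrow> \<bar>q1 t\<bar> \<le> K"
    and M: "\<And>t. t \<in> {0..b} \<Longrightarrow> \<bar>X t\<bar> \<le> M" "\<And>t. t \<in> {0..b} \<Longrightarrow> \<bar>Y t\<bar> \<le> M"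
    and d: "\<And>t. t \<in> {0..b} \<Longrightarrow> \<bar>k1 t - k t\<bar> \<le> d" "\<And>t. t \<in> {0..b} \<Longrightarrow> \<bar>q1 t - q t\<bar> \<le> d"
  shows "(X1 b - X b)\<^sup>2 + (Y1 b - Y b)\<^sup>2 \<le> 2 * (d * M)\<^sup>2 / (2 * K + 1) * exp ((2 * K + 1) * b)"
proof -
  define u v where "u t = X1 t - X t" and "v t = Y1 t - Y t" for t
  define N' where "N' t = 2 * (u t * (k1 t * v t + (k1 t - k t) * Y t) - v t * (q1 t * u t + (q1 t - q t) * X t))" for t
  have "(u b)\<^sup>2 + (v b)\<^sup>2 + 2 * (d * M)\<^sup>2 / (2 * K + 1)
      \<le> ((u 0)\<^sup>2 + (v 0)\<^sup>2 + 2 * (d * M)\<^sup>2 / (2 * K + 1)) * exp ((2 * K + 1) * (b - 0))"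
  proof (rule gronwall[where N' = N' and b = b])
    show "continuous_on {0..b} (\<lambda>t. (u t)\<^sup>2 + (v t)\<^sup>2)"
      unfolding u_def v_def
      by (intro continuous_intros planar_solution_continuous_on[OF sol0] planar_solution_continuous_on[OF sol1])
    fix t assume t: "0 < t" "t < b"
    show "((\<lambda>t. (u t)\<^sup>2 + (v t)\<^sup>2) has_real_derivative N' t) (at t)"
      unfolding u_def v_def N'_def
      using planar_solution_at_interior[OF sol0 t] planar_solution_at_interior[OF sol1 t]
      by (auto intro!: derivative_eq_intros simp: algebra_simps)
    have t': "t \<in> {0..b}" using t by simp
    have 1: "(k1 t - q1 t) * (2 * u t * v t) \<le> (2 * K) * ((u t)\<^sup>2 + (v t)\<^sup>2)"
    proof -
      have "(k1 t - q1 t) * (2 * u t * v t) \<le> \<bar>k1 t - q1 t\<bar> * \<bar>2 * u t * v t\<bar>"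
        by (metis abs_ge_self abs_mult)
      also have "\<dots> \<le> (2 * K) * ((u t)\<^sup>2 + (v t)\<^sup>2)"
        using K(2,3)[OF t'] sum_squares_bound[of "\<bar>u t\<bar>" "\<bar>v t\<bar>"] by (intro mult_mono) (auto simp: abs_mult)
      finally show ?thesis .
    qed
    have "\<bar>(k1 t - k t) * Y t\<bar> \<le> d * M" "\<bar>(q1 t - q t) * X t\<bar> \<le> d * M"
      unfolding abs_mult using d[OF t'] M[OF t'] by (intro mult_mono; linarith)+
    then have 2: "((k1 t - k t) * Y t)\<^sup>2 \<le> (d * M)\<^sup>2" "((q1 t - q t) * X t)\<^sup>2 \<le> (d * M)\<^sup>2"
      by (auto intro!: abs_le_square_iff[THEN iffD1])
    have "N' t = (k1 t - q1 t) * (2 * u t * v t) + 2 * u t * ((k1 t - k t) * Y t) - 2 * v t * ((q1 t - q t) * X t)"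
      by (simp add: N'_def algebra_simps)
    also have "\<dots> \<le> (2 * K) * ((u t)\<^sup>2 + (v t)\<^sup>2) + ((u t)\<^sup>2 + (d * M)\<^sup>2) + ((v t)\<^sup>2 + (d * M)\<^sup>2)"
      using 1 2 sum_squares_bound[of "u t" "(k1 t - k t) * Y t"] sum_squares_bound[of "v t" "- ((q1 t - q t) * X t)"]
      by simp
    finally show "N' t \<le> (2 * K + 1) * ((u t)\<^sup>2 + (v t)\<^sup>2) + 2 * (d * M)\<^sup>2"
      by (simp add: algebra_simps)
  qed (use K b in auto)
  moreover have "0 \<le> 2 * (d * M)\<^sup>2 / (2 * K + 1)" using K by auto
  ultimately show ?thesis using init by (simp add: u_def v_def)
qed

section \<open>Floquet theory of periodic planar systems\<close>

definition fundamental_system where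
  "fundamental_system k q c c' s s' \<longleftrightarrow>
     planar_solution k q {0..} c c' \<and> planar_solution k q {0..} s s' \<and>
     c 0 = 1 \<and> c' 0 = (0::real) \<and> s 0 = 0 \<and> s' 0 = (1::real)"

lemma fundamental_system_exists:
  assumes "continuous_on {0..} k" "continuous_on {0..} q"
    and "\<And>t. t \<ge> 0 \<Longrightarrow> \<bar>k t\<bar> \<le> K" "\<And>t. t \<ge> 0 \<Longrightarrow> \<bar>q t\<bar> \<le> K"
  obtains c c' s s' where "fundamental_system k q c c' s s'"
proof -
  obtain c c' where c: "planar_solution k q {0..} c c'" "c 0 = 1" "c' 0 = 0"
    by (rule planar_solution_exists[OF assms, of 1 0])
  obtain s s' where s: "planar_solution k q {0..} s s'" "s 0 = 0" "s' 0 = 1"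
    by (rule planar_solution_exists[OF assms, of 0 1])
  show ?thesis by (rule that[of c c' s s']) (simp add: fundamental_system_def c s)
qed

lemma fundamental_system_det:
  assumes "fundamental_system k q c c' s s'" "t \<ge> 0"
  shows "c t * s' t - s t * c' t = 1"
  using wronskian_constant[of k q "{0..}" c c' s s' 0 t] assms
  by (simp add: fundamental_system_def)

lemma solution_by_fundamental_system:
  assumes fs: "fundamental_system k q c c' s s'"
    and cont: "continuous_on {0..} k" "continuous_on {0..} q"
    and sol: "planar_solution k q {0..} X Y" and t: "t \<ge> 0"
  shows "X t = X 0 * c t + Y 0 * s t" "Y t = X 0 * c' t + Y 0 * s' t"
proof -
  have sol': "planar_solution k q {0..} (\<lambda>t. X 0 * c t + Y 0 * s t) (\<lambda>t. X 0 * c' t + Y 0 * s' t)"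
    using fs by (intro planar_solution_lincomb) (auto simp: fundamental_system_def)
  have "{0..t} \<subseteq> {0..}" by auto
  note sub = planar_solution_subset[OF sol this] planar_solution_subset[OF sol' this]
    continuous_on_subset[OF cont(1) this] continuous_on_subset[OF cont(2) this]
  have "X t = X 0 * c t + Y 0 * s t \<and> Y t = X 0 * c' t + Y 0 * s' t"
    using fs t by (intro planar_solution_unique[OF sub, of 0 t]) (auto simp: fundamental_system_def)
  then show "X t = X 0 * c t + Y 0 * s t" "Y t = X 0 * c' t + Y 0 * s' t" by auto
qed

text \<open>For \<open>\<bar>D\<bar> < 2\<close> the quadratic form \<open>x\<^sup>2 - D x y + y\<^sup>2\<close> is positive definite and invariant
  under the recursion. Evaluated at \<open>(f t, f (t + T))\<close> it is therefore a \<open>T\<close>-periodic, hence bounded,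
  function that controls \<open>f\<close>.\<close>

lemma recurrence_bounded:
  fixes f :: "real \<Rightarrow> real"
  assumes T: "T > 0" and D: "\<bar>D\<bar> < 2" and cont: "continuous_on {0..} f"
    and rec: "\<And>t. t \<ge> 0 \<Longrightarrow> f (t + 2 * T) = D * f (t + T) - f t"
  shows "\<exists>B. \<forall>t\<ge>0. \<bar>f t\<bar> \<le> B"
proof -
  \<comment> \<open>The invariant quadratic form along the orbit.\<close>
  define Q where "Q t = (f t)\<^sup>2 - D * f t * f (t + T) + (f (t + T))\<^sup>2" for t
  have per: "Q (t + T) = Q t" if "t \<ge> 0" for t
  proof -
    have e: "f (t + T + T) = D * f (t + T) - f t" 
    proof -
      have "t + T + T = t + 2 * T" by simp
      then show ?thesis using rec[OF that] by metis
    qed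
    show ?thesis unfolding Q_def e by (simp add: power2_eq_square algebra_simps)
  qed
  have per': "Q (t + real n * T) = Q t" if "t \<ge> 0" for t n
  proof (induction n)
    case (Suc n)
    have "Q (t + real (Suc n) * T) = Q ((t + real n * T) + T)" by (simp add: algebra_simps)
    then show ?case using Suc per[of "t + real n * T"] that T by simp
  qed simp
  have "continuous_on {0..T} Q"
    unfolding Q_def using T
    by (intro continuous_intros continuous_on_compose2[OF cont] continuous_on_subset[OF cont]) auto
  then have "bounded (Q ` {0..T})" by (intro compact_imp_bounded compact_continuous_image) auto
  then have "\<exists>M. \<forall>t\<in>{0..T}. \<bar>Q t\<bar> \<le> M" by (simp add: bounded_iff)
  then obtain M where M: "\<And>t. t \<in> {0..T} \<Longrightarrow> \<bar>Q t\<bar> \<le> M" by blast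
  have QM: "Q t \<le> M" if "t \<ge> 0" for t
  proof -
    define n where "n = nat \<lfloor>t / T\<rfloor>"
    define r where "r = t - real n * T"
    have "real n = of_int \<lfloor>t / T\<rfloor>" using that T by (simp add: n_def)
    then have "real n \<le> t / T" "t / T < real n + 1"
      using of_int_floor_le[of "t / T"] real_of_int_floor_add_one_gt[of "t / T"] by auto
    then have r: "r \<in> {0..T}" using T by (auto simp: r_def field_simps)
    have "Q t = Q (r + real n * T)" by (simp add: r_def)
    also have "\<dots> = Q r" using r by (intro per') auto
    finally show ?thesis using M[OF r] by linarith
  qed
  define d where "d = 1 - D\<^sup>2 / 4"
  have "\<bar>D\<bar>\<^sup>2 < 2\<^sup>2" using D by (intro power_strict_mono) auto
  then have d: "d > 0" by (simp add: d_def)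
  have "\<bar>f t\<bar> \<le> M / d + 1" if "t \<ge> 0" for t
  proof -
    have "Q t = d * (f t)\<^sup>2 + (f (t + T) - D / 2 * f t)\<^sup>2"
      by (simp add: Q_def d_def power2_eq_square algebra_simps)
    then have "d * (f t)\<^sup>2 \<le> M" using QM[OF that] zero_le_power2[of "f (t + T) - D / 2 * f t"] by linarith
    then have "(f t)\<^sup>2 \<le> M / d" using d by (simp add: field_simps)
    moreover have "\<bar>f t\<bar> \<le> (f t)\<^sup>2 + 1"
      using sum_squares_bound[of "\<bar>f t\<bar>" 1] by simp
    ultimately show ?thesis by linarith
  qed
  then show ?thesis by blast
qed

locale periodic_planar =
  fixes k q :: "real \<Rightarrow> real" and T :: real and c c' s s' :: "real \<Rightarrow> real"
  assumes T: "T > 0"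
    and k_cont: "continuous_on {0..} k" and q_cont: "continuous_on {0..} q"
    and k_periodic: "t \<ge> 0 \<Longrightarrow> k (t + T) = k t" and q_periodic: "t \<ge> 0 \<Longrightarrow> q (t + T) = q t"
    and fs: "fundamental_system k q c c' s s'"
begin

lemma shifted_solution:
  assumes "planar_solution k q {0..} X Y"
  shows "planar_solution k q {0..} (\<lambda>t. X (t + T)) (\<lambda>t. Y (t + T))"
  unfolding planar_solution_def
proof (intro ballI conjI)
  fix t :: real assume t: "t \<in> {0..}"
  have img: "(\<lambda>t. t + T) ` {0..} \<subseteq> {0..}" using T by auto
  have d: "((\<lambda>t. t + T) has_real_derivative 1) (at t within {0..})" by (auto intro!: derivative_eq_intros)
  have X: "(X has_real_derivative k (t + T) * Y (t + T)) (at (t + T) within (\<lambda>t. t + T) ` {0..})"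
    "(Y has_real_derivative - q (t + T) * X (t + T)) (at (t + T) within (\<lambda>t. t + T) ` {0..})"
    using assms t T unfolding planar_solution_def by (auto intro: DERIV_subset[OF _ img])
  show "((\<lambda>t. X (t + T)) has_real_derivative k t * Y (t + T)) (at t within {0..})"
    using DERIV_image_chain[OF X(1) d] k_periodic t by (simp add: o_def)
  show "((\<lambda>t. Y (t + T)) has_real_derivative - q t * X (t + T)) (at t within {0..})"
    using DERIV_image_chain[OF X(2) d] q_periodic t by (simp add: o_def)
qed

lemma shift_formula:
  assumes "planar_solution k q {0..} X Y" "t \<ge> 0"
  shows "X (t + T) = X T * c t + Y T * s t" "Y (t + T) = X T * c' t + Y T * s' t"
  using solution_by_fundamental_system[OF fs k_cont q_cont shifted_solution[OF assms(1)] assms(2)]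
  by simp_all

text \<open>The monodromy matrix has determinant 1 and trace \<open>c T + s' T\<close>, the discriminant of the system; its
  characteristic equation becomes a recursion in steps of the period, which every solution satisfies
  componentwise.\<close>

lemma cayley_hamilton:
  assumes sol: "planar_solution k q {0..} X Y" and t: "t \<ge> 0"
  shows "X (t + 2 * T) = (c T + s' T) * X (t + T) - X t"
    and "Y (t + 2 * T) = (c T + s' T) * Y (t + T) - Y t"
proof -
  have det: "c T * s' T - s T * c' T = 1" using fundamental_system_det[OF fs] T by simp
  have 0: "X T = X 0 * c T + Y 0 * s T" "Y T = X 0 * c' T + Y 0 * s' T"
    using solution_by_fundamental_system[OF fs k_cont q_cont sol, of T] T by simp_all
  have 1: "X (T + T) = X T * c T + Y T * s T" "Y (T + T) = X T * c' T + Y T * s' T"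
    using shift_formula[OF sol, of T] T by simp_all
  have 2: "X (T + T) = (c T + s' T) * X T - X 0" "Y (T + T) = (c T + s' T) * Y T - Y 0"
    unfolding 1 0 using det by algebra+
  have 3: "X (t + 2 * T) = X (T + T) * c t + Y (T + T) * s t" "Y (t + 2 * T) = X (T + T) * c' t + Y (T + T) * s' t"
  proof -
    have e: "t + 2 * T = t + T + T" by simp
    show "X (t + 2 * T) = X (T + T) * c t + Y (T + T) * s t" "Y (t + 2 * T) = X (T + T) * c' t + Y (T + T) * s' t"
      unfolding e using shift_formula[OF shifted_solution[OF sol] t] by auto
  qed
  have 4: "X t = X 0 * c t + Y 0 * s t" "Y t = X 0 * c' t + Y 0 * s' t"
    using solution_by_fundamental_system[OF fs k_cont q_cont sol t] .
  show "X (t + 2 * T) = (c T + s' T) * X (t + T) - X t" "Y (t + 2 * T) = (c T + s' T) * Y (t + T) - Y t"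
    unfolding 3 2 shift_formula[OF sol t] 4 by (simp_all add: algebra_simps)
qed

lemma solution_bounded:
  assumes "\<bar>c T + s' T\<bar> < 2" and sol: "planar_solution k q {0..} X Y"
  obtains B where "\<And>t. t \<ge> 0 \<Longrightarrow> \<bar>X t\<bar> \<le> B" "\<And>t. t \<ge> 0 \<Longrightarrow> \<bar>Y t\<bar> \<le> B"
proof -
  obtain B1 where B1: "\<And>t. t \<ge> 0 \<Longrightarrow> \<bar>X t\<bar> \<le> B1"
    using recurrence_bounded[OF T assms(1) planar_solution_continuous_on(1)[OF sol] cayley_hamilton(1)[OF sol]]
    by blast
  obtain B2 where B2: "\<And>t. t \<ge> 0 \<Longrightarrow> \<bar>Y t\<bar> \<le> B2"
    using recurrence_bounded[OF T assms(1) planar_solution_continuous_on(2)[OF sol] cayley_hamilton(2)[OF sol]]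
    by blast
  show ?thesis using B1 B2 by (intro that[of "max B1 B2"]) (auto intro: le_max_iff_disj[THEN iffD2])
qed

text \<open>Let \<open>\<mu>\<close> be the Floquet multiplier with \<open>\<bar>\<mu>\<bar> > 1\<close>. For every solution \<open>Z\<close>, the combination
  \<open>Z (t + T) - Z t / \<mu>\<close> is a solution with multiplier \<open>\<mu>\<close>. It cannot vanish for both columns of the
  fundamental matrix, since then the monodromy matrix would be \<open>1 / \<mu>\<close> times the identity and its
  determinant \<open>1 / \<mu>\<^sup>2 \<noteq> 1\<close>.\<close>

lemma growing_solution:
  assumes D: "\<bar>c T + s' T\<bar> > 2"
  obtains X Y \<mu> where "planar_solution k q {0..} X Y" "\<bar>\<mu>\<bar> > 1" "X 0 \<noteq> 0 \<or> Y 0 \<noteq> 0"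
    "\<And>t. t \<ge> 0 \<Longrightarrow> X (t + T) = \<mu> * X t" "\<And>t. t \<ge> 0 \<Longrightarrow> Y (t + T) = \<mu> * Y t"
proof -
  define D where "D = c T + s' T"
  \<comment> \<open>The root of larger modulus of \<open>x\<^sup>2 - D x + 1\<close>.\<close>
  define \<mu> where "\<mu> = (D + sgn D * sqrt (D\<^sup>2 - 4)) / 2"
  have "2\<^sup>2 < \<bar>D\<bar>\<^sup>2" using assms by (intro power_strict_mono) (auto simp: D_def)
  then have D4: "D\<^sup>2 - 4 > 0" by simp
  have sg: "(sgn D)\<^sup>2 = 1" "sgn D * D = \<bar>D\<bar>" using assms by (auto simp: D_def sgn_if abs_if)
  have "(2 * \<mu> - D)\<^sup>2 = D\<^sup>2 - 4"
  proof -
    have "2 * \<mu> - D = sgn D * sqrt (D\<^sup>2 - 4)" unfolding \<mu>_def by algebra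
    then show ?thesis using sg D4 by (simp add: power_mult_distrib)
  qed
  then have mu: "\<mu>\<^sup>2 - D * \<mu> + 1 = 0" by (simp add: power2_eq_square algebra_simps)
  have sgn_mu: "sgn D * \<mu> = (\<bar>D\<bar> + sqrt (D\<^sup>2 - 4)) / 2"
    using sg by (simp add: \<mu>_def algebra_simps power2_eq_square)
  have "\<bar>D\<bar> > 2" using D by (simp add: D_def)
  then have "(\<bar>D\<bar> + r) / 2 > 1" if "r > 0" for r using that by simp
  then have "sgn D * \<mu> > 1" unfolding sgn_mu using D4 by simp
  moreover have "sgn D * \<mu> \<le> \<bar>\<mu>\<bar>" by (auto simp: sgn_if)
  ultimately have big: "\<bar>\<mu>\<bar> > 1" by linarith
  then have nz: "\<mu> \<noteq> 0" by auto
  define U where "U X t = X (t + T) - X t / \<mu>" for X :: "real \<Rightarrow> real" and t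
  have Usol: "planar_solution k q {0..} (U X) (U Y)" if "planar_solution k q {0..} X Y" for X Y
    using planar_solution_lincomb[OF shifted_solution[OF that] that, of 1 "- inverse \<mu>"]
    unfolding U_def[abs_def] by (simp add: field_simps)
  have mult: "U X (t + T) = \<mu> * U X t" if "X (t + 2 * T) = D * X (t + T) - X t" for X t
  proof -
    have D: "D - 1 / \<mu> = \<mu>" using mu nz by (simp add: field_simps power2_eq_square)
    have e: "t + T + T = t + 2 * T" by simp
    have "U X (t + T) = (D - 1 / \<mu>) * X (t + T) - X t"
      unfolding U_def e that by (simp add: algebra_simps)
    then show ?thesis unfolding D using nz by (simp add: U_def right_diff_distrib)
  qed
  have "\<not> (U c 0 = 0 \<and> U c' 0 = 0 \<and> U s 0 = 0 \<and> U s' 0 = 0)"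
  proof
    assume "U c 0 = 0 \<and> U c' 0 = 0 \<and> U s 0 = 0 \<and> U s' 0 = 0"
    then have "c T = 1 / \<mu>" "c' T = 0" "s T = 0" "s' T = 1 / \<mu>"
      using fs by (simp_all add: U_def fundamental_system_def)
    moreover have "c T * s' T - s T * c' T = 1" using fundamental_system_det[OF fs] T by simp
    ultimately have "(1 / \<mu>) * (1 / \<mu>) = 1" by simp
    then have "\<mu>\<^sup>2 = 1" using nz by (simp add: field_simps power2_eq_square)
    then show False using big by (simp add: power2_eq_1_iff) auto
  qed
  moreover have "planar_solution k q {0..} c c'" "planar_solution k q {0..} s s'"
    using fs by (auto simp: fundamental_system_def)
  ultimately obtain X Y where XY: "planar_solution k q {0..} X Y" "U X 0 \<noteq> 0 \<or> U Y 0 \<noteq> 0"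
    by blast
  show ?thesis
    using cayley_hamilton[OF XY(1)] XY big
    by (intro that[of "U X" "U Y" \<mu>] Usol mult) (auto simp: D_def)
qed

end

section \<open>The hypergeometric series and its value at 1\<close>

definition hyp_coeff :: "real \<Rightarrow> real \<Rightarrow> real \<Rightarrow> nat \<Rightarrow> real" where
  "hyp_coeff a b c r = pochhammer a r * pochhammer b r / (pochhammer c r * fact r)"

definition hyp :: "real \<Rightarrow> real \<Rightarrow> real \<Rightarrow> real \<Rightarrow> real" where
  "hyp a b c x = (\<Sum>r. hyp_coeff a b c r * x ^ r)"

lemma hyp_coeff_0 [simp]: "hyp_coeff a b c 0 = 1"
  by (simp add: hyp_coeff_def)

lemma hyp_at_0 [simp]: "hyp a b c 0 = 1"
  using powser_zero[of "hyp_coeff a b c"] by (simp add: hyp_def)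

lemma hyp_coeff_Suc:
  assumes "c > 0"
  shows "(c + real r) * (1 + real r) * hyp_coeff a b c (Suc r) = (a + real r) * (b + real r) * hyp_coeff a b c r"
proof -
  have "pochhammer c r > 0" using assms by (rule pochhammer_pos)
  moreover have "c + r > 0" using assms by simp
  ultimately show ?thesis
    unfolding hyp_coeff_def pochhammer_Suc fact_Suc
    by (simp add: divide_simps)
qed

text \<open>Each Pochhammer symbol is comparable to a factorial times a power, by the product limit of the
  reciprocal Gamma function.\<close>

lemma hyp_coeff_decay:
  assumes "c > 0"
  obtains K where "\<And>n. n \<ge> 1 \<Longrightarrow>
    real (Suc n) * \<bar>hyp_coeff a b c (Suc n)\<bar> \<le> K * real n powr (a + b - c)"
proof -
  define u where "u n = rGamma_series a n * rGamma_series b n / rGamma_series c n" for n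
  have "rGamma c \<noteq> 0"
    using assms by (auto simp: rGamma_eq_zero_iff elim!: nonpos_Ints_cases)
  then have "u \<longlonglongrightarrow> rGamma a * rGamma b / rGamma c"
    unfolding u_def by (intro tendsto_intros)
  then have "Bseq u" by (intro convergent_imp_Bseq convergentI)
  then obtain K where K: "\<And>n. norm (u n) \<le> K" by (auto simp: Bseq_def)
  have "real (Suc n) * \<bar>hyp_coeff a b c (Suc n)\<bar> \<le> K * real n powr (a + b - c)" if "n \<ge> 1" for n
  proof -
    have p: "pochhammer z (Suc n) = rGamma_series z n * (fact n * real n powr z)" for z :: real
      using that by (simp add: rGamma_series_def powr_def)
    have "pochhammer c (Suc n) > 0" using assms by (rule pochhammer_pos)
    then have nz: "rGamma_series c n \<noteq> 0" using p[of c] by auto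
    have "real (Suc n) * hyp_coeff a b c (Suc n) = u n * real n powr (a + b - c)"
      unfolding hyp_coeff_def p fact_Suc u_def powr_diff powr_add using nz that
      by (simp add: divide_simps)
    then have "real (Suc n) * \<bar>hyp_coeff a b c (Suc n)\<bar> = \<bar>u n\<bar> * real n powr (a + b - c)"
      using abs_mult[of "real (Suc n)" "hyp_coeff a b c (Suc n)"] abs_mult[of "u n" "real n powr (a + b - c)"]
      by simp
    also have "\<dots> \<le> K * real n powr (a + b - c)"
      using K[of n] by (intro mult_right_mono) auto
    finally show ?thesis .
  qed
  then show ?thesis using that by blast
qed

lemma hyp_coeff_summable:
  assumes "c > 0" and "c - a - b > 0"
  shows "summable (\<lambda>r. \<bar>hyp_coeff a b c r\<bar>)"
proof -
  obtain K where K: "\<And>n. n \<ge> 1 \<Longrightarrow>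
      real (Suc n) * \<bar>hyp_coeff a b c (Suc n)\<bar> \<le> K * real n powr (a + b - c)"
    using hyp_coeff_decay[OF assms(1)] by metis
  have bound: "norm \<bar>hyp_coeff a b c (Suc n)\<bar> \<le> K * real n powr (a + b - c - 1)" if "n \<ge> 1" for n
  proof -
    have "real n * \<bar>hyp_coeff a b c (Suc n)\<bar> \<le> real (Suc n) * \<bar>hyp_coeff a b c (Suc n)\<bar>"
      by (intro mult_right_mono) auto
    also have "\<dots> \<le> K * real n powr (a + b - c)" by (rule K[OF that])
    also have "\<dots> = real n * (K * real n powr (a + b - c - 1))"
      using that by (simp add: powr_diff)
    finally show ?thesis using that by simp
  qed
  have "summable (\<lambda>n. K * real n powr (a + b - c - 1))"
    using assms by (intro summable_mult) (simp add: summable_real_powr_iff)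
  then have "summable (\<lambda>n. \<bar>hyp_coeff a b c (Suc n)\<bar>)"
    by (rule summable_comparison_test'[of _ 1]) (rule bound)
  then show ?thesis
    by (subst (asm) summable_Suc_iff[where f = "\<lambda>r. \<bar>hyp_coeff a b c r\<bar>"])
qed

lemma hyp_coeff_times_index_LIMSEQ:
  assumes "c > 0" and "c - a - b > 0"
  shows "(\<lambda>r. real r * hyp_coeff a b c r) \<longlonglongrightarrow> 0"
proof -
  obtain K where K: "\<And>n. n \<ge> 1 \<Longrightarrow>
      real (Suc n) * \<bar>hyp_coeff a b c (Suc n)\<bar> \<le> K * real n powr (a + b - c)"
    using hyp_coeff_decay[OF assms(1)] by metis
  have "(\<lambda>n. K * real n powr (a + b - c)) \<longlonglongrightarrow> K * 0"
    using assms by (intro tendsto_mult tendsto_const tendsto_neg_powr filterlim_real_sequentially) simp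
  then have "(\<lambda>n. real (Suc n) * hyp_coeff a b c (Suc n)) \<longlonglongrightarrow> 0"
    by (rule_tac Lim_null_comparison[rotated])
       (auto simp: eventually_sequentially abs_mult intro!: exI[of _ 1] K[simplified])
  then show ?thesis
    using filterlim_sequentially_Suc[of "\<lambda>r. real r * hyp_coeff a b c r"] by blast
qed

lemma hyp_at_1: "hyp a b c 1 = (\<Sum>r. hyp_coeff a b c r)"
  by (simp add: hyp_def)

text \<open>After multiplication with the constants, the difference of the coefficients of the two series is the
  decrease of \<open>c r hyp_coeff a b c r\<close> from \<open>r\<close> to \<open>r + 1\<close>. This quantity is 0 at \<open>r = 0\<close> and tends to
  0, so the sum of the differences telescopes to 0.\<close>

lemma hyp_contiguous:
  assumes "c > 0" and "c - a - b > 0"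
  shows "c * (c - a - b) * hyp a b c 1 = (c - a) * (c - b) * hyp a b (c + 1) 1"
proof -
  let ?A = "hyp_coeff a b c" and ?A' = "hyp_coeff a b (c + 1)"
  have s: "summable ?A" "summable ?A'"
    using hyp_coeff_summable[of c a b] hyp_coeff_summable[of "c+1" a b] assms
    by (auto intro: summable_rabs_cancel)
  have shift: "(c + r) * ?A' r = c * ?A r" for r
  proof -
    have "pochhammer (c+1) r * c = pochhammer c r * (c + r)"
      using pochhammer_rec[of c r] pochhammer_Suc[of c r] by (simp add: mult_ac)
    moreover have "pochhammer (c+1) r > 0" "pochhammer c r > 0"
      using assms by (auto intro!: pochhammer_pos)
    ultimately show ?thesis
      unfolding hyp_coeff_def by (simp add: divide_simps) algebra
  qed
  have tele: "c * (c - a - b) * ?A r - (c - a) * (c - b) * ?A' r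
      = c * (real r * ?A r) - c * (real (Suc r) * ?A (Suc r))" for r
  proof -
    have cr: "c + r > 0" using assms by simp
    have "(c + r) * (c * (c - a - b) * ?A r - (c - a) * (c - b) * ?A' r)
        = c * (c - a - b) * ((c + r) * ?A r) - (c - a) * (c - b) * ((c + r) * ?A' r)"
      by (simp only: right_diff_distrib mult.assoc mult.left_commute)
    also have "\<dots> = (c + r) * (c * (real r * ?A r)) - c * ((c + real r) * (1 + real r) * ?A (Suc r))"
      unfolding hyp_coeff_Suc[OF assms(1)] shift by (simp add: algebra_simps)
    also have "\<dots> = (c + r) * (c * (real r * ?A r) - c * (real (Suc r) * ?A (Suc r)))"
      by (simp add: algebra_simps)
    finally show ?thesis using cr by simp
  qed
  have "(\<lambda>r. c * (real r * ?A r) - c * (real (Suc r) * ?A (Suc r))) sums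
      (c * (real 0 * ?A 0) - c * 0)"
    by (intro telescope_sums' tendsto_mult tendsto_const hyp_coeff_times_index_LIMSEQ assms)
  then have "(\<lambda>r. c * (c - a - b) * ?A r - (c - a) * (c - b) * ?A' r) sums 0"
    by (simp only: tele) simp
  moreover have "(\<lambda>r. c * (c - a - b) * ?A r - (c - a) * (c - b) * ?A' r) sums
      (c * (c - a - b) * suminf ?A - (c - a) * (c - b) * suminf ?A')"
    using s by (intro sums_diff sums_mult summable_sums)
  ultimately have "0 = c * (c - a - b) * suminf ?A - (c - a) * (c - b) * suminf ?A'"
    by (rule sums_unique2)
  then show ?thesis by (simp add: hyp_at_1)
qed

text \<open>For positive index, the coefficients with parameter \<open>c + n\<close> are in modulus at most \<open>c / (c + n)\<close> times
  those with parameter \<open>c\<close>.\<close>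

lemma hyp_at_1_large_c:
  assumes "c > 0" and "c - a - b > 0"
  shows "(\<lambda>n. hyp a b (c + real n) 1) \<longlonglongrightarrow> 1"
proof -
  let ?A = "hyp_coeff a b c"
  define T where "T = (\<Sum>r. \<bar>?A r\<bar>)"
  have sA: "summable (\<lambda>r. \<bar>?A r\<bar>)" by (rule hyp_coeff_summable[OF assms])
  then have sA': "summable (\<lambda>r. \<bar>?A (Suc r)\<bar>)"
    by (subst summable_Suc_iff[where f = "\<lambda>r. \<bar>?A r\<bar>"])
  have bound: "norm (hyp a b (c + real n) 1 - 1) \<le> c / (c + real n) * T" for n
  proof -
    let ?B = "hyp_coeff a b (c + real n)"
    have sB: "summable (\<lambda>r. \<bar>?B r\<bar>)" using assms by (intro hyp_coeff_summable) auto
    then have sB': "summable ?B" by (rule summable_rabs_cancel)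
    have bd: "\<bar>?B (Suc r)\<bar> \<le> c / (c + real n) * \<bar>?A (Suc r)\<bar>" for r
    proof -
      have pp: "0 < pochhammer (c + 1) r" "pochhammer (c + 1) r \<le> pochhammer (c + real n + 1) r"
        using assms
         apply (intro pochhammer_pos, simp)
        unfolding pochhammer_prod using assms by (intro prod_mono) auto
      have "\<bar>?B (Suc r)\<bar> = (\<bar>pochhammer a (Suc r) * pochhammer b (Suc r)\<bar> / fact (Suc r))
          * (1 / ((c + n) * pochhammer (c + real n + 1) r))"
        unfolding hyp_coeff_def pochhammer_rec[of "c + real n"] using assms pp
        by (simp add: abs_mult divide_simps)
      also have "\<dots> \<le> (\<bar>pochhammer a (Suc r) * pochhammer b (Suc r)\<bar> / fact (Suc r))
          * (1 / ((c + n) * pochhammer (c + 1) r))"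
        using assms pp by (intro mult_left_mono divide_left_mono mult_pos_pos) auto
      also have "\<dots> = c / (c + real n) * \<bar>?A (Suc r)\<bar>"
        unfolding hyp_coeff_def pochhammer_rec[of c] using assms pp
        by (simp add: abs_mult divide_simps)
      finally show ?thesis .
    qed
    have "hyp a b (c + real n) 1 - 1 = (\<Sum>r. ?B (Suc r))"
      using suminf_split_head[OF sB'] by (simp add: hyp_at_1)
    also have "norm \<dots> \<le> (\<Sum>r. c / (c + real n) * \<bar>?A (Suc r)\<bar>)"
      by (rule norm_suminf_le) (use bd summable_mult[OF sA'] in auto)
    also have "\<dots> = c / (c + real n) * (\<Sum>r. \<bar>?A (Suc r)\<bar>)"
      by (rule suminf_mult[OF sA'])
    also have "\<dots> \<le> c / (c + real n) * T"
      using assms suminf_split_head[OF sA] unfolding T_def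
      by (intro mult_left_mono) simp_all
    finally show ?thesis .
  qed
  have "(\<lambda>n. c / (c + real n)) \<longlonglongrightarrow> 0"
    by (rule real_tendsto_divide_at_top[OF tendsto_const
          filterlim_tendsto_add_at_top[OF tendsto_const filterlim_real_sequentially]])
  then have "(\<lambda>n. c / (c + real n) * T) \<longlonglongrightarrow> 0"
    by (rule tendsto_mult_left_zero)
  then have "(\<lambda>n. hyp a b (c + real n) 1 - 1) \<longlonglongrightarrow> 0"
    by (rule Lim_null_comparison[OF always_eventually, rotated]) (use bound in simp)
  then show ?thesis by (rule LIM_zero_cancel)
qed

text \<open>Gauss's summation theorem. Raising \<open>c\<close> to \<open>c + n\<close> by the contiguous relation produces quotients of
  Pochhammer symbols, which converge to Gamma values while the remaining series converges to 1. With
  the entire function \<open>rGamma\<close> no poles need to be excluded.\<close>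

theorem gauss_summation:
  assumes "c > 0" and "c - a - b > 0"
  shows "rGamma c * rGamma (c - a - b) * hyp a b c 1 = rGamma (c - a) * rGamma (c - b)"
proof -
  have rec: "pochhammer c n * pochhammer (c - a - b) n * hyp a b c 1
      = pochhammer (c - a) n * pochhammer (c - b) n * hyp a b (c + real n) 1" for n
  proof (induction n)
    case (Suc n)
    have "pochhammer c (Suc n) * pochhammer (c - a - b) (Suc n) * hyp a b c 1
        = (c + n) * (c + n - a - b) * (pochhammer c n * pochhammer (c - a - b) n * hyp a b c 1)"
      by (simp add: pochhammer_Suc algebra_simps)
    also have "\<dots> = pochhammer (c - a) n * pochhammer (c - b) n
        * ((c + n) * (c + n - a - b) * hyp a b (c + real n) 1)"
      unfolding Suc by (simp add: algebra_simps)
    also have "\<dots> = pochhammer (c - a) n * pochhammer (c - b) n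
        * ((c + n - a) * (c + n - b) * hyp a b (c + real n + 1) 1)"
      using assms by (subst hyp_contiguous) auto
    also have "\<dots> = pochhammer (c - a) (Suc n) * pochhammer (c - b) (Suc n) * hyp a b (c + real (Suc n)) 1"
      by (simp add: pochhammer_Suc algebra_simps)
    finally show ?case .
  qed simp
  have rec': "rGamma_series c n * rGamma_series (c - a - b) n * hyp a b c 1
      = rGamma_series (c - a) n * rGamma_series (c - b) n * hyp a b (c + real (Suc n)) 1"
    if "n \<ge> 1" for n
  proof -
    have p: "pochhammer z (Suc n) = rGamma_series z n * (fact n * real n powr z)" for z :: real
      using that by (simp add: rGamma_series_def powr_def)
    have "real n powr c * real n powr (c - a - b) = real n powr (c - a) * real n powr (c - b)"
      by (simp flip: powr_add)
    moreover have "real n powr c * real n powr (c - a - b) \<noteq> 0" using that by simp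
    ultimately show ?thesis
      using rec[of "Suc n"] unfolding p
      by (simp add: mult.assoc mult.left_commute)
  qed
  have L: "(\<lambda>n. rGamma_series c n * rGamma_series (c - a - b) n * hyp a b c 1)
      \<longlonglongrightarrow> rGamma c * rGamma (c - a - b) * hyp a b c 1"
    by (intro tendsto_intros)
  have "(\<lambda>n. hyp a b (c + real (Suc n)) 1) \<longlonglongrightarrow> 1"
    using LIMSEQ_Suc[OF hyp_at_1_large_c[OF assms]] .
  then have "(\<lambda>n. rGamma_series (c - a) n * rGamma_series (c - b) n * hyp a b (c + real (Suc n)) 1)
      \<longlonglongrightarrow> rGamma (c - a) * rGamma (c - b) * 1"
    by (intro tendsto_intros)
  moreover have "\<forall>\<^sub>F n in sequentially. rGamma_series (c - a) n * rGamma_series (c - b) n * hyp a b (c + real (Suc n)) 1 =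
     rGamma_series c n * rGamma_series (c - a - b) n * hyp a b c 1"
    using rec' by (auto simp: eventually_sequentially intro!: exI[of _ 1])
  ultimately have "(\<lambda>n. rGamma_series c n * rGamma_series (c - a - b) n * hyp a b c 1)
      \<longlonglongrightarrow> rGamma (c - a) * rGamma (c - b) * 1"
    by (rule Lim_transform_eventually)
  then have "(\<lambda>n. rGamma_series c n * rGamma_series (c - a - b) n * hyp a b c 1)
      \<longlonglongrightarrow> rGamma (c - a) * rGamma (c - b)" by (simp only: mult_1_right)
  then show ?thesis by (rule LIMSEQ_unique[OF L])
qed

lemma hyp_continuous_on_Icc:
  assumes "c > 0" and "c - a - b > 0"
  shows "continuous_on {0..1} (hyp a b c)"
proof -
  have "uniform_limit {0..1} (\<lambda>n x. \<Sum>r<n. hyp_coeff a b c r * x ^ r) (\<lambda>x. \<Sum>r. hyp_coeff a b c r * x ^ r) sequentially"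
    by (rule Weierstrass_m_test[OF _ hyp_coeff_summable[OF assms]])
       (auto simp: abs_mult intro!: mult_left_le power_le_one)
  then have "continuous_on {0..1} (\<lambda>x. \<Sum>r. hyp_coeff a b c r * x ^ r)"
    by (rule uniform_limit_theorem[OF always_eventually, rotated]) (simp, intro allI continuous_intros)
  then show ?thesis by (simp add: hyp_def[abs_def])
qed

text \<open>The recursion of the coefficients is the hypergeometric equation for the formal power series.\<close>

lemma hyp_ode:
  assumes "c > 0" and "c - a - b > 0"
  obtains F' F'' where
    "\<And>x. \<bar>x\<bar> < 1 \<Longrightarrow> (hyp a b c has_real_derivative F' x) (at x)"
    "\<And>x. \<bar>x\<bar> < 1 \<Longrightarrow> (F' has_real_derivative F'' x) (at x)"
    "\<And>x. \<bar>x\<bar> < 1 \<Longrightarrow> x * (1 - x) * F'' x + (c - (a + b + 1) * x) * F' x = a * b * hyp a b c x"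
proof -
  let ?A = "hyp_coeff a b c"
  define f where "f = Abs_fps ?A"
  have "summable (\<lambda>r. ?A r * 1 ^ r)"
    using hyp_coeff_summable[OF assms] by (simp add: summable_rabs_cancel)
  then have r1: "1 \<le> fps_conv_radius f"
    using conv_radius_geI[of ?A 1] by (simp add: fps_conv_radius_def f_def one_ereal_def)
  have r: "ereal (norm x) < fps_conv_radius f" if "\<bar>x\<bar> < 1" for x :: real
    by (rule less_le_trans[OF _ r1]) (use that in \<open>simp add: one_ereal_def\<close>)
  have r': "ereal (norm x) < fps_conv_radius (fps_deriv f)"
           "ereal (norm x) < fps_conv_radius (fps_deriv (fps_deriv f))" if "\<bar>x\<bar> < 1" for x :: real
    using r[OF that] fps_conv_radius_deriv[of f] fps_conv_radius_deriv[of "fps_deriv f"] by auto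
  have h: "hyp a b c = eval_fps f" by (auto simp: hyp_def eval_fps_def f_def)
  have id: "fps_X * (1 - fps_X) * fps_deriv (fps_deriv f) + (fps_const c - fps_const (a + b + 1) * fps_X) * fps_deriv f
      = fps_const (a * b) * f" (is "?L = ?R")
  proof (rule fps_ext)
    fix n
    show "fps_nth ?L n = fps_nth ?R n"
    proof (cases n)
      case 0
      then show ?thesis using hyp_coeff_Suc[OF assms(1), of 0 a b]
        by (simp add: f_def algebra_simps)
    next
      case (Suc k)
      have e: "?L = fps_X * fps_deriv (fps_deriv f) - fps_X * (fps_X * fps_deriv (fps_deriv f)) + fps_const c * fps_deriv f
          - fps_const (a+b+1) * (fps_X * fps_deriv f)" by (simp add: algebra_simps)
      have "(c + real (Suc k)) * (1 + real (Suc k)) * ?A (Suc (Suc k)) = (a + real (Suc k)) * (b + real (Suc k)) * ?A (Suc k)"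
        by (rule hyp_coeff_Suc[OF assms(1)])
      then show ?thesis unfolding e Suc
        by (cases k) (simp_all add: f_def algebra_simps)
    qed
  qed
  show ?thesis
  proof (rule that[of "eval_fps (fps_deriv f)" "eval_fps (fps_deriv (fps_deriv f))"])
    fix x :: real assume x: "\<bar>x\<bar> < 1"
    show "(hyp a b c has_real_derivative eval_fps (fps_deriv f) x) (at x)"
      unfolding h by (intro has_field_derivative_eval_fps r x)
    show "(eval_fps (fps_deriv f) has_real_derivative eval_fps (fps_deriv (fps_deriv f)) x) (at x)"
      by (intro has_field_derivative_eval_fps r' x)
    have m: "eval_fps (p * q) x = eval_fps p x * eval_fps q x" "ereal (norm x) < fps_conv_radius (p * q)"
        if "ereal (norm x) < fps_conv_radius p" "ereal (norm x) < fps_conv_radius q" for p q :: "real fps"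
      by (auto intro!: eval_fps_mult less_le_trans[OF _ fps_conv_radius_mult] simp: that[unfolded real_norm_def])
    have d: "eval_fps (p - q) x = eval_fps p x - eval_fps q x" "ereal (norm x) < fps_conv_radius (p - q)"
        if "ereal (norm x) < fps_conv_radius p" "ereal (norm x) < fps_conv_radius q" for p q :: "real fps"
      by (auto intro!: eval_fps_diff less_le_trans[OF _ fps_conv_radius_diff] simp: that[unfolded real_norm_def])
    have p: "eval_fps (p + q) x = eval_fps p x + eval_fps q x"
        if "ereal (norm x) < fps_conv_radius p" "ereal (norm x) < fps_conv_radius q" for p q :: "real fps"
      using that by (intro eval_fps_add)
    have "eval_fps (fps_X * (1 - fps_X) * fps_deriv (fps_deriv f) + (fps_const c - fps_const (a + b + 1) * fps_X) * fps_deriv f) x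
      = eval_fps (fps_const (a * b) * f) x" by (simp only: id)
    then show "x * (1 - x) * eval_fps (fps_deriv (fps_deriv f)) x + (c - (a + b + 1) * x) * eval_fps (fps_deriv f) x
        = a * b * hyp a b c x"
      using r[OF x] r'[OF x] by (simp add: m d p h del: real_norm_def)
  qed
qed

section \<open>The limiting Hill equation in the phase variable\<close>

lemma cos_times_shifted_sin:
  fixes a :: real
  shows "cos (pi * a) * sin (pi * (1/4 + a)) = (sin (2 * pi * a + pi / 4) + sqrt 2 / 2) / 2"
proof -
  have "cos (pi * a) * sin (pi * (1/4 + a)) = (sin (pi * (1/4 + a) + pi * a) + sin (pi * (1/4 + a) - pi * a)) / 2"
    by (metis mult.commute sin_times_cos)
  also have "pi * (1/4 + a) + pi * a = 2 * pi * a + pi / 4" by (simp add: algebra_simps)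
  also have "pi * (1/4 + a) - pi * a = pi / 4" by (simp add: algebra_simps)
  finally show ?thesis by (simp add: sin_45)
qed

lemma rGamma_reflection_real:
  fixes x :: real
  shows "rGamma x * rGamma (1 - x) = sin (pi * x) / pi"
proof -
  have "complex_of_real (rGamma x * rGamma (1 - x)) = complex_of_real (sin (pi * x) / pi)"
    using rGamma_reflection_complex[of "complex_of_real x"]
      rGamma_complex_of_real[of x] rGamma_complex_of_real[of "1 - x"] sin_of_real[of "pi * x", where 'a = complex]
    by simp
  then show ?thesis by (simp only: of_real_eq_iff)
qed

text \<open>In the product of the two Gauss sums, the Gamma values pair up as \<open>x\<close>, \<open>1 - x\<close> with
  \<open>x = 1/4 + \<alpha>\<close> and \<open>x = 1/2 + \<alpha>\<close>, so that the reflection formula leaves only sines.\<close>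

lemma hyp_product:
  fixes \<alpha> :: real
  defines "\<beta> \<equiv> 1/4 - \<alpha>"
  shows "hyp \<alpha> \<beta> (1/2) 1 * hyp \<alpha> \<beta> (3/4) 1 = (sqrt 2 * sin (2 * pi * \<alpha> + pi / 4) + 1) / 2"
proof -
  have G1: "rGamma (1/2) * rGamma (1/4) * hyp \<alpha> \<beta> (1/2) 1 = rGamma (1/2 - \<alpha>) * rGamma (1/4 + \<alpha>)"
    using gauss_summation[of "1/2" \<alpha> \<beta>] by (simp add: \<beta>_def)
  have G2: "rGamma (3/4) * rGamma (1/2) * hyp \<alpha> \<beta> (3/4) 1 = rGamma (3/4 - \<alpha>) * rGamma (1/2 + \<alpha>)"
    using gauss_summation[of "3/4" \<alpha> \<beta>] by (simp add: \<beta>_def)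
  have r0: "rGamma (1/2) * rGamma (1/2 :: real) = 1 / pi"
    using rGamma_reflection_real[of "1/2"] by simp
  have r1: "rGamma (1/4) * rGamma (3/4 :: real) = sqrt 2 / 2 / pi"
    using rGamma_reflection_real[of "1/4"] by (simp add: sin_45)
  have r2: "rGamma (1/4 + \<alpha>) * rGamma (3/4 - \<alpha>) = sin (pi * (1/4 + \<alpha>)) / pi"
    using rGamma_reflection_real[of "1/4 + \<alpha>"] by (simp add: algebra_simps)
  have "rGamma (1/2 + \<alpha>) * rGamma (1/2 - \<alpha>) = sin (pi * (1/2 + \<alpha>)) / pi"
    using rGamma_reflection_real[of "1/2 + \<alpha>"] by (simp add: algebra_simps)
  also have "sin (pi * (1/2 + \<alpha>)) = cos (pi * \<alpha>)"
    using sin_add[of "pi/2" "pi * \<alpha>"] by (simp add: algebra_simps)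
  finally have r3: "rGamma (1/2 + \<alpha>) * rGamma (1/2 - \<alpha>) = cos (pi * \<alpha>) / pi" .
  let ?p = "hyp \<alpha> \<beta> (1/2) 1 * hyp \<alpha> \<beta> (3/4) 1"
  have "(rGamma (1/2) * rGamma (1/2)) * (rGamma (1/4) * rGamma (3/4)) * ?p
      = (rGamma (1/2) * rGamma (1/4) * hyp \<alpha> \<beta> (1/2) 1) * (rGamma (3/4) * rGamma (1/2) * hyp \<alpha> \<beta> (3/4) 1)"
    by (simp only: ac_simps)
  also have "\<dots> = (rGamma (1/4 + \<alpha>) * rGamma (3/4 - \<alpha>)) * (rGamma (1/2 + \<alpha>) * rGamma (1/2 - \<alpha>))"
    unfolding G1 G2 by (simp only: ac_simps)
  finally have "sqrt 2 / 2 * ?p = cos (pi * \<alpha>) * sin (pi * (1/4 + \<alpha>))"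
    unfolding r0 r1 r2 r3 by (simp add: field_simps)
  then have "sqrt 2 * (sqrt 2 / 2 * ?p) = sqrt 2 * ((sin (2 * pi * \<alpha> + pi / 4) + sqrt 2 / 2) / 2)"
    unfolding cos_times_shifted_sin by simp
  also have "sqrt 2 * (sqrt 2 / 2 * ?p) = ?p" by simp
  finally show ?thesis by (simp add: algebra_simps)
qed

text \<open>The square of \<open>d\<theta>/ds\<close> for the angle in \<open>v = cos \<theta>\<close>, where \<open>v\<close> solves \<open>v'' + \<epsilon> v + v\<^sup>3 = 0\<close> with
  amplitude 1 in the rescaled time \<open>s\<close>.\<close>

definition speed2 :: "real \<Rightarrow> real \<Rightarrow> real" where
  "speed2 \<epsilon> \<theta> = \<epsilon> + (1 + (cos \<theta>)\<^sup>2) / 2"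

text \<open>The coefficients of the planar system that \<open>\<xi>'' + (\<epsilon>' + \<gamma> v\<^sup>2) \<xi> = 0\<close>, with \<open>v = cos \<theta>\<close> as
  above, becomes for the pair \<open>(\<xi>, d\<xi>/ds)\<close> and the independent variable \<open>\<theta>\<close>.\<close>

definition hill_k :: "real \<Rightarrow> real \<Rightarrow> real" where
  "hill_k \<epsilon> \<theta> = 1 / sqrt (speed2 \<epsilon> \<theta>)"

definition hill_q :: "real \<Rightarrow> real \<Rightarrow> real \<Rightarrow> real \<Rightarrow> real" where
  "hill_q \<gamma> \<epsilon> \<epsilon>' \<theta> = (\<epsilon>' + \<gamma> * (cos \<theta>)\<^sup>2) / sqrt (speed2 \<epsilon> \<theta>)"

lemma speed2_ge: "\<epsilon> \<ge> 0 \<Longrightarrow> speed2 \<epsilon> \<theta> \<ge> 1/2"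
  using zero_le_power2[of "cos \<theta>"] unfolding speed2_def by (simp add: field_simps)

lemma speed2_pos: "\<epsilon> \<ge> 0 \<Longrightarrow> speed2 \<epsilon> \<theta> > 0"
  using speed2_ge[of \<epsilon> \<theta>] by simp

lemma speed_derivative:
  assumes "\<epsilon> \<ge> 0"
  shows "((\<lambda>\<theta>. sqrt (speed2 \<epsilon> \<theta>)) has_real_derivative - (cos \<theta> * sin \<theta>) / (2 * sqrt (speed2 \<epsilon> \<theta>))) (at \<theta> within A)"
  using speed2_pos[OF assms, of \<theta>] unfolding speed2_def
  by (auto intro!: derivative_eq_intros simp: field_simps)

lemma hill_k_continuous: "\<epsilon> \<ge> 0 \<Longrightarrow> continuous_on A (hill_k \<epsilon>)"
  and hill_q_continuous: "\<epsilon> \<ge> 0 \<Longrightarrow> continuous_on A (hill_q \<gamma> \<epsilon> \<epsilon>')"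
  unfolding hill_k_def hill_q_def
  using speed2_pos[of \<epsilon>] by (auto intro!: continuous_intros simp: speed2_def less_imp_neq[symmetric])

text \<open>With \<open>u = cos \<theta>\<close> and time derivatives along \<open>u'' + u\<^sup>3 = 0\<close> one has \<open>(u')\<^sup>2 = (1 - u\<^sup>4) / 2\<close>.
  Substituting \<open>w = u\<^sup>4\<close> into the limit equation therefore gives the hypergeometric equation
  with \<open>\<alpha> + \<beta> = 1/4\<close> and \<open>c = 3/4\<close>, where \<open>\<gamma> = - 8 \<alpha> \<beta>\<close>.\<close>

lemma cos4_hypergeometric_solution:
  fixes G G' G'' :: "real \<Rightarrow> real" and \<theta> ab :: real
  defines "w \<equiv> cos \<theta> ^ 4"
  assumes G: "(G has_real_derivative G' w) (at w)" "(G' has_real_derivative G'' w) (at w)"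
    and ode: "w * (1 - w) * G'' w + (3/4 - 5/4 * w) * G' w = ab * G w"
  shows "((\<lambda>\<theta>. G (cos \<theta> ^ 4)) has_real_derivative
      hill_k 0 \<theta> * (- 4 * cos \<theta> ^ 3 * (sqrt (speed2 0 \<theta>) * sin \<theta>) * G' (cos \<theta> ^ 4))) (at \<theta>)"
    and "((\<lambda>\<theta>. - 4 * cos \<theta> ^ 3 * (sqrt (speed2 0 \<theta>) * sin \<theta>) * G' (cos \<theta> ^ 4)) has_real_derivative
      - hill_q (- 8 * ab) 0 0 \<theta> * G (cos \<theta> ^ 4)) (at \<theta>)"
proof -
  let ?g = "sqrt (speed2 0 \<theta>)" and ?u = "cos \<theta>" and ?v = "sin \<theta>"
  have g0: "?g > 0" using speed2_pos[of 0 \<theta>] by simp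
  have g2: "?g * ?g = (1 + ?u\<^sup>2) / 2" using speed2_pos[of 0 \<theta>] by (simp add: speed2_def)
  have v2: "?v\<^sup>2 = 1 - ?u\<^sup>2" by (simp add: sin_squared_eq)
  have dw: "((\<lambda>\<theta>. cos \<theta> ^ 4) has_real_derivative - 4 * ?u ^ 3 * ?v) (at \<theta>)"
    by (auto intro!: derivative_eq_intros)
  have d1: "((\<lambda>\<theta>. G (cos \<theta> ^ 4)) has_real_derivative G' w * (- 4 * ?u ^ 3 * ?v)) (at \<theta>)"
    unfolding w_def by (rule DERIV_chain2[OF G(1)[unfolded w_def] dw])
  have eq: "G' w * (- 4 * ?u ^ 3 * ?v) = hill_k 0 \<theta> * (- 4 * ?u ^ 3 * (?g * ?v) * G' (?u ^ 4))"
    using g0 by (simp add: hill_k_def w_def)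
  show "((\<lambda>\<theta>. G (cos \<theta> ^ 4)) has_real_derivative
      hill_k 0 \<theta> * (- 4 * ?u ^ 3 * (?g * ?v) * G' (?u ^ 4))) (at \<theta>)"
    using d1 unfolding eq .
  have d2: "((\<lambda>\<theta>. G' (cos \<theta> ^ 4)) has_real_derivative G'' w * (- 4 * ?u ^ 3 * ?v)) (at \<theta>)"
    unfolding w_def by (rule DERIV_chain2[OF G(2)[unfolded w_def] dw])
  have dh: "((\<lambda>\<theta>. sqrt (speed2 0 \<theta>) * sin \<theta>) has_real_derivative ?u ^ 3 / ?g) (at \<theta>)"
  proof -
    have "- (?u * ?v) / (2 * ?g) * ?v + ?u * ?g = (?u * (2 * (?g * ?g) - ?v\<^sup>2)) / (2 * ?g)"
      using g0 by (simp add: field_simps power2_eq_square)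
    also have "2 * (?g * ?g) - ?v\<^sup>2 = 2 * ?u\<^sup>2"
    proof -
      have "2 * ((1 + x) / 2) - (1 - x) = 2 * x" for x :: real by (simp add: field_simps)
      then show ?thesis unfolding g2 v2 .
    qed
    also have "?u * (2 * ?u\<^sup>2) / (2 * ?g) = ?u ^ 3 / ?g"
      by (simp only: power2_eq_square power3_eq_cube)
    finally have e: "- (?u * ?v) / (2 * ?g) * ?v + ?u * ?g = ?u ^ 3 / ?g" .
    show ?thesis
      using DERIV_mult[OF speed_derivative[of 0 \<theta> UNIV] DERIV_sin[of \<theta>]] unfolding e by blast
  qed
  have algebra: "(- 4 * (3 * u\<^sup>2 * - v)) * (g * v) * p + - 4 * u ^ 3 * (u ^ 3 / g) * p
         + - 4 * u ^ 3 * (g * v) * (r * (- 4 * u ^ 3 * v))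
       = (4 * u\<^sup>2 / g) * (4 * u ^ 4 * (g * g * v\<^sup>2) * r + (3 * (g * g * v\<^sup>2) - u ^ 4) * p)"
      if "g \<noteq> 0" for g u v p r :: real
    using that by (simp add: field_simps power2_eq_square power3_eq_cube power4_eq_xxxx)
  have gv: "?g * ?g * ?v\<^sup>2 = (1 - w) / 2"
    unfolding g2 v2 w_def by (simp add: power4_eq_xxxx power2_eq_square algebra_simps)
  have "((\<lambda>\<theta>. - 4 * cos \<theta> ^ 3 * (sqrt (speed2 0 \<theta>) * sin \<theta>) * G' (cos \<theta> ^ 4)) has_real_derivative
        (- 4 * (3 * ?u\<^sup>2 * - ?v)) * (?g * ?v) * G' w + - 4 * ?u ^ 3 * (?u ^ 3 / ?g) * G' w
         + - 4 * ?u ^ 3 * (?g * ?v) * (G'' w * (- 4 * ?u ^ 3 * ?v))) (at \<theta>)"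
    by (rule derivative_eq_intros dh d2 refl)+ (simp add: w_def algebra_simps)
  also have "(- 4 * (3 * ?u\<^sup>2 * - ?v)) * (?g * ?v) * G' w + - 4 * ?u ^ 3 * (?u ^ 3 / ?g) * G' w
         + - 4 * ?u ^ 3 * (?g * ?v) * (G'' w * (- 4 * ?u ^ 3 * ?v))
       = (4 * ?u\<^sup>2 / ?g) * (4 * ?u ^ 4 * (?g * ?g * ?v\<^sup>2) * G'' w + (3 * (?g * ?g * ?v\<^sup>2) - ?u ^ 4) * G' w)"
    using g0 by (intro algebra) simp
  also have "4 * ?u ^ 4 * (?g * ?g * ?v\<^sup>2) * G'' w + (3 * (?g * ?g * ?v\<^sup>2) - ?u ^ 4) * G' w
      = 2 * (w * (1 - w) * G'' w + (3/4 - 5/4 * w) * G' w)"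
    unfolding gv w_def[symmetric] by (simp add: field_simps)
  also have "4 * ?u\<^sup>2 / ?g * (2 * (w * (1 - w) * G'' w + (3/4 - 5/4 * w) * G' w))
      = - hill_q (- 8 * ab) 0 0 \<theta> * G (?u ^ 4)"
    unfolding ode by (simp add: hill_q_def w_def)
  finally show "((\<lambda>\<theta>. - 4 * cos \<theta> ^ 3 * (sqrt (speed2 0 \<theta>) * sin \<theta>) * G' (cos \<theta> ^ 4)) has_real_derivative
      - hill_q (- 8 * ab) 0 0 \<theta> * G (cos \<theta> ^ 4)) (at \<theta>)" .
qed

text \<open>Used where an identity degenerates at one endpoint: the hypergeometric equation is singular at 0
  and 1, and the plate equation is imposed for positive times only.\<close>

lemma eq_at_endpoint:
  fixes f :: "real \<Rightarrow> real"
  assumes "continuous_on {a..b} f" "continuous_on {a..b} X" "a < b"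
  shows "(\<And>t. a < t \<Longrightarrow> t \<le> b \<Longrightarrow> X t = f t) \<Longrightarrow> X a = f a"
    and "(\<And>t. a \<le> t \<Longrightarrow> t < b \<Longrightarrow> X t = f t) \<Longrightarrow> X b = f b"
proof -
  have a: "(f \<longlongrightarrow> f a) (at_right a)" "(X \<longlongrightarrow> X a) (at_right a)"
    and b: "(f \<longlongrightarrow> f b) (at_left b)" "(X \<longlongrightarrow> X b) (at_left b)"
    using assms by (simp_all add: continuous_on_Icc_at_rightD continuous_on_Icc_at_leftD)
  show "X a = f a" if eq: "\<And>t. a < t \<Longrightarrow> t \<le> b \<Longrightarrow> X t = f t"
  proof -
    have "\<forall>\<^sub>F t in at_right a. X t = f t"
      using eventually_at_right_less[of a] eventually_at_right[of a b] assms(3)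
      unfolding eventually_at_right[OF assms(3)] by (intro exI[of _ b]) (auto intro: eq)
    then have "(f \<longlongrightarrow> X a) (at_right a)" using a(2) tendsto_cong by fastforce
    then show ?thesis using a(1) tendsto_unique[OF trivial_limit_at_right_real] by blast
  qed
  show "X b = f b" if eq: "\<And>t. a \<le> t \<Longrightarrow> t < b \<Longrightarrow> X t = f t"
  proof -
    have "\<forall>\<^sub>F t in at_left b. X t = f t"
      unfolding eventually_at_left[OF assms(3)] using assms(3) by (intro exI[of _ a]) (auto intro: eq)
    then have "(f \<longlongrightarrow> X b) (at_left b)" using b(2) tendsto_cong by fastforce
    then show ?thesis using b(1) tendsto_unique[OF trivial_limit_at_left_real] by blast
  qed
qed

lemma cos4_le_1: "cos (\<theta>::real) ^ 4 \<le> 1"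
proof -
  have "((cos \<theta>)\<^sup>2) ^ 2 \<le> 1" by (rule power_le_one) (auto simp: abs_square_le_1)
  also have "((cos \<theta>)\<^sup>2) ^ 2 = cos \<theta> ^ 4" by (simp only: power_mult[symmetric]) simp
  finally show ?thesis .
qed

text \<open>Near \<open>\<theta> = 0\<close> the solution \<open>c\<close> is regular in \<open>1 - cos\<^sup>4 \<theta>\<close>, hence it is the series with
  third parameter \<open>1/2\<close> in this variable, and its value at \<open>\<pi> / 2\<close> is the value of the series at 1. For \<open>s'\<close>,
  consider the solution \<open>e\<close> with \<open>e = 1\<close> and second component 0 at \<open>\<pi> / 2\<close>. It is the series
  with third parameter \<open>3/4\<close> in \<open>cos\<^sup>4 \<theta>\<close>, and since the fundamental matrix has determinant 1, its
  value at 0 is \<open>s' (\<pi> / 2)\<close>.\<close>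

lemma fundamental_values_at_half_pi:
  fixes \<alpha> \<beta> \<gamma> :: real
  assumes ab: "\<beta> = 1/4 - \<alpha>" and \<gamma>: "\<gamma> = - 8 * (\<alpha> * \<beta>)"
    and c: "planar_solution (hill_k 0) (hill_q \<gamma> 0 0) {0..} c c'" "c 0 = 1" "c' 0 = 0"
    and s: "planar_solution (hill_k 0) (hill_q \<gamma> 0 0) {0..} s s'" "s 0 = 0" "s' 0 = 1"
  shows "c (pi/2) = hyp \<alpha> \<beta> (1/2) 1" and "s' (pi/2) = hyp \<alpha> \<beta> (3/4) 1"
proof -
  have sub: "{a..b} \<subseteq> {0..}" if "a \<ge> 0" for a b :: real using that by auto
  have hc: "continuous_on {0..pi/2} (\<lambda>\<theta>. hyp \<alpha> \<beta> (1/2) (1 - cos \<theta> ^ 4))"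
    by (rule continuous_on_compose2[OF hyp_continuous_on_Icc[of "1/2" \<alpha> \<beta>]])
       (auto intro!: continuous_intros simp: ab cos4_le_1)
  have he: "continuous_on {0..pi/2} (\<lambda>\<theta>. hyp \<alpha> \<beta> (3/4) (cos \<theta> ^ 4))"
    by (rule continuous_on_compose2[OF hyp_continuous_on_Icc[of "3/4" \<alpha> \<beta>]])
       (auto intro!: continuous_intros simp: ab cos4_le_1)
  have kq: "continuous_on A (hill_k 0)" "continuous_on A (hill_q \<gamma> 0 0)" for A
    by (simp_all add: hill_k_continuous hill_q_continuous)
  show "c (pi/2) = hyp \<alpha> \<beta> (1/2) 1"
  proof -
    obtain F' F'' where F:
      "\<And>x. \<bar>x\<bar> < 1 \<Longrightarrow> (hyp \<alpha> \<beta> (1/2) has_real_derivative F' x) (at x)"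
      "\<And>x. \<bar>x\<bar> < 1 \<Longrightarrow> (F' has_real_derivative F'' x) (at x)"
      "\<And>x. \<bar>x\<bar> < 1 \<Longrightarrow> x * (1 - x) * F'' x + (1/2 - (\<alpha> + \<beta> + 1) * x) * F' x = \<alpha> * \<beta> * hyp \<alpha> \<beta> (1/2) x"
      using hyp_ode[of "1/2" \<alpha> \<beta>] ab by auto
    \<comment> \<open>Under \<open>x = 1 - w\<close>, parameters with \<open>\<alpha> + \<beta> = 1/4\<close> exchange \<open>c = 1/2\<close> with \<open>c = 3/4\<close>.\<close>
    define G G' G'' where "G w = hyp \<alpha> \<beta> (1/2) (1 - w)" and "G' w = - F' (1 - w)" and "G'' w = F'' (1 - w)" for w
    define Y where "Y \<theta> = - 4 * cos \<theta> ^ 3 * (sqrt (speed2 0 \<theta>) * sin \<theta>) * G' (cos \<theta> ^ 4)" for \<theta>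
    have G: "(G has_real_derivative G' w) (at w)" "(G' has_real_derivative G'' w) (at w)"
       "w * (1 - w) * G'' w + (3/4 - 5/4 * w) * G' w = \<alpha> * \<beta> * G w" if "0 < w" "w \<le> 1" for w
    proof -
      have x: "\<bar>1 - w\<bar> < 1" using that by auto
      have d: "((\<lambda>w. 1 - w) has_real_derivative - 1) (at w)" by (auto intro!: derivative_eq_intros)
      show "(G has_real_derivative G' w) (at w)"
        unfolding G_def[abs_def] G'_def using DERIV_chain2[OF F(1)[OF x] d] by simp
      show "(G' has_real_derivative G'' w) (at w)"
        unfolding G'_def[abs_def] G''_def using DERIV_minus[OF DERIV_chain2[OF F(2)[OF x] d]] by simp
      show "w * (1 - w) * G'' w + (3/4 - 5/4 * w) * G' w = \<alpha> * \<beta> * G w"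
      proof -
        have "w * (1 - w) * G'' w + (3/4 - 5/4 * w) * G' w
            = (1 - w) * (1 - (1 - w)) * F'' (1 - w) + (1/2 - (\<alpha> + \<beta> + 1) * (1 - w)) * F' (1 - w)"
          unfolding G'_def G''_def ab by (simp add: field_simps)
        then show ?thesis unfolding F(3)[OF x] G_def .
      qed
    qed
    have eq: "c t = G (cos t ^ 4)" if t: "0 \<le> t" "t < pi/2" for t
    proof -
      have G_sol: "planar_solution (hill_k 0) (hill_q \<gamma> 0 0) {0..t} (\<lambda>\<theta>. G (cos \<theta> ^ 4)) Y"
        unfolding planar_solution_def
      proof (intro ballI conjI)
        fix \<theta> assume "\<theta> \<in> {0..t}"
        then have "0 < cos \<theta>" using t by (intro cos_gt_zero_pi) auto
        then have w: "0 < cos \<theta> ^ 4" "cos \<theta> ^ 4 \<le> 1" by (auto intro: power_le_one)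
        note sol = cos4_hypergeometric_solution[where G = G and G' = G' and G'' = G'' and ab = "\<alpha> * \<beta>", OF G[OF w]]
        show "((\<lambda>\<theta>. G (cos \<theta> ^ 4)) has_real_derivative hill_k 0 \<theta> * Y \<theta>) (at \<theta> within {0..t})"
          using sol(1) unfolding Y_def by (rule has_field_derivative_at_within)
        show "(Y has_real_derivative - hill_q \<gamma> 0 0 \<theta> * G (cos \<theta> ^ 4)) (at \<theta> within {0..t})"
          using sol(2) unfolding Y_def[abs_def] \<gamma> by (rule has_field_derivative_at_within)
      qed
      have "c t = G (cos t ^ 4) \<and> c' t = Y t"
        using t c by (intro planar_solution_unique[OF planar_solution_subset[OF c(1) sub] G_sol kq, where c = 0 and t = t]) (auto simp: G_def Y_def)
      then show ?thesis by simp
    qed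
    have "c (pi/2) = G (cos (pi/2) ^ 4)"
      by (rule eq_at_endpoint(2)[of 0 "pi/2" "\<lambda>t. G (cos t ^ 4)"])
         (use hc eq planar_solution_continuous_on(1)[OF planar_solution_subset[OF c(1) sub]] in \<open>auto simp: G_def\<close>)
    then show ?thesis by (simp add: G_def)
  qed
  show "s' (pi/2) = hyp \<alpha> \<beta> (3/4) 1"
  proof -
    obtain F' F'' where F:
      "\<And>x. \<bar>x\<bar> < 1 \<Longrightarrow> (hyp \<alpha> \<beta> (3/4) has_real_derivative F' x) (at x)"
      "\<And>x. \<bar>x\<bar> < 1 \<Longrightarrow> (F' has_real_derivative F'' x) (at x)"
      "\<And>x. \<bar>x\<bar> < 1 \<Longrightarrow> x * (1 - x) * F'' x + (3/4 - (\<alpha> + \<beta> + 1) * x) * F' x = \<alpha> * \<beta> * hyp \<alpha> \<beta> (3/4) x"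
      using hyp_ode[of "3/4" \<alpha> \<beta>] ab by auto
    define G where "G = hyp \<alpha> \<beta> (3/4)"
    define Y where "Y \<theta> = - 4 * cos \<theta> ^ 3 * (sqrt (speed2 0 \<theta>) * sin \<theta>) * F' (cos \<theta> ^ 4)" for \<theta>
    \<comment> \<open>The solution with data \<open>(1, 0)\<close> at \<open>\<pi> / 2\<close>, by Cramer's rule.\<close>
    define e e' where "e t = s' (pi/2) * c t - c' (pi/2) * s t" and "e' t = s' (pi/2) * c' t - c' (pi/2) * s' t" for t
    have e: "planar_solution (hill_k 0) (hill_q \<gamma> 0 0) {0..} e e'"
      using planar_solution_lincomb[OF c(1) s(1), of "s' (pi/2)" "- c' (pi/2)"] by (simp add: e_def[abs_def] e'_def[abs_def])
    have det: "c (pi/2) * s' (pi/2) - s (pi/2) * c' (pi/2) = 1"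
      using wronskian_constant[OF c(1) s(1), of 0 "pi/2"] c s by simp
    have eq: "e t = G (cos t ^ 4)" if t: "0 < t" "t \<le> pi/2" for t
    proof -
      have G_sol: "planar_solution (hill_k 0) (hill_q \<gamma> 0 0) {t..pi/2} (\<lambda>\<theta>. G (cos \<theta> ^ 4)) Y"
        unfolding planar_solution_def
      proof (intro ballI conjI)
        fix \<theta> assume th: "\<theta> \<in> {t..pi/2}"
        then have "0 \<le> cos \<theta>" "cos \<theta> < 1" using t cos_monotone_0_pi[of 0 \<theta>] by (auto intro!: cos_ge_zero)
        then have "cos \<theta> ^ 4 < 1" by (intro power_less_one_iff[THEN iffD2]) auto
        then have w: "\<bar>cos \<theta> ^ 4\<bar> < 1" by simp
        have "cos \<theta> ^ 4 * (1 - cos \<theta> ^ 4) * F'' (cos \<theta> ^ 4) + (3/4 - 5/4 * cos \<theta> ^ 4) * F' (cos \<theta> ^ 4)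
            = \<alpha> * \<beta> * G (cos \<theta> ^ 4)"
          using F(3)[OF w] unfolding G_def ab by (simp add: algebra_simps)
        note sol = cos4_hypergeometric_solution[where G = G and G' = F' and G'' = F'' and ab = "\<alpha> * \<beta>", OF F(1)[OF w, folded G_def] F(2)[OF w] this]
        show "((\<lambda>\<theta>. G (cos \<theta> ^ 4)) has_real_derivative hill_k 0 \<theta> * Y \<theta>) (at \<theta> within {t..pi/2})"
          using sol(1) unfolding Y_def by (rule has_field_derivative_at_within)
        show "(Y has_real_derivative - hill_q \<gamma> 0 0 \<theta> * G (cos \<theta> ^ 4)) (at \<theta> within {t..pi/2})"
          using sol(2) unfolding Y_def[abs_def] \<gamma> by (rule has_field_derivative_at_within)
      qed
      have "e t = G (cos t ^ 4) \<and> e' t = Y t"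
        using t det
        by (intro planar_solution_unique[OF planar_solution_subset[OF e sub] G_sol kq, where c = "pi/2" and t = t])
           (auto simp: G_def Y_def e_def e'_def algebra_simps)
      then show ?thesis by simp
    qed
    have "e 0 = G (cos 0 ^ 4)"
      by (rule eq_at_endpoint(1)[of 0 "pi/2" "\<lambda>t. G (cos t ^ 4)"])
         (use he eq planar_solution_continuous_on(1)[OF planar_solution_subset[OF e sub]] in \<open>auto simp: G_def\<close>)
    then show ?thesis using c s by (simp add: G_def e_def)
  qed
qed

section \<open>The discriminant at high energy\<close>

text \<open>For coefficients that are symmetric about \<open>h\<close>, the reflected fundamental solutions solve the same
  system. Comparing their Wronskians with the original ones at 0 and at \<open>h\<close> expresses the diagonal of the
  monodromy matrix by the fundamental matrix at \<open>h\<close>.\<close>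

lemma discriminant_half_period:
  assumes fs: "fundamental_system k q c c' s s'" and h: "h > 0"
    and sym: "\<And>t. t \<in> {0..2*h} \<Longrightarrow> k (2*h - t) = k t" "\<And>t. t \<in> {0..2*h} \<Longrightarrow> q (2*h - t) = q t"
  shows "c (2*h) + s' (2*h) = 4 * (c h * s' h) - 2"
proof -
  have "{0..2*h} \<subseteq> {0..}" by auto
  then have cs: "planar_solution k q {0..2*h} c c'" "planar_solution k q {0..2*h} s s'"
    and init: "c 0 = 1" "c' 0 = 0" "s 0 = 0" "s' 0 = 1"
    using fs unfolding fundamental_system_def by (auto intro: planar_solution_subset)
  have refl: "planar_solution k q {0..2*h} (\<lambda>t. X (2*h - t)) (\<lambda>t. - Y (2*h - t))"
    if "planar_solution k q {0..2*h} X Y" for X Y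
    using planar_solution_reflect[OF that, of "2*h"] sym by (simp add: planar_solution_def)
  have mem: "0 \<in> {0..2*h}" "h \<in> {0..2*h}" and hh: "2 * h - h = h" using h by auto
  have "c (2*h) = s h * c' h + c h * s' h"
    using wronskian_constant[OF cs(2) refl[OF cs(1)] convex_closed_interval mem(1) mem(2)] init hh by simp
  moreover have "s' (2*h) = c h * s' h + s h * c' h"
    using wronskian_constant[OF cs(1) refl[OF cs(2)] convex_closed_interval mem(1) mem(2)] init hh by simp
  moreover have "c h * s' h - s h * c' h = 1" using fundamental_system_det[OF fs, of h] h by simp
  ultimately show ?thesis by linarith
qed

text \<open>The discriminant is \<open>2 \<surd>2 sin (\<pi> / 4 - \<pi> N / 2)\<close>. Only its modulus matters, and squaring it removes
  the case distinctions on the sign.\<close>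

lemma limit_discriminant:
  assumes N: "\<gamma> = N * (N + 1) / 2"
    and fs: "fundamental_system (hill_k 0) (hill_q \<gamma> 0 0) c c' s s'"
  shows "(c pi + s' pi)\<^sup>2 = 4 * (1 - sin (pi * N))"
proof -
  define \<alpha> where "\<alpha> = - N / 4"
  have \<gamma>: "\<gamma> = - 8 * (\<alpha> * (1/4 - \<alpha>))" by (simp add: \<alpha>_def N field_simps)
  define x where "x = 2 * pi * \<alpha> + pi / 4"
  have refl: "speed2 0 (pi - t) = speed2 0 t" for t by (simp add: speed2_def)
  have half: "c (2 * (pi/2)) + s' (2 * (pi/2)) = 4 * (c (pi/2) * s' (pi/2)) - 2"
    by (rule discriminant_half_period[OF fs]) (simp_all add: hill_k_def hill_q_def refl)
  have half_values: "c (pi/2) = hyp \<alpha> (1/4 - \<alpha>) (1/2) 1" "s' (pi/2) = hyp \<alpha> (1/4 - \<alpha>) (3/4) 1"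
    using fundamental_values_at_half_pi[OF HOL.refl \<gamma>, of c c' s s'] fs
    unfolding fundamental_system_def by auto
  have "c pi + s' pi = 4 * (c (pi/2) * s' (pi/2)) - 2" using half by simp
  also have "\<dots> = 4 * ((sqrt 2 * sin x + 1) / 2) - 2" unfolding half_values hyp_product x_def ..
  also have "\<dots> = 2 * (sqrt 2 * sin x)" by (simp add: field_simps)
  finally have "c pi + s' pi = 2 * (sqrt 2 * sin x)" .
  then have "(c pi + s' pi)\<^sup>2 = 8 * (sin x)\<^sup>2" by (simp add: power_mult_distrib)
  also have "\<dots> = 4 * (1 - cos (2 * x))" by (simp add: cos_double_sin)
  also have "cos (2 * x) = cos (pi / 2 - pi * N)" by (simp add: x_def \<alpha>_def algebra_simps)
  finally show ?thesis by (simp add: cos_diff)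
qed

lemma triangular_index:
  fixes \<gamma> :: real
  assumes "\<gamma> > 0"
  obtains N where "N > 0" "\<gamma> = N * (N + 1) / 2"
proof
  let ?r = "sqrt (1 + 8 * \<gamma>)"
  have "?r > 1" using assms by simp
  then show "(?r - 1) / 2 > 0" by simp
  have "?r * ?r = 1 + 8 * \<gamma>" using assms by simp
  then show "\<gamma> = (?r - 1) / 2 * ((?r - 1) / 2 + 1) / 2" by (simp add: field_simps)
qed

lemma triangular_less_iff:
  fixes x y :: real
  assumes "x \<ge> 0" "y \<ge> 0"
  shows "x * (x + 1) / 2 < y * (y + 1) / 2 \<longleftrightarrow> x < y"
proof
  assume *: "x * (x + 1) / 2 < y * (y + 1) / 2"
  show "x < y"
  proof (rule ccontr)
    assume "\<not> x < y"
    then have "y * (y + 1) \<le> x * (x + 1)" using assms by (intro mult_mono) auto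
    then show False using * by simp
  qed
next
  assume "x < y"
  then show "x * (x + 1) / 2 < y * (y + 1) / 2"
    using assms by (intro divide_strict_right_mono mult_strict_mono') auto
qed

text \<open>The endpoints of the interval are the triangular numbers with indices \<open>2 j\<close> and \<open>2 j + 1\<close>.\<close>

lemma I_interval_sin_pos:
  assumes "\<gamma> \<in> I_interval j" "\<gamma> = N * (N + 1) / 2" "N > 0"
  shows "sin (pi * N) > 0"
proof -
  have "real (j * (2*j + 1)) = real (2*j) * (real (2*j) + 1) / 2"
       "real ((j + 1) * (2*j + 1)) = real (2*j + 1) * (real (2*j + 1) + 1) / 2"
    by (simp_all add: field_simps)
  then have "real (2*j) < N" "N < real (2*j + 1)"
    using assms triangular_less_iff[of "real (2*j)" N] triangular_less_iff[of N "real (2*j + 1)"]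
    unfolding I_interval_def by auto
  then have "0 < pi * (N - 2 * j)" "pi * (N - 2 * j) < pi * 1"
    by (auto intro!: mult_strict_left_mono simp del: mult_1_right)
  then have "sin (pi * (N - 2 * j)) > 0" by (intro sin_gt_zero) auto
  also have "pi * (N - 2 * j) = pi * N - 2 * real j * pi" by (simp add: algebra_simps)
  finally show ?thesis unfolding sin_diff sin_2npi cos_2npi by simp
qed

text \<open>The endpoints of the interval are the triangular numbers with indices \<open>2 j + 1\<close> and \<open>2 j + 2\<close>.\<close>

lemma K_interval_sin_neg:
  assumes "\<gamma> \<in> K_interval j" "\<gamma> = N * (N + 1) / 2" "N > 0"
  shows "sin (pi * N) < 0"
proof -
  have "real ((j + 1) * (2*j + 1)) = real (2*j + 1) * (real (2*j + 1) + 1) / 2"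
       "real ((j + 1) * (2*j + 3)) = real (2*j + 2) * (real (2*j + 2) + 1) / 2"
    by (simp_all add: field_simps)
  then have "real (2*j + 1) < N" "N < real (2*j + 2)"
    using assms triangular_less_iff[of "real (2*j + 1)" N] triangular_less_iff[of N "real (2*j + 2)"]
    unfolding K_interval_def by auto
  then have "0 < pi * (N - 2 * j - 1)" "pi * (N - 2 * j - 1) < pi * 1"
    by (auto intro!: mult_strict_left_mono simp del: mult_1_right)
  then have "sin (pi * (N - 2 * j - 1)) > 0" by (intro sin_gt_zero) auto
  also have "pi * (N - 2 * j - 1) = pi * N - 2 * real j * pi - pi" by (simp add: algebra_simps)
  finally show ?thesis unfolding sin_diff cos_diff sin_2npi cos_2npi by simp
qed

text \<open>The bounds are uniform in \<open>\<theta>\<close> because the squared speed is at least \<open>1/2\<close>.\<close>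

lemma hill_k_bounds:
  assumes "\<epsilon> \<ge> 0"
  shows "hill_k \<epsilon> \<theta> \<ge> 0" "hill_k \<epsilon> \<theta> \<le> 2" "\<bar>hill_k \<epsilon> \<theta> - hill_k 0 \<theta>\<bar> \<le> 2 * \<epsilon>"
proof -
  let ?a = "sqrt (speed2 0 \<theta>)" and ?b = "sqrt (speed2 \<epsilon> \<theta>)"
  have half: "1/2 \<le> sqrt x" if "x \<ge> 1/2" for x :: real
    using that by (intro real_le_rsqrt) (simp add: power2_eq_square)
  have a: "?a \<ge> 1/2" "?b \<ge> 1/2" by (rule half[OF speed2_ge], simp add: assms)+
  show "hill_k \<epsilon> \<theta> \<ge> 0" by (simp add: hill_k_def less_imp_le[OF speed2_pos] assms)
  have "1 / ?b \<le> 1 / (1/2)" using a by (intro frac_le) simp_all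
  then show "hill_k \<epsilon> \<theta> \<le> 2" by (simp add: hill_k_def)
  have prod: "?a * ?b \<ge> 1/2"
  proof -
    have "1/2 * (1/2) \<le> speed2 0 \<theta> * speed2 \<epsilon> \<theta>"
      using speed2_ge[of _ \<theta>] speed2_pos[of 0 \<theta>] assms by (intro mult_mono) auto
    then show ?thesis unfolding real_sqrt_mult[symmetric] by (intro real_le_rsqrt) (simp add: power2_eq_square)
  qed
  have sum: "?a + ?b \<ge> 1" using a by linarith
  have "(?b - ?a) * (?b + ?a) = \<epsilon>"
    using speed2_pos[of _ \<theta>] assms by (simp add: algebra_simps speed2_def)
  moreover have ba: "?b - ?a \<ge> 0" using assms by (simp add: speed2_def)
  moreover have "(?b - ?a) * 1 \<le> (?b - ?a) * (?b + ?a)" using sum ba by (intro mult_left_mono) auto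
  ultimately have le: "?b - ?a \<le> \<epsilon>" by simp
  have "\<bar>hill_k \<epsilon> \<theta> - hill_k 0 \<theta>\<bar> = (?b - ?a) / (?a * ?b)"
  proof -
    have "1 / y - 1 / x = - ((y - x) / (x * y))" if "x > 0" "y > 0" for x y :: real
      using that by (simp add: field_simps)
    from this[of ?a ?b] have "hill_k \<epsilon> \<theta> - hill_k 0 \<theta> = - ((?b - ?a) / (?a * ?b))"
      using a unfolding hill_k_def by linarith
    moreover have "(?b - ?a) / (?a * ?b) \<ge> 0" using ba prod by (intro divide_nonneg_nonneg) linarith+
    ultimately show ?thesis by (simp only: abs_minus_cancel abs_of_nonneg)
  qed
  also have "\<dots> \<le> \<epsilon> / (1/2)" using le ba prod assms by (intro frac_le) auto
  finally show "\<bar>hill_k \<epsilon> \<theta> - hill_k 0 \<theta>\<bar> \<le> 2 * \<epsilon>" by simp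
qed

lemma hill_q_bounds:
  assumes "\<epsilon> \<ge> 0" "\<epsilon>' \<ge> 0" "\<gamma> \<ge> 0"
  shows "\<bar>hill_q \<gamma> \<epsilon> \<epsilon>' \<theta>\<bar> \<le> 2 * (\<epsilon>' + \<gamma>)"
    and "\<bar>hill_q \<gamma> \<epsilon> \<epsilon>' \<theta> - hill_q \<gamma> 0 0 \<theta>\<bar> \<le> 2 * \<epsilon>' + 2 * \<gamma> * \<epsilon>"
proof -
  let ?u = "(cos \<theta>)\<^sup>2"
  have u: "0 \<le> ?u" "?u \<le> 1" by (auto simp: abs_square_le_1)
  note k = hill_k_bounds[OF assms(1), of \<theta>]
  have q: "hill_q \<gamma> \<epsilon> \<epsilon>' \<theta> = (\<epsilon>' + \<gamma> * ?u) * hill_k \<epsilon> \<theta>" for \<epsilon> \<epsilon>'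
    by (simp add: hill_q_def hill_k_def)
  have gu: "0 \<le> \<gamma> * ?u" "\<gamma> * ?u \<le> \<gamma>" using u assms by (auto intro: mult_left_le)
  have "\<bar>hill_q \<gamma> \<epsilon> \<epsilon>' \<theta>\<bar> = (\<epsilon>' + \<gamma> * ?u) * hill_k \<epsilon> \<theta>" unfolding q using gu k assms by simp
  also have "\<dots> \<le> (\<epsilon>' + \<gamma>) * 2" using gu k assms by (intro mult_mono) auto
  finally show "\<bar>hill_q \<gamma> \<epsilon> \<epsilon>' \<theta>\<bar> \<le> 2 * (\<epsilon>' + \<gamma>)" by simp
  have "hill_q \<gamma> \<epsilon> \<epsilon>' \<theta> - hill_q \<gamma> 0 0 \<theta> = \<epsilon>' * hill_k \<epsilon> \<theta> + (\<gamma> * ?u) * (hill_k \<epsilon> \<theta> - hill_k 0 \<theta>)"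
    unfolding q by (simp add: algebra_simps)
  also have "\<bar>\<dots>\<bar> \<le> \<epsilon>' * 2 + \<gamma> * (2 * \<epsilon>)"
  proof (rule order_trans[OF abs_triangle_ineq add_mono])
    show "\<bar>\<epsilon>' * hill_k \<epsilon> \<theta>\<bar> \<le> \<epsilon>' * 2" using k assms by (simp add: abs_mult mult_left_mono)
    show "\<bar>\<gamma> * ?u * (hill_k \<epsilon> \<theta> - hill_k 0 \<theta>)\<bar> \<le> \<gamma> * (2 * \<epsilon>)"
      unfolding abs_mult[of "\<gamma> * ?u"] using k gu assms by (intro mult_mono) auto
  qed
  finally show "\<bar>hill_q \<gamma> \<epsilon> \<epsilon>' \<theta> - hill_q \<gamma> 0 0 \<theta>\<bar> \<le> 2 * \<epsilon>' + 2 * \<gamma> * \<epsilon>" by simp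
qed

lemma hill_fundamental_system_exists:
  assumes "\<epsilon> \<ge> 0" "\<epsilon>' \<ge> 0" "\<gamma> \<ge> 0"
  obtains c c' s s' where "fundamental_system (hill_k \<epsilon>) (hill_q \<gamma> \<epsilon> \<epsilon>') c c' s s'"
proof (rule fundamental_system_exists[of "hill_k \<epsilon>" "hill_q \<gamma> \<epsilon> \<epsilon>'" "2 + 2 * (\<epsilon>' + \<gamma>)"])
  show "\<bar>hill_k \<epsilon> t\<bar> \<le> 2 + 2 * (\<epsilon>' + \<gamma>)" for t using hill_k_bounds[OF assms(1), of t] assms by simp
  show "\<bar>hill_q \<gamma> \<epsilon> \<epsilon>' t\<bar> \<le> 2 + 2 * (\<epsilon>' + \<gamma>)" for t using hill_q_bounds(1)[OF assms, of t] assms by simp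
qed (auto intro: that hill_k_continuous hill_q_continuous assms)

lemma hill_solution_continuous_dependence:
  assumes \<gamma>: "\<gamma> \<ge> 0" and sol0: "planar_solution (hill_k 0) (hill_q \<gamma> 0 0) {0..} X Y" and \<eta>: "\<eta> > 0"
  shows "\<exists>\<rho>>0. \<forall>\<epsilon> \<epsilon>' X1 Y1. 0 \<le> \<epsilon> \<longrightarrow> \<epsilon> \<le> \<rho> \<longrightarrow> 0 \<le> \<epsilon>' \<longrightarrow> \<epsilon>' \<le> \<rho> \<longrightarrow>
     planar_solution (hill_k \<epsilon>) (hill_q \<gamma> \<epsilon> \<epsilon>') {0..} X1 Y1 \<longrightarrow> X1 0 = X 0 \<longrightarrow> Y1 0 = Y 0 \<longrightarrow>
     \<bar>X1 pi - X pi\<bar> < \<eta> \<and> \<bar>Y1 pi - Y pi\<bar> < \<eta>"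
proof -
  have sub: "{0..pi} \<subseteq> {0..}" by auto
  have "bounded (X ` {0..pi})" "bounded (Y ` {0..pi})"
    by (intro compact_imp_bounded compact_continuous_image planar_solution_continuous_on[OF planar_solution_subset[OF sol0 sub]] compact_Icc)+
  then obtain M1 M2 where "\<And>t. t \<in> {0..pi} \<Longrightarrow> \<bar>X t\<bar> \<le> M1" "\<And>t. t \<in> {0..pi} \<Longrightarrow> \<bar>Y t\<bar> \<le> M2"
    unfolding bounded_iff by (metis imageI real_norm_def)
  then have M: "\<bar>X t\<bar> \<le> max M1 M2" "\<bar>Y t\<bar> \<le> max M1 M2" if "t \<in> {0..pi}" for t
    using that by (auto intro: le_max_iff_disj[THEN iffD2])
  define M where "M = max M1 M2"
  define K where "K = 4 + 2 * \<gamma>"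
  \<comment> \<open>For coefficients at distance at most \<open>(2 + 2 \<gamma>) \<rho>\<close>, the perturbation estimate is \<open>C \<rho>\<^sup>2\<close>.\<close>
  define C where "C = 2 * ((2 + 2 * \<gamma>) * M)\<^sup>2 / (2 * K + 1) * exp ((2 * K + 1) * pi)"
  have C: "C \<ge> 0" using \<gamma> by (simp add: C_def K_def)
  define \<rho> where "\<rho> = min 1 (\<eta> / (sqrt C + 1))"
  have rho: "\<rho> > 0" "\<rho> \<le> 1" "\<rho> * sqrt C < \<eta>"
  proof -
    have p: "sqrt C + 1 > 0" using C by (simp add: add_nonneg_pos)
    then show "\<rho> > 0" "\<rho> \<le> 1" using \<eta> by (auto simp: \<rho>_def)
    have "\<rho> * (sqrt C + 1) \<le> \<eta> / (sqrt C + 1) * (sqrt C + 1)"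
      using p by (intro mult_right_mono) (auto simp: \<rho>_def)
    then have "\<rho> * (sqrt C + 1) \<le> \<eta>" using p by simp
    then show "\<rho> * sqrt C < \<eta>" using \<open>\<rho> > 0\<close> by (simp add: algebra_simps)
  qed
  have "\<bar>X1 pi - X pi\<bar> < \<eta> \<and> \<bar>Y1 pi - Y pi\<bar> < \<eta>"
    if e: "0 \<le> \<epsilon>" "\<epsilon> \<le> \<rho>" "0 \<le> \<epsilon>'" "\<epsilon>' \<le> \<rho>"
     and sol: "planar_solution (hill_k \<epsilon>) (hill_q \<gamma> \<epsilon> \<epsilon>') {0..} X1 Y1" and init: "X1 0 = X 0" "Y1 0 = Y 0" for \<epsilon> \<epsilon>' X1 Y1
  proof -
    have d: "\<bar>hill_k \<epsilon> t - hill_k 0 t\<bar> \<le> (2 + 2 * \<gamma>) * \<rho>" "\<bar>hill_q \<gamma> \<epsilon> \<epsilon>' t - hill_q \<gamma> 0 0 t\<bar> \<le> (2 + 2 * \<gamma>) * \<rho>" for t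
    proof -
      have ge: "\<gamma> * \<epsilon> \<le> \<gamma> * \<rho>" "0 \<le> \<gamma> * \<rho>" using e \<gamma> rho by (auto intro: mult_left_mono)
      show "\<bar>hill_k \<epsilon> t - hill_k 0 t\<bar> \<le> (2 + 2 * \<gamma>) * \<rho>"
        using hill_k_bounds(3)[OF e(1), of t] ge e by (simp add: algebra_simps)
      show "\<bar>hill_q \<gamma> \<epsilon> \<epsilon>' t - hill_q \<gamma> 0 0 t\<bar> \<le> (2 + 2 * \<gamma>) * \<rho>"
        using hill_q_bounds(2)[OF e(1,3) \<gamma>, of t] ge e by (simp add: algebra_simps)
    qed
    have K: "\<bar>hill_k \<epsilon> t\<bar> \<le> K" "\<bar>hill_q \<gamma> \<epsilon> \<epsilon>' t\<bar> \<le> K" for t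
      using hill_k_bounds[OF e(1), of t] hill_q_bounds(1)[OF e(1,3) \<gamma>, of t] \<gamma> e rho by (auto simp: K_def)
    have "(X1 pi - X pi)\<^sup>2 + (Y1 pi - Y pi)\<^sup>2
       \<le> 2 * ((2 + 2 * \<gamma>) * \<rho> * M)\<^sup>2 / (2 * K + 1) * exp ((2 * K + 1) * pi)"
      by (rule planar_solution_perturb[OF planar_solution_subset[OF sol0 sub] planar_solution_subset[OF sol sub] init])
         (use K d M \<gamma> in \<open>auto simp: M_def K_def\<close>)
    also have "\<dots> = (\<rho> * sqrt C)\<^sup>2" using C by (simp add: C_def power_mult_distrib mult_ac)
    also have "\<dots> < \<eta>\<^sup>2" using rho C by (intro power_strict_mono) auto
    finally have sq: "(X1 pi - X pi)\<^sup>2 + (Y1 pi - Y pi)\<^sup>2 < \<eta>\<^sup>2" .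
    then have "(X1 pi - X pi)\<^sup>2 < \<eta>\<^sup>2" "(Y1 pi - Y pi)\<^sup>2 < \<eta>\<^sup>2"
      using zero_le_power2[of "X1 pi - X pi"] zero_le_power2[of "Y1 pi - Y pi"] by linarith+
    then show ?thesis using \<eta> by (metis abs_le_square_iff abs_of_pos not_le)
  qed
  then show ?thesis using rho(1) by blast
qed

lemma discriminant_continuous_at_limit:
  assumes \<gamma>: "\<gamma> \<ge> 0" and fs0: "fundamental_system (hill_k 0) (hill_q \<gamma> 0 0) c0 c0' s0 s0'" and \<eta>: "\<eta> > 0"
  shows "\<exists>\<rho>>0. \<forall>\<epsilon> \<epsilon>' c c' s s'. 0 \<le> \<epsilon> \<longrightarrow> \<epsilon> \<le> \<rho> \<longrightarrow> 0 \<le> \<epsilon>' \<longrightarrow> \<epsilon>' \<le> \<rho> \<longrightarrow>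
     fundamental_system (hill_k \<epsilon>) (hill_q \<gamma> \<epsilon> \<epsilon>') c c' s s' \<longrightarrow> \<bar>(c pi + s' pi) - (c0 pi + s0' pi)\<bar> < \<eta>"
proof -
  have \<eta>2: "\<eta> / 2 > 0" using \<eta> by simp
  have "planar_solution (hill_k 0) (hill_q \<gamma> 0 0) {0..} c0 c0'" "planar_solution (hill_k 0) (hill_q \<gamma> 0 0) {0..} s0 s0'"
    and init: "c0 0 = 1" "c0' 0 = 0" "s0 0 = 0" "s0' 0 = 1"
    using fs0 by (auto simp: fundamental_system_def)
  note dep = this(1,2)[THEN hill_solution_continuous_dependence[OF \<gamma> _ \<eta>2]]
  obtain \<rho>1 where 1: "\<rho>1 > 0" "\<And>\<epsilon> \<epsilon>' X1 Y1. 0 \<le> \<epsilon> \<Longrightarrow> \<epsilon> \<le> \<rho>1 \<Longrightarrow> 0 \<le> \<epsilon>' \<Longrightarrow> \<epsilon>' \<le> \<rho>1 \<Longrightarrow>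
     planar_solution (hill_k \<epsilon>) (hill_q \<gamma> \<epsilon> \<epsilon>') {0..} X1 Y1 \<Longrightarrow> X1 0 = 1 \<Longrightarrow> Y1 0 = 0 \<Longrightarrow> \<bar>X1 pi - c0 pi\<bar> < \<eta> / 2"
    using dep(1) init by metis
  obtain \<rho>2 where 2: "\<rho>2 > 0" "\<And>\<epsilon> \<epsilon>' X1 Y1. 0 \<le> \<epsilon> \<Longrightarrow> \<epsilon> \<le> \<rho>2 \<Longrightarrow> 0 \<le> \<epsilon>' \<Longrightarrow> \<epsilon>' \<le> \<rho>2 \<Longrightarrow>
     planar_solution (hill_k \<epsilon>) (hill_q \<gamma> \<epsilon> \<epsilon>') {0..} X1 Y1 \<Longrightarrow> X1 0 = 0 \<Longrightarrow> Y1 0 = 1 \<Longrightarrow> \<bar>Y1 pi - s0' pi\<bar> < \<eta> / 2"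
    using dep(2) init by metis
  show ?thesis
  proof (intro exI[of _ "min \<rho>1 \<rho>2"] conjI allI impI)
    show "0 < min \<rho>1 \<rho>2" using 1 2 by simp
    fix \<epsilon> \<epsilon>' c c' s s'
    assume e: "0 \<le> \<epsilon>" "\<epsilon> \<le> min \<rho>1 \<rho>2" "0 \<le> \<epsilon>'" "\<epsilon>' \<le> min \<rho>1 \<rho>2"
      and fs: "fundamental_system (hill_k \<epsilon>) (hill_q \<gamma> \<epsilon> \<epsilon>') c c' s s'"
    have "\<bar>c pi - c0 pi\<bar> < \<eta> / 2" using fs e by (intro 1(2)[of \<epsilon> \<epsilon>' c c']) (auto simp: fundamental_system_def)
    moreover have "\<bar>s' pi - s0' pi\<bar> < \<eta> / 2" using fs e by (intro 2(2)[of \<epsilon> \<epsilon>' s s']) (auto simp: fundamental_system_def)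
    ultimately show "\<bar>(c pi + s' pi) - (c0 pi + s0' pi)\<bar> < \<eta>" by linarith
  qed
qed

lemma discriminant_stable_range:
  assumes "\<gamma> > 0" "\<gamma> \<in> I_interval j"
  shows "\<exists>\<rho>>0. \<forall>\<epsilon> \<epsilon>' c c' s s'. 0 \<le> \<epsilon> \<longrightarrow> \<epsilon> \<le> \<rho> \<longrightarrow> 0 \<le> \<epsilon>' \<longrightarrow> \<epsilon>' \<le> \<rho> \<longrightarrow>
     fundamental_system (hill_k \<epsilon>) (hill_q \<gamma> \<epsilon> \<epsilon>') c c' s s' \<longrightarrow> \<bar>c pi + s' pi\<bar> < 2"
proof -
  obtain N where N: "N > 0" "\<gamma> = N * (N + 1) / 2" using triangular_index[OF assms(1)] .
  obtain c0 c0' s0 s0' where fs0: "fundamental_system (hill_k 0) (hill_q \<gamma> 0 0) c0 c0' s0 s0'"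
    by (rule hill_fundamental_system_exists[of 0 0 \<gamma>]) (use assms in auto)
  have "(c0 pi + s0' pi)\<^sup>2 < 2\<^sup>2"
    using limit_discriminant[OF N(2) fs0] I_interval_sin_pos[OF assms(2) N(2,1)] by simp
  then have less: "\<bar>c0 pi + s0' pi\<bar> < 2" by (intro power2_less_imp_less[of "\<bar>_\<bar>"]) simp_all
  then obtain \<rho> where \<rho>: "\<rho> > 0" "\<And>\<epsilon> \<epsilon>' c c' s s'. 0 \<le> \<epsilon> \<Longrightarrow> \<epsilon> \<le> \<rho> \<Longrightarrow> 0 \<le> \<epsilon>' \<Longrightarrow> \<epsilon>' \<le> \<rho> \<Longrightarrow>
     fundamental_system (hill_k \<epsilon>) (hill_q \<gamma> \<epsilon> \<epsilon>') c c' s s' \<Longrightarrow>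
     \<bar>(c pi + s' pi) - (c0 pi + s0' pi)\<bar> < 2 - \<bar>c0 pi + s0' pi\<bar>"
    using discriminant_continuous_at_limit[OF _ fs0, of "2 - \<bar>c0 pi + s0' pi\<bar>"] assms(1) by (metis diff_gt_0_iff_gt less_imp_le)
  show ?thesis
  proof (intro exI[of _ \<rho>] conjI allI impI)
    fix \<epsilon> \<epsilon>' c c' s s'
    assume "0 \<le> \<epsilon>" "\<epsilon> \<le> \<rho>" "0 \<le> \<epsilon>'" "\<epsilon>' \<le> \<rho>" "fundamental_system (hill_k \<epsilon>) (hill_q \<gamma> \<epsilon> \<epsilon>') c c' s s'"
    from \<rho>(2)[OF this] show "\<bar>c pi + s' pi\<bar> < 2" by linarith
  qed (rule \<rho>(1))
qed

lemma discriminant_unstable_range: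
  assumes "\<gamma> > 0" "\<gamma> \<in> K_interval j"
  shows "\<exists>\<rho>>0. \<forall>\<epsilon> \<epsilon>' c c' s s'. 0 \<le> \<epsilon> \<longrightarrow> \<epsilon> \<le> \<rho> \<longrightarrow> 0 \<le> \<epsilon>' \<longrightarrow> \<epsilon>' \<le> \<rho> \<longrightarrow>
     fundamental_system (hill_k \<epsilon>) (hill_q \<gamma> \<epsilon> \<epsilon>') c c' s s' \<longrightarrow> \<bar>c pi + s' pi\<bar> > 2"
proof -
  obtain N where N: "N > 0" "\<gamma> = N * (N + 1) / 2" using triangular_index[OF assms(1)] .
  obtain c0 c0' s0 s0' where fs0: "fundamental_system (hill_k 0) (hill_q \<gamma> 0 0) c0 c0' s0 s0'"
    by (rule hill_fundamental_system_exists[of 0 0 \<gamma>]) (use assms in auto)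
  have "2\<^sup>2 < (c0 pi + s0' pi)\<^sup>2"
    using limit_discriminant[OF N(2) fs0] K_interval_sin_neg[OF assms(2) N(2,1)] by simp
  then have less: "\<bar>c0 pi + s0' pi\<bar> > 2" by (intro power2_less_imp_less[of 2 "\<bar>_\<bar>"]) simp_all
  then obtain \<rho> where \<rho>: "\<rho> > 0" "\<And>\<epsilon> \<epsilon>' c c' s s'. 0 \<le> \<epsilon> \<Longrightarrow> \<epsilon> \<le> \<rho> \<Longrightarrow> 0 \<le> \<epsilon>' \<Longrightarrow> \<epsilon>' \<le> \<rho> \<Longrightarrow>
     fundamental_system (hill_k \<epsilon>) (hill_q \<gamma> \<epsilon> \<epsilon>') c c' s s' \<Longrightarrow>
     \<bar>(c pi + s' pi) - (c0 pi + s0' pi)\<bar> < \<bar>c0 pi + s0' pi\<bar> - 2"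
    using discriminant_continuous_at_limit[OF _ fs0, of "\<bar>c0 pi + s0' pi\<bar> - 2"] assms(1) by (metis diff_gt_0_iff_gt less_imp_le)
  show ?thesis
  proof (intro exI[of _ \<rho>] conjI allI impI)
    fix \<epsilon> \<epsilon>' c c' s s'
    assume "0 \<le> \<epsilon>" "\<epsilon> \<le> \<rho>" "0 \<le> \<epsilon>'" "\<epsilon>' \<le> \<rho>" "fundamental_system (hill_k \<epsilon>) (hill_q \<gamma> \<epsilon> \<epsilon>') c c' s s'"
    from \<rho>(2)[OF this] show "\<bar>c pi + s' pi\<bar> > 2" by linarith
  qed (rule \<rho>(1))
qed

section \<open>The phase of a simple mode\<close>

lemma deriv_on_eqI:
  assumes "(f has_real_derivative D) (at t within {0..})" "t \<ge> 0"
  shows "deriv_on {0..} f t = D"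
proof -
  have "at_right t \<le> at t within {0..}" using assms(2) by (intro at_le) auto
  then have "at t within {0..} \<noteq> bot" using trivial_limit_at_right_real[of t] by (auto simp: bot_unique)
  then show ?thesis
    using assms(1) unfolding deriv_on_def has_real_derivative_iff_has_vector_derivative
    by (rule vector_derivative_within)
qed

lemma C_on_has_derivative:
  assumes "f differentiable_on T" "t \<in> T"
  shows "(f has_real_derivative deriv_on T f t) (at t within T)"
  using assms unfolding deriv_on_def differentiable_on_def has_real_derivative_iff_has_vector_derivative
  by (auto simp flip: vector_derivative_works)

lemma C2_derivatives:
  assumes "C_on 2 T f"
  shows "\<And>t. t \<in> T \<Longrightarrow> (f has_real_derivative deriv_on T f t) (at t within T)"
    and "\<And>t. t \<in> T \<Longrightarrow> (deriv_on T f has_real_derivative deriv_on T (deriv_on T f) t) (at t within T)"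
    and "continuous_on T (deriv_on T (deriv_on T f))"
  using assms by (auto simp: numeral_2_eq_2 intro: C_on_has_derivative)

text \<open>Translates between derivatives chosen by \<open>deriv_on\<close> and the relational form of a first-order system.\<close>

lemma hill_solution_iff_planar:
  assumes "continuous_on {0..} a"
  shows "hill_solution a \<xi> \<longleftrightarrow> (\<exists>\<eta>. planar_solution (\<lambda>_. 1) a {0..} \<xi> \<eta> \<and> (\<forall>t\<ge>0. deriv_on {0..} \<xi> t = \<eta> t))"
proof
  assume h: "hill_solution a \<xi>"
  then have "C_on 2 {0..} \<xi>" by (simp add: hill_solution_def)
  note d = C2_derivatives[OF this]
  have e: "deriv_on {0..} (deriv_on {0..} \<xi>) t = - a t * \<xi> t" if "t \<ge> 0" for t
    using h that by (auto simp: hill_solution_def eq_neg_iff_add_eq_0)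
  show "\<exists>\<eta>. planar_solution (\<lambda>_. 1) a {0..} \<xi> \<eta> \<and> (\<forall>t\<ge>0. deriv_on {0..} \<xi> t = \<eta> t)"
    using d(1,2) e by (intro exI[of _ "deriv_on {0..} \<xi>"]) (auto simp: planar_solution_def)
next
  assume "\<exists>\<eta>. planar_solution (\<lambda>_. 1) a {0..} \<xi> \<eta> \<and> (\<forall>t\<ge>0. deriv_on {0..} \<xi> t = \<eta> t)"
  then obtain \<eta> where sol: "planar_solution (\<lambda>_. 1) a {0..} \<xi> \<eta>" and eq: "\<And>t. t \<ge> 0 \<Longrightarrow> deriv_on {0..} \<xi> t = \<eta> t"
    by blast
  have d1: "(\<xi> has_real_derivative \<eta> t) (at t within {0..})" if "t \<ge> 0" for t
    using sol that by (simp add: planar_solution_def)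
  have d2: "(deriv_on {0..} \<xi> has_real_derivative - a t * \<xi> t) (at t within {0..})" if "t \<ge> 0" for t
    using sol that by (rule_tac has_field_derivative_transform_within[where f = \<eta> and d = 1]) (auto simp: planar_solution_def eq)
  have e: "deriv_on {0..} (deriv_on {0..} \<xi>) t = - a t * \<xi> t" if "t \<ge> 0" for t
    by (rule deriv_on_eqI[OF d2[OF that] that])
  have c: "continuous_on {0..} \<xi>" "continuous_on {0..} (deriv_on {0..} \<xi>)"
    using d1 d2 by (auto intro!: DERIV_continuous_on)
  have "continuous_on {0..} (deriv_on {0..} (deriv_on {0..} \<xi>))"
    using e c assms by (subst continuous_on_cong[OF HOL.refl e]) (auto intro!: continuous_intros)
  then have "C_on 2 {0..} \<xi>"
    using c d1 d2 by (simp add: numeral_2_eq_2 differentiable_on_def real_differentiable_def) blast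
  then show "hill_solution a \<xi>" using e by (simp add: hill_solution_def)
qed

lemma phase_exists:
  assumes eps: "\<epsilon> \<ge> 0" and kap: "\<kappa> > 0"
  obtains \<theta> where "\<theta> 0 = x"
    "\<And>t. t \<ge> 0 \<Longrightarrow> (\<theta> has_real_derivative \<kappa> * sqrt (speed2 \<epsilon> (\<theta> t))) (at t within {0..})"
proof -
  let ?s = "\<lambda>x. sqrt (speed2 \<epsilon> x)"
  have lip: "\<bar>?s x - ?s y\<bar> \<le> 1 * \<bar>x - y\<bar>" for x y :: real
  proof -
    have "norm (?s x - ?s y) \<le> 1 * norm (x - y)"
    proof (rule field_differentiable_bound[of UNIV])
      fix z :: real
      show "(?s has_real_derivative - (cos z * sin z) / (2 * sqrt (speed2 \<epsilon> z))) (at z within UNIV)"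
        by (rule speed_derivative[OF eps])
      have "1/2 \<le> ?s z"
        using speed2_ge[OF eps, of z] by (intro real_le_rsqrt) (simp add: power2_eq_square)
      moreover have "\<bar>cos z * sin z\<bar> \<le> 1 * 1" unfolding abs_mult by (intro mult_mono) auto
      ultimately have "\<bar>cos z * sin z\<bar> / (2 * ?s z) \<le> 1 / 1" by (intro frac_le) auto
      then show "norm (- (cos z * sin z) / (2 * sqrt (speed2 \<epsilon> z))) \<le> 1"
        using speed2_pos[OF eps, of z] by (simp add: abs_mult)
    qed auto
    then show ?thesis by simp
  qed
  obtain \<theta> where "\<theta> 0 = x"
    "\<And>t. t \<ge> 0 \<Longrightarrow> (\<theta> has_vector_derivative \<kappa> * ?s (\<theta> t)) (at t within {0..})"
  proof (rule global_lipschitz_ode_exists[of "\<lambda>t x. \<kappa> * ?s x" \<kappa> x])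
    show "continuous_on S (\<lambda>t. \<kappa> * ?s (g t))" if "continuous_on S g" for g :: "real \<Rightarrow> real" and S
      using that by (auto intro!: continuous_intros simp: speed2_def)
    show "norm (\<kappa> * ?s x - \<kappa> * ?s y) \<le> \<kappa> * norm (x - y)" for x y
      using lip[of x y] kap by (simp add: abs_mult flip: right_diff_distrib)
  qed blast
  then show ?thesis using that by (simp add: has_real_derivative_iff_has_vector_derivative)
qed

text \<open>The velocity \<open>h = \<surd>(speed2 \<epsilon> \<theta>) sin \<theta>\<close> satisfies \<open>h' = \<epsilon> cos \<theta> + cos\<^sup>3 \<theta>\<close> if
  \<open>\<kappa> = 1\<close>, so \<open>R cos \<theta>\<close> solves a Duffing equation.\<close>

lemma cos_phase_derivatives:
  assumes eps: "\<epsilon> \<ge> 0"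
    and \<theta>: "(\<theta> has_real_derivative \<kappa> * sqrt (speed2 \<epsilon> (\<theta> t))) (at t within S)"
  shows "((\<lambda>t. R * cos (\<theta> t)) has_real_derivative - R * \<kappa> * (sqrt (speed2 \<epsilon> (\<theta> t)) * sin (\<theta> t))) (at t within S)"
    and "((\<lambda>t. - R * \<kappa> * (sqrt (speed2 \<epsilon> (\<theta> t)) * sin (\<theta> t))) has_real_derivative
        - R * \<kappa>\<^sup>2 * (\<epsilon> * cos (\<theta> t) + cos (\<theta> t) ^ 3)) (at t within S)"
proof -
  let ?x = "\<theta> t" let ?g = "sqrt (speed2 \<epsilon> ?x)"
  have g0: "?g > 0" using speed2_pos[OF eps, of ?x] by simp
  have g2: "?g * ?g = \<epsilon> + (1 + (cos ?x)\<^sup>2) / 2" using speed2_pos[OF eps, of ?x] by (simp add: speed2_def)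
  have v2: "(sin ?x)\<^sup>2 = 1 - (cos ?x)\<^sup>2" by (simp add: sin_squared_eq)
  show "((\<lambda>t. R * cos (\<theta> t)) has_real_derivative - R * \<kappa> * (?g * sin ?x)) (at t within S)"
    by (rule derivative_eq_intros \<theta> HOL.refl)+ simp
  have "((\<lambda>x. sqrt (speed2 \<epsilon> x) * sin x) has_real_derivative - (cos ?x * sin ?x) / (2 * ?g) * sin ?x + cos ?x * ?g) (at ?x)"
    using DERIV_mult[OF speed_derivative[OF eps, of ?x UNIV] DERIV_sin[of ?x]] .
  then have "((\<lambda>t. sqrt (speed2 \<epsilon> (\<theta> t)) * sin (\<theta> t)) has_real_derivative
      (- (cos ?x * sin ?x) / (2 * ?g) * sin ?x + cos ?x * ?g) * (\<kappa> * ?g)) (at t within S)"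
    using \<theta> by (rule DERIV_chain2)
  then have "((\<lambda>t. - R * \<kappa> * (sqrt (speed2 \<epsilon> (\<theta> t)) * sin (\<theta> t))) has_real_derivative
      - R * \<kappa> * ((- (cos ?x * sin ?x) / (2 * ?g) * sin ?x + cos ?x * ?g) * (\<kappa> * ?g))) (at t within S)"
    by (rule DERIV_cmult)
  also have "(- (cos ?x * sin ?x) / (2 * ?g) * sin ?x + cos ?x * ?g) * (\<kappa> * ?g)
      = \<kappa> * cos ?x * (?g * ?g - (sin ?x)\<^sup>2 / 2)"
    using g0 by (simp add: field_simps power2_eq_square)
  also have "?g * ?g - (sin ?x)\<^sup>2 / 2 = \<epsilon> + (cos ?x)\<^sup>2"
    unfolding g2 v2 by (simp add: field_simps)
  also have "- R * \<kappa> * (\<kappa> * cos ?x * (\<epsilon> + (cos ?x)\<^sup>2)) = - R * \<kappa>\<^sup>2 * (\<epsilon> * cos ?x + cos ?x ^ 3)"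
    by (simp add: algebra_simps power2_eq_square power3_eq_cube)
  finally show "((\<lambda>t. - R * \<kappa> * (sqrt (speed2 \<epsilon> (\<theta> t)) * sin (\<theta> t))) has_real_derivative
        - R * \<kappa>\<^sup>2 * (\<epsilon> * cos (\<theta> t) + cos (\<theta> t) ^ 3)) (at t within S)" .
qed

definition duffing_solution :: "real \<Rightarrow> real \<Rightarrow> (real \<Rightarrow> real) \<Rightarrow> (real \<Rightarrow> real) \<Rightarrow> bool" where
  "duffing_solution A B \<phi> \<phi>' \<longleftrightarrow>
     (\<forall>t\<ge>0. (\<phi> has_real_derivative \<phi>' t) (at t within {0..}) \<and>
            (\<phi>' has_real_derivative - (A * \<phi> t + B * \<phi> t ^ 3)) (at t within {0..}))"

text \<open>The difference of two solutions solves a linear equation whose coefficient is the difference quotient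
  of the nonlinearity.\<close>

lemma duffing_solution_unique:
  assumes \<phi>: "duffing_solution A B \<phi> \<phi>'" and \<psi>: "duffing_solution A B \<psi> \<psi>'"
    and init: "\<phi> 0 = \<psi> 0" "\<phi>' 0 = \<psi>' 0" and t: "t \<ge> 0"
  shows "\<phi> t = \<psi> t"
proof -
  define q where "q t = A + B * ((\<phi> t)\<^sup>2 + \<phi> t * \<psi> t + (\<psi> t)\<^sup>2)" for t
  have "continuous_on {0..} \<phi>" "continuous_on {0..} \<psi>"
    using \<phi> \<psi> by (auto simp: duffing_solution_def intro: DERIV_continuous_on)
  then have "continuous_on {0..} q" unfolding q_def by (intro continuous_intros)
  then have q: "continuous_on {0..t} q" by (rule continuous_on_subset) auto
  have "planar_solution (\<lambda>_. 1) q {0..} (\<lambda>t. \<phi> t - \<psi> t) (\<lambda>t. \<phi>' t - \<psi>' t)"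
    unfolding planar_solution_def
  proof (intro ballI conjI)
    fix s :: real assume s: "s \<in> {0..}"
    show "((\<lambda>t. \<phi> t - \<psi> t) has_real_derivative 1 * (\<phi>' s - \<psi>' s)) (at s within {0..})"
      using \<phi> \<psi> s by (auto simp: duffing_solution_def intro!: derivative_eq_intros)
    have "((\<lambda>t. \<phi>' t - \<psi>' t) has_real_derivative - (A * \<phi> s + B * \<phi> s ^ 3) - - (A * \<psi> s + B * \<psi> s ^ 3)) (at s within {0..})"
      using \<phi> \<psi> s unfolding duffing_solution_def by (intro DERIV_diff) auto
    also have "- (A * \<phi> s + B * \<phi> s ^ 3) - - (A * \<psi> s + B * \<psi> s ^ 3) = - q s * (\<phi> s - \<psi> s)"
      by (simp add: q_def algebra_simps power2_eq_square power3_eq_cube)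
    finally show "((\<lambda>t. \<phi>' t - \<psi>' t) has_real_derivative - q s * (\<phi> s - \<psi> s)) (at s within {0..})" .
  qed
  then have "planar_solution (\<lambda>_. 1) q {0..t} (\<lambda>t. \<phi> t - \<psi> t) (\<lambda>t. \<phi>' t - \<psi>' t)"
    by (rule planar_solution_subset) auto
  from planar_solution_zero_forward[OF this _ q] show ?thesis using init t by auto
qed

text \<open>The initial phase is read off from the initial data; energy conservation says that
  \<open>\<phi>' 0\<close> has the right modulus, and the choice between \<open>arccos\<close> and \<open>2 \<pi> - arccos\<close> gives it the right
  sign. The phase then exists by the Lipschitz theorem, and uniqueness identifies \<open>R cos \<theta>\<close> with \<open>\<phi>\<close>.\<close>

lemma duffing_phase:
  assumes A: "A > 0" and B: "B > 0" and \<phi>: "duffing_solution A B \<phi> \<phi>'"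
    and E: "(\<phi>' 0)\<^sup>2 / 2 + A * (\<phi> 0)\<^sup>2 / 2 + B * \<phi> 0 ^ 4 / 4 = A * R\<^sup>2 / 2 + B * R ^ 4 / 4"
    and lam: "R > 0"
  defines "\<kappa> \<equiv> R * sqrt B" and "\<epsilon> \<equiv> A / (B * R\<^sup>2)"
  obtains \<theta> where "\<theta> 0 \<ge> 0" "\<And>t. t \<ge> 0 \<Longrightarrow> \<phi> t = R * cos (\<theta> t)"
    "\<And>t. t \<ge> 0 \<Longrightarrow> (\<theta> has_real_derivative \<kappa> * sqrt (speed2 \<epsilon> (\<theta> t))) (at t within {0..})"
proof -
  have kap: "\<kappa> > 0" "\<kappa>\<^sup>2 = B * R\<^sup>2" using B lam by (simp_all add: \<kappa>_def power_mult_distrib)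
  have eps: "\<epsilon> > 0" "\<kappa>\<^sup>2 * \<epsilon> = A" using A B lam by (simp_all add: \<epsilon>_def kap)
  define u where "u = \<phi> 0 / R"
  have phi0: "\<phi> 0 = R * u" using lam by (simp add: u_def)
  have E': "(\<phi>' 0)\<^sup>2 = R\<^sup>2 * \<kappa>\<^sup>2 * ((\<epsilon> + (1 + u\<^sup>2) / 2) * (1 - u\<^sup>2))"
  proof -
    have "(\<phi>' 0)\<^sup>2 = R\<^sup>2 * (A * (1 - u\<^sup>2)) + R ^ 4 * B * (1 - u ^ 4) / 2"
      using E unfolding phi0 by (simp add: power_mult_distrib field_simps)
    also have "\<dots> = R\<^sup>2 * (\<kappa>\<^sup>2 * \<epsilon> * (1 - u\<^sup>2) + \<kappa>\<^sup>2 * (1 - u ^ 4) / 2)"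
      unfolding eps(2) unfolding kap(2) by (simp add: field_simps power4_eq_xxxx power2_eq_square)
    also have "\<dots> = R\<^sup>2 * \<kappa>\<^sup>2 * ((\<epsilon> + (1 + u\<^sup>2) / 2) * (1 - u\<^sup>2))"
      by (simp add: field_simps power4_eq_xxxx power2_eq_square)
    finally show ?thesis .
  qed
  have "\<epsilon> + (1 + u\<^sup>2) / 2 > 0" using eps(1) zero_le_power2[of u] by (intro add_pos_nonneg) auto
  then have P: "R\<^sup>2 * \<kappa>\<^sup>2 * (\<epsilon> + (1 + u\<^sup>2) / 2) > 0"
    using lam kap(1) by (intro mult_pos_pos zero_less_power)
  have "0 \<le> (R\<^sup>2 * \<kappa>\<^sup>2 * (\<epsilon> + (1 + u\<^sup>2) / 2)) * (1 - u\<^sup>2)"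
    using E' zero_le_power2[of "\<phi>' 0"] by (simp only: mult.assoc)
  then have "1 - u\<^sup>2 \<ge> 0" using mult_pos_neg[OF P, of "1 - u\<^sup>2"] by linarith
  then have "\<bar>u\<bar> \<le> 1" using abs_square_le_1[of u] by simp
  then have u: "-1 \<le> u" "u \<le> 1" by auto
  define x where "x = (if \<phi>' 0 \<le> 0 then arccos u else 2 * pi - arccos u)"
  have x: "x \<ge> 0" "cos x = u"
    using u arccos_ubound[OF u] arccos_lbound[OF u] pi_gt_zero by (simp_all add: x_def cos_diff)
  have phi'0: "\<phi>' 0 = - R * \<kappa> * (sqrt (speed2 \<epsilon> x) * sin x)"
  proof -
    have ge: "speed2 \<epsilon> x \<ge> 0" using eps speed2_pos[of \<epsilon> x] by simp
    have "(- R * \<kappa> * (sqrt (speed2 \<epsilon> x) * sin x))\<^sup>2 = R\<^sup>2 * \<kappa>\<^sup>2 * (speed2 \<epsilon> x * (sin x)\<^sup>2)"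
      using ge by (simp add: power_mult_distrib)
    also have "\<dots> = (\<phi>' 0)\<^sup>2" unfolding E' by (simp add: speed2_def sin_squared_eq x)
    finally have cases: "- R * \<kappa> * (sqrt (speed2 \<epsilon> x) * sin x) = \<phi>' 0 \<or>
        - R * \<kappa> * (sqrt (speed2 \<epsilon> x) * sin x) = - \<phi>' 0" by (simp only: power2_eq_iff)
    have "0 \<le> R * \<kappa> * sqrt (speed2 \<epsilon> x)" using lam kap(1) ge by simp
    then have sign: "sin x \<ge> 0 \<Longrightarrow> - R * \<kappa> * (sqrt (speed2 \<epsilon> x) * sin x) \<le> 0"
        "sin x \<le> 0 \<Longrightarrow> - R * \<kappa> * (sqrt (speed2 \<epsilon> x) * sin x) \<ge> 0"
      using mult_nonneg_nonneg[of "R * \<kappa> * sqrt (speed2 \<epsilon> x)" "sin x"]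
        mult_nonneg_nonpos[of "R * \<kappa> * sqrt (speed2 \<epsilon> x)" "sin x"] by (simp_all add: mult.assoc)
    have u1: "0 \<le> sqrt (1 - u\<^sup>2)" using \<open>1 - u\<^sup>2 \<ge> 0\<close> by simp
    show ?thesis
    proof (cases "\<phi>' 0 \<le> 0")
      case True
      then have "sin x \<ge> 0" using u u1 by (simp add: x_def sin_arccos)
      then show ?thesis using sign(1) cases True by linarith
    next
      case False
      then have "sin x \<le> 0" using u u1 by (simp add: x_def sin_diff sin_arccos)
      then show ?thesis using sign(2) cases False by linarith
    qed
  qed
  obtain \<theta> where th: "\<theta> 0 = x"
    "\<And>t. t \<ge> 0 \<Longrightarrow> (\<theta> has_real_derivative \<kappa> * sqrt (speed2 \<epsilon> (\<theta> t))) (at t within {0..})"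
    by (rule phase_exists[OF less_imp_le[OF eps(1)] kap(1), where x = x]) blast
  have sol: "duffing_solution A B (\<lambda>t. R * cos (\<theta> t)) (\<lambda>t. - R * \<kappa> * (sqrt (speed2 \<epsilon> (\<theta> t)) * sin (\<theta> t)))"
    unfolding duffing_solution_def
  proof (intro allI impI conjI)
    fix t :: real assume t: "t \<ge> 0"
    note d = cos_phase_derivatives[OF less_imp_le[OF eps(1)] th(2)[OF t], of R]
    show "((\<lambda>t. R * cos (\<theta> t)) has_real_derivative - R * \<kappa> * (sqrt (speed2 \<epsilon> (\<theta> t)) * sin (\<theta> t))) (at t within {0..})"
      by (rule d(1))
    have "- R * \<kappa>\<^sup>2 * (\<epsilon> * cos (\<theta> t) + cos (\<theta> t) ^ 3) = - (R * (\<kappa>\<^sup>2 * \<epsilon>) * cos (\<theta> t) + R * \<kappa>\<^sup>2 * cos (\<theta> t) ^ 3)"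
      by (simp add: algebra_simps)
    also have "\<dots> = - (A * (R * cos (\<theta> t)) + B * (R * cos (\<theta> t)) ^ 3)"
      unfolding eps(2) unfolding kap(2) by (simp add: power_mult_distrib power2_eq_square power3_eq_cube algebra_simps)
    finally show "((\<lambda>t. - R * \<kappa> * (sqrt (speed2 \<epsilon> (\<theta> t)) * sin (\<theta> t))) has_real_derivative
        - (A * (R * cos (\<theta> t)) + B * (R * cos (\<theta> t)) ^ 3)) (at t within {0..})"
      using d(2) by simp
  qed
  show ?thesis
  proof (rule that[of \<theta>])
    show "\<theta> 0 \<ge> 0" using th x by simp
    show "\<phi> t = R * cos (\<theta> t)" if "t \<ge> 0" for t
    proof (rule duffing_solution_unique[OF \<phi> sol _ _ that])
      show "\<phi> 0 = R * cos (\<theta> 0)" unfolding th(1) x(2) by (rule phi0)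
      show "\<phi>' 0 = - R * \<kappa> * (sqrt (speed2 \<epsilon> (\<theta> 0)) * sin (\<theta> 0))" unfolding th(1) by (rule phi'0)
    qed
  qed (rule th(2))
qed

lemma phase_lower_bound:
  assumes eps: "\<epsilon> \<ge> 0" and kap: "\<kappa> > 0"
    and \<theta>: "\<And>t. t \<ge> 0 \<Longrightarrow> (\<theta> has_real_derivative \<kappa> * sqrt (speed2 \<epsilon> (\<theta> t))) (at t within {0..})"
    and t: "t \<ge> 0"
  shows "\<theta> 0 + \<kappa> / 2 * t \<le> \<theta> t"
proof -
  have "\<theta> 0 - \<kappa> / 2 * 0 \<le> \<theta> t - \<kappa> / 2 * t"
  proof (rule DERIV_nonneg_imp_increasing_open[OF t])
    have "continuous_on {0..} \<theta>" 
    using \<theta> by (intro DERIV_continuous_on[where D = "\<lambda>t. \<kappa> * sqrt (speed2 \<epsilon> (\<theta> t))"]) auto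
    then have "continuous_on {0..t} \<theta>" by (rule continuous_on_subset) auto
    then show "continuous_on {0..t} (\<lambda>t. \<theta> t - \<kappa> / 2 * t)" by (intro continuous_intros)
    fix s assume s: "0 < s" "s < t"
    have "at s within {0..} = at s" using s by (intro at_within_interior) auto
    then have "(\<theta> has_real_derivative \<kappa> * sqrt (speed2 \<epsilon> (\<theta> s))) (at s)" using \<theta>[of s] s by simp
    then have "((\<lambda>t. \<theta> t - \<kappa> / 2 * t) has_real_derivative \<kappa> * sqrt (speed2 \<epsilon> (\<theta> s)) - \<kappa> / 2) (at s)"
      by (auto intro!: derivative_eq_intros)
    moreover have "1/2 \<le> sqrt (speed2 \<epsilon> (\<theta> s))"
      using speed2_ge[OF eps, of "\<theta> s"] by (intro real_le_rsqrt) (simp add: power2_eq_square)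
    then have "\<kappa> * (1/2) \<le> \<kappa> * sqrt (speed2 \<epsilon> (\<theta> s))" using kap by (intro mult_left_mono) auto
    then have "\<kappa> * sqrt (speed2 \<epsilon> (\<theta> s)) - \<kappa> / 2 \<ge> 0" by simp
    ultimately show "\<exists>y. ((\<lambda>t. \<theta> t - \<kappa> / 2 * t) has_real_derivative y) (at s) \<and> 0 \<le> y" by blast
  qed
  then show ?thesis by simp
qed

section \<open>Stability and instability of the Hill equation\<close>

lemma hill_periodic: "hill_k \<epsilon> (t + pi) = hill_k \<epsilon> t" "hill_q \<gamma> \<epsilon> \<epsilon>' (t + pi) = hill_q \<gamma> \<epsilon> \<epsilon>' t"
  by (simp_all add: hill_k_def hill_q_def speed2_def)

text \<open>A Hill equation in time whose coefficient is driven by a phase \<open>\<theta>\<close>, together with a fundamental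
  matrix of the associated periodic system in the phase variable. The initial phase is nonnegative, so
  that the solutions on the half line can be composed with \<open>\<theta>\<close>.\<close>

locale hill_in_phase =
  fixes \<epsilon> \<epsilon>' \<gamma> \<kappa> :: real and \<theta> a c c' s s' :: "real \<Rightarrow> real"
  assumes nonneg: "\<epsilon> \<ge> 0" "\<epsilon>' \<ge> 0" "\<gamma> \<ge> 0" and kap: "\<kappa> > 0"
    and \<theta>0: "\<theta> 0 \<ge> 0"
    and \<theta>: "t \<ge> 0 \<Longrightarrow> (\<theta> has_real_derivative \<kappa> * sqrt (speed2 \<epsilon> (\<theta> t))) (at t within {0..})"
    and a: "t \<ge> 0 \<Longrightarrow> a t = \<kappa>\<^sup>2 * (\<epsilon>' + \<gamma> * (cos (\<theta> t))\<^sup>2)"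
    and fs: "fundamental_system (hill_k \<epsilon>) (hill_q \<gamma> \<epsilon> \<epsilon>') c c' s s'"
begin

sublocale periodic_planar "hill_k \<epsilon>" "hill_q \<gamma> \<epsilon> \<epsilon>'" pi c c' s s'
  by unfold_locales
     (simp_all add: hill_k_continuous hill_q_continuous hill_periodic nonneg fs)

lemma theta_continuous: "continuous_on {0..} \<theta>"
  
    using \<theta> by (intro DERIV_continuous_on[where D = "\<lambda>t. \<kappa> * sqrt (speed2 \<epsilon> (\<theta> t))"]) auto

lemma theta_ge: "t \<ge> 0 \<Longrightarrow> \<theta> 0 + \<kappa> / 2 * t \<le> \<theta> t"
  by (rule phase_lower_bound[OF nonneg(1) kap \<theta>])

lemma theta_nonneg: "t \<ge> 0 \<Longrightarrow> \<theta> t \<ge> 0"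
  using theta_ge[of t] \<theta>0 kap by (smt (verit) divide_nonneg_pos mult_nonneg_nonneg)

lemma theta_hits:
  assumes "y \<ge> \<theta> 0"
  obtains t where "t \<ge> 0" "\<theta> t = y"
proof -
  let ?b = "2 * (y - \<theta> 0) / \<kappa>"
  have b: "?b \<ge> 0" using assms kap by simp
  moreover have "\<theta> 0 + \<kappa> / 2 * ?b = y" using kap by (simp add: field_simps)
  ultimately have "y \<le> \<theta> ?b" using theta_ge[of ?b] by simp
  then obtain t where "0 \<le> t" "t \<le> ?b" "\<theta> t = y"
    using IVT'[of \<theta> 0 y ?b] assms b continuous_on_subset[OF theta_continuous, of "{0..?b}"] by auto
  then show ?thesis using that by blast
qed

lemma a_continuous: "continuous_on {0..} a"
  using theta_continuous by (subst continuous_on_cong[OF HOL.refl a]) (auto intro!: continuous_intros)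

lemma solution_in_time:
  assumes "planar_solution (hill_k \<epsilon>) (hill_q \<gamma> \<epsilon> \<epsilon>') {0..} X Y"
  shows "planar_solution (\<lambda>_. 1) a {0..} (\<lambda>t. X (\<theta> t)) (\<lambda>t. \<kappa> * Y (\<theta> t))"
  unfolding planar_solution_def
proof (intro ballI conjI)
  fix t :: real assume "t \<in> {0..}"
  then have t: "t \<ge> 0" by simp
  let ?g = "sqrt (speed2 \<epsilon> (\<theta> t))"
  have g: "?g > 0" using speed2_pos[OF nonneg(1), of "\<theta> t"] by simp
  have img: "\<theta> ` {0..} \<subseteq> {0..}" using theta_nonneg by auto
  have X: "(X has_real_derivative hill_k \<epsilon> (\<theta> t) * Y (\<theta> t)) (at (\<theta> t) within \<theta> ` {0..})"
    and Y: "(Y has_real_derivative - hill_q \<gamma> \<epsilon> \<epsilon>' (\<theta> t) * X (\<theta> t)) (at (\<theta> t) within \<theta> ` {0..})"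
    using assms theta_nonneg[OF t] unfolding planar_solution_def by (auto intro: DERIV_subset[OF _ img])
  have "((\<lambda>t. X (\<theta> t)) has_real_derivative hill_k \<epsilon> (\<theta> t) * Y (\<theta> t) * (\<kappa> * ?g)) (at t within {0..})"
    using DERIV_image_chain[OF X \<theta>[OF t]] by (simp add: o_def)
  also have "hill_k \<epsilon> (\<theta> t) * Y (\<theta> t) * (\<kappa> * ?g) = 1 * (\<kappa> * Y (\<theta> t))"
    using g by (simp add: hill_k_def)
  finally show "((\<lambda>t. X (\<theta> t)) has_real_derivative 1 * (\<kappa> * Y (\<theta> t))) (at t within {0..})" .
  have "((\<lambda>t. Y (\<theta> t)) has_real_derivative - hill_q \<gamma> \<epsilon> \<epsilon>' (\<theta> t) * X (\<theta> t) * (\<kappa> * ?g)) (at t within {0..})"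
    using DERIV_image_chain[OF Y \<theta>[OF t]] by (simp add: o_def)
  then have "((\<lambda>t. \<kappa> * Y (\<theta> t)) has_real_derivative \<kappa> * (- hill_q \<gamma> \<epsilon> \<epsilon>' (\<theta> t) * X (\<theta> t) * (\<kappa> * ?g))) (at t within {0..})"
    by (rule DERIV_cmult)
  also have "\<kappa> * (- hill_q \<gamma> \<epsilon> \<epsilon>' (\<theta> t) * X (\<theta> t) * (\<kappa> * ?g)) = - a t * X (\<theta> t)"
    using g unfolding a[OF t] by (simp add: hill_q_def power2_eq_square)
  finally show "((\<lambda>t. \<kappa> * Y (\<theta> t)) has_real_derivative - a t * X (\<theta> t)) (at t within {0..})" .
qed

text \<open>The factors \<open>p\<close> and \<open>r\<close> invert the fundamental matrix at the initial phase, by Cramer's rule.\<close>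

lemma hill_solution_in_phase:
  assumes "hill_solution a \<xi>"
  defines "x \<equiv> \<xi> 0" and "y \<equiv> deriv_on {0..} \<xi> 0 / \<kappa>"
  defines "p \<equiv> x * s' (\<theta> 0) - y * s (\<theta> 0)" and "r \<equiv> y * c (\<theta> 0) - x * c' (\<theta> 0)"
  assumes t: "t \<ge> 0"
  shows "\<xi> t = p * c (\<theta> t) + r * s (\<theta> t)" "deriv_on {0..} \<xi> t = \<kappa> * (p * c' (\<theta> t) + r * s' (\<theta> t))"
proof -
  obtain \<eta> where \<eta>: "planar_solution (\<lambda>_. 1) a {0..} \<xi> \<eta>" "\<And>t. t \<ge> 0 \<Longrightarrow> deriv_on {0..} \<xi> t = \<eta> t"
    using assms(1) hill_solution_iff_planar[OF a_continuous] by blast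
  have "planar_solution (hill_k \<epsilon>) (hill_q \<gamma> \<epsilon> \<epsilon>') {0..} (\<lambda>t. p * c t + r * s t) (\<lambda>t. p * c' t + r * s' t)"
    using fs by (intro planar_solution_lincomb) (auto simp: fundamental_system_def)
  note sol = solution_in_time[OF this]
  have det: "c (\<theta> 0) * s' (\<theta> 0) - s (\<theta> 0) * c' (\<theta> 0) = 1"
    by (rule fundamental_system_det[OF fs \<theta>0])
  have "p * c (\<theta> 0) + r * s (\<theta> 0) = x * (c (\<theta> 0) * s' (\<theta> 0) - s (\<theta> 0) * c' (\<theta> 0))"
    by (simp add: p_def r_def algebra_simps)
  then have i1: "\<xi> 0 = p * c (\<theta> 0) + r * s (\<theta> 0)" unfolding det x_def by simp
  have "p * c' (\<theta> 0) + r * s' (\<theta> 0) = y * (c (\<theta> 0) * s' (\<theta> 0) - s (\<theta> 0) * c' (\<theta> 0))"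
    by (simp add: p_def r_def algebra_simps)
  then have i2: "\<eta> 0 = \<kappa> * (p * c' (\<theta> 0) + r * s' (\<theta> 0))"
    unfolding det y_def using kap \<eta>(2)[of 0] by simp
  have sub: "{0..t} \<subseteq> {0..}" by auto
  have "\<xi> t = p * c (\<theta> t) + r * s (\<theta> t) \<and> \<eta> t = \<kappa> * (p * c' (\<theta> t) + r * s' (\<theta> t))"
    using t by (intro planar_solution_unique[OF planar_solution_subset[OF \<eta>(1) sub] planar_solution_subset[OF sol sub]
        continuous_on_const continuous_on_subset[OF a_continuous sub], where c = 0 and t = t] i1 i2) auto
  then show "\<xi> t = p * c (\<theta> t) + r * s (\<theta> t)" "deriv_on {0..} \<xi> t = \<kappa> * (p * c' (\<theta> t) + r * s' (\<theta> t))"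
    using \<eta>(2)[OF t] by auto
qed

text \<open>A bounded fundamental matrix bounds every solution by a fixed multiple of its initial data.\<close>

lemma hill_stable:
  assumes "\<bar>c pi + s' pi\<bar> < 2"
  shows "hill_zero_stable a"
proof -
  obtain B1 where B1: "\<And>t. t \<ge> 0 \<Longrightarrow> \<bar>c t\<bar> \<le> B1" "\<And>t. t \<ge> 0 \<Longrightarrow> \<bar>c' t\<bar> \<le> B1"
    using solution_bounded[OF assms, of c c'] fs unfolding fundamental_system_def by blast
  obtain B2 where B2: "\<And>t. t \<ge> 0 \<Longrightarrow> \<bar>s t\<bar> \<le> B2" "\<And>t. t \<ge> 0 \<Longrightarrow> \<bar>s' t\<bar> \<le> B2"
    using solution_bounded[OF assms, of s s'] fs unfolding fundamental_system_def by blast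
  define B where "B = max B1 B2"
  have B: "\<bar>c t\<bar> \<le> B" "\<bar>c' t\<bar> \<le> B" "\<bar>s t\<bar> \<le> B" "\<bar>s' t\<bar> \<le> B" if "t \<ge> 0" for t
    using B1[OF that] B2[OF that] by (auto simp: B_def)
  have B0: "B \<ge> 0" using B(1)[of 0] by linarith
  define C where "C = (1 + \<kappa>) * (2 * B * (B * (1 + 1 / \<kappa>)))"
  have C: "C \<ge> 0" using B0 kap by (simp add: C_def)
  have bound: "norm (\<xi> t, deriv_on {0..} \<xi> t) \<le> C * norm (\<xi> 0, deriv_on {0..} \<xi> 0)"
    if \<xi>: "hill_solution a \<xi>" and t: "t \<ge> 0" for \<xi> t
  proof -
    define \<nu> where "\<nu> = norm (\<xi> 0, deriv_on {0..} \<xi> 0)"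
    define x y where "x = \<xi> 0" and "y = deriv_on {0..} \<xi> 0 / \<kappa>"
    define p r where "p = x * s' (\<theta> 0) - y * s (\<theta> 0)" and "r = y * c (\<theta> 0) - x * c' (\<theta> 0)"
    have nu: "\<bar>\<xi> 0\<bar> \<le> \<nu>" "\<bar>deriv_on {0..} \<xi> 0\<bar> \<le> \<nu>"
      using norm_fst_le[of "\<xi> 0" "deriv_on {0..} \<xi> 0"] norm_snd_le[of "deriv_on {0..} \<xi> 0" "\<xi> 0"] by (simp_all add: \<nu>_def)
    have nu0: "\<nu> \<ge> 0" by (simp add: \<nu>_def)
    have xy: "\<bar>x\<bar> \<le> \<nu>" "\<bar>y\<bar> \<le> \<nu> / \<kappa>"
      using nu kap by (simp_all add: x_def y_def divide_right_mono)
    have lin: "\<bar>a1 * b1 + a2 * b2\<bar> \<le> m1 * n + m2 * n"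
      if "\<bar>a1\<bar> \<le> m1" "\<bar>a2\<bar> \<le> m2" "\<bar>b1\<bar> \<le> n" "\<bar>b2\<bar> \<le> n" for a1 a2 b1 b2 m1 m2 n :: real
    proof -
      have "\<bar>a1\<bar> * \<bar>b1\<bar> \<le> m1 * n" "\<bar>a2\<bar> * \<bar>b2\<bar> \<le> m2 * n"
        using that by (intro mult_mono; linarith)+
      then show ?thesis using abs_triangle_ineq[of "a1 * b1" "a2 * b2"] by (simp add: abs_mult)
    qed
    have pr: "\<bar>p\<bar> \<le> B * (1 + 1 / \<kappa>) * \<nu>" "\<bar>r\<bar> \<le> B * (1 + 1 / \<kappa>) * \<nu>"
    proof -
      have e: "\<nu> * B + \<nu> / \<kappa> * B = B * (1 + 1 / \<kappa>) * \<nu>" "\<nu> / \<kappa> * B + \<nu> * B = B * (1 + 1 / \<kappa>) * \<nu>"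
        by (simp_all add: algebra_simps)
      show "\<bar>p\<bar> \<le> B * (1 + 1 / \<kappa>) * \<nu>"
        using lin[of x \<nu> y "\<nu> / \<kappa>" "s' (\<theta> 0)" B "- s (\<theta> 0)"] xy B[OF \<theta>0] unfolding p_def e by simp
      show "\<bar>r\<bar> \<le> B * (1 + 1 / \<kappa>) * \<nu>"
        using lin[of y "\<nu> / \<kappa>" x \<nu> "c (\<theta> 0)" B "- c' (\<theta> 0)"] xy B[OF \<theta>0] unfolding r_def e by simp
    qed
    note eq = hill_solution_in_phase[OF \<xi> t, folded x_def y_def, folded p_def r_def]
    have th: "\<theta> t \<ge> 0" by (rule theta_nonneg[OF t])
    have M: "B * (1 + 1 / \<kappa>) * \<nu> * B + B * (1 + 1 / \<kappa>) * \<nu> * B = 2 * B * (B * (1 + 1 / \<kappa>)) * \<nu>"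
      by (simp add: algebra_simps)
    have b1: "\<bar>\<xi> t\<bar> \<le> 2 * B * (B * (1 + 1 / \<kappa>)) * \<nu>"
      using lin[OF pr B(1,3)[OF th]] unfolding M eq(1) .
    have "\<bar>p * c' (\<theta> t) + r * s' (\<theta> t)\<bar> \<le> 2 * B * (B * (1 + 1 / \<kappa>)) * \<nu>"
      using lin[OF pr B(2,4)[OF th]] unfolding M .
    then have b2: "\<bar>deriv_on {0..} \<xi> t\<bar> \<le> \<kappa> * (2 * B * (B * (1 + 1 / \<kappa>)) * \<nu>)"
      unfolding eq(2) abs_mult[of \<kappa>] using kap by simp
    have "norm (\<xi> t, deriv_on {0..} \<xi> t) \<le> \<bar>\<xi> t\<bar> + \<bar>deriv_on {0..} \<xi> t\<bar>"
      using norm_Pair_le[of "\<xi> t" "deriv_on {0..} \<xi> t"] by simp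
    also have "\<dots> \<le> 2 * B * (B * (1 + 1 / \<kappa>)) * \<nu> + \<kappa> * (2 * B * (B * (1 + 1 / \<kappa>)) * \<nu>)"
      using b1 b2 by (rule add_mono)
    also have "\<dots> = C * \<nu>" by (simp only: C_def distrib_right mult_1_left mult.assoc)
    finally show ?thesis by (simp only: \<nu>_def)
  qed
  show ?thesis
    unfolding hill_zero_stable_def
  proof (intro allI impI)
    fix e :: real assume e: "e > 0"
    have C1: "C + 1 > 0" using C by simp
    show "\<exists>\<delta>>0. \<forall>\<xi>. hill_solution a \<xi> \<longrightarrow> norm (\<xi> 0, deriv_on {0..} \<xi> 0) < \<delta> \<longrightarrow>
        (\<forall>t\<ge>0. norm (\<xi> t, deriv_on {0..} \<xi> t) < e)"
    proof (intro exI[of _ "e / (C + 1)"] conjI allI impI)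
      show "e / (C + 1) > 0" using e C1 by simp
      fix \<xi> t assume \<xi>: "hill_solution a \<xi>" and small: "norm (\<xi> 0, deriv_on {0..} \<xi> 0) < e / (C + 1)" and t: "(t::real) \<ge> 0"
      have "norm (\<xi> t, deriv_on {0..} \<xi> t) \<le> C * norm (\<xi> 0, deriv_on {0..} \<xi> 0)" by (rule bound[OF \<xi> t])
      also have "\<dots> \<le> C * (e / (C + 1))" using small C by (intro mult_left_mono) auto
      also have "\<dots> < e" using e C1 C by (simp add: field_simps)
      finally show "norm (\<xi> t, deriv_on {0..} \<xi> t) < e" .
    qed
  qed
qed

text \<open>At the times when the phase has advanced by \<open>n \<pi>\<close>, the solution with multiplier \<open>\<mu>\<close> has grown by the
  factor \<open>\<mu>\<^sup>n\<close>; rescaling it makes its initial data as small as desired.\<close>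

lemma hill_unstable:
  assumes "\<bar>c pi + s' pi\<bar> > 2"
  shows "\<not> hill_zero_stable a"
proof
  assume "hill_zero_stable a"
  then obtain d where d: "d > 0" "\<And>\<xi> t. hill_solution a \<xi> \<Longrightarrow> norm (\<xi> 0, deriv_on {0..} \<xi> 0) < d \<Longrightarrow> t \<ge> 0 \<Longrightarrow>
      norm (\<xi> t, deriv_on {0..} \<xi> t) < 1"
    unfolding hill_zero_stable_def by (metis zero_less_one)
  obtain X Y \<mu> where XY: "planar_solution (hill_k \<epsilon>) (hill_q \<gamma> \<epsilon> \<epsilon>') {0..} X Y" "\<bar>\<mu>\<bar> > 1" "X 0 \<noteq> 0 \<or> Y 0 \<noteq> 0"
    "\<And>t. t \<ge> 0 \<Longrightarrow> X (t + pi) = \<mu> * X t" "\<And>t. t \<ge> 0 \<Longrightarrow> Y (t + pi) = \<mu> * Y t"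
    using growing_solution[OF assms] by metis
  define v where "v = norm (X (\<theta> 0), \<kappa> * Y (\<theta> 0))"
  have "v \<noteq> 0"
  proof
    assume "v = 0"
    then have z: "X (\<theta> 0) = 0" "Y (\<theta> 0) = 0" using kap by (simp_all add: v_def zero_prod_def)
    have sub: "{0..\<theta> 0} \<subseteq> {0..}" by auto
    have "X 0 = 0 \<and> Y 0 = 0"
      using \<theta>0 by (intro planar_solution_zero[OF planar_solution_subset[OF XY(1) sub]
          hill_k_continuous[OF nonneg(1)] hill_q_continuous[OF nonneg(1)], where c = "\<theta> 0"] z) auto
    then show False using XY(3) by simp
  qed
  then have v: "v > 0" by (simp add: v_def)
  define r where "r = d / (2 * v)"
  have r: "r > 0" using d v by (simp add: r_def)
  define \<xi> \<eta> where "\<xi> t = r * X (\<theta> t)" and "\<eta> t = r * (\<kappa> * Y (\<theta> t))" for t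
  have sol: "planar_solution (\<lambda>_. 1) a {0..} \<xi> \<eta>"
    using planar_solution_lincomb[OF solution_in_time[OF XY(1)] solution_in_time[OF XY(1)], of r 0]
    by (simp add: \<xi>_def[abs_def] \<eta>_def[abs_def])
  have D: "deriv_on {0..} \<xi> t = \<eta> t" if "t \<ge> 0" for t
    using sol that by (intro deriv_on_eqI) (auto simp: planar_solution_def)
  have hill: "hill_solution a \<xi>"
    using sol D hill_solution_iff_planar[OF a_continuous] by blast
  have nrm: "norm (r * x, r * y) = r * norm (x, y)" for x y :: real
    using norm_scaleR[of r "(x, y)"] r by simp
  have "norm (\<xi> 0, deriv_on {0..} \<xi> 0) = d / 2"
    using v by (simp add: D \<xi>_def \<eta>_def nrm flip: v_def) (simp add: r_def)
  then have "norm (\<xi> 0, deriv_on {0..} \<xi> 0) < d" using d by simp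
  note small = d(2)[OF hill this]
  have pow: "X (\<theta> 0 + real n * pi) = \<mu> ^ n * X (\<theta> 0)" "Y (\<theta> 0 + real n * pi) = \<mu> ^ n * Y (\<theta> 0)" for n
  proof (induction n)
    case (Suc n)
    have e: "\<theta> 0 + real (Suc n) * pi = (\<theta> 0 + real n * pi) + pi" by (simp add: algebra_simps)
    have ge: "\<theta> 0 + real n * pi \<ge> 0" using \<theta>0 by simp
    show "X (\<theta> 0 + real (Suc n) * pi) = \<mu> ^ Suc n * X (\<theta> 0)" unfolding e XY(4)[OF ge] Suc by simp
    show "Y (\<theta> 0 + real (Suc n) * pi) = \<mu> ^ Suc n * Y (\<theta> 0)" unfolding e XY(5)[OF ge] Suc by simp
  qed simp_all
  have "\<bar>\<mu>\<bar> ^ n * (d / 2) < 1" for n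
  proof -
    have "\<theta> 0 + real n * pi \<ge> \<theta> 0" by simp
    then obtain t where t: "t \<ge> 0" "\<theta> t = \<theta> 0 + real n * pi" by (rule theta_hits)
    have "(\<xi> t, deriv_on {0..} \<xi> t) = \<mu> ^ n *\<^sub>R (r * X (\<theta> 0), r * (\<kappa> * Y (\<theta> 0)))"
      unfolding D[OF t(1)] \<xi>_def \<eta>_def t(2) pow by simp
    then have "norm (\<xi> t, deriv_on {0..} \<xi> t) = \<bar>\<mu>\<bar> ^ n * (r * v)"
      by (simp only: norm_scaleR nrm v_def power_abs)
    also have "r * v = d / 2" using v by (simp add: r_def)
    finally show ?thesis using small[OF t(1)] by simp
  qed
  moreover obtain n where "1 / (d / 2) < \<bar>\<mu>\<bar> ^ n" using real_arch_pow[OF XY(2)] by blast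
  then have "1 < \<bar>\<mu>\<bar> ^ n * (d / 2)" using d by (simp add: field_simps)
  ultimately show False by (metis less_asym)
qed

end

section \<open>Simple modes of the plate\<close>

lemma deriv_on_cong:
  assumes "t \<in> T" "\<And>s. s \<in> T \<Longrightarrow> f s = g s"
  shows "deriv_on T f t = deriv_on T g t"
proof -
  have "(f has_vector_derivative D) (at t within T) \<longleftrightarrow> (g has_vector_derivative D) (at t within T)" for D
    using has_vector_derivative_transform[of t T g f D] has_vector_derivative_transform[of t T f g D] assms
    by metis
  then show ?thesis by (simp add: deriv_on_def vector_derivative_def)
qed

lemma deriv_on_Icc_eqI:
  assumes "(f has_real_derivative D) (at t within {a..b})" "t \<in> {a..b}" "a < b"
  shows "deriv_on {a..b} f t = D"
  using assms unfolding deriv_on_def has_real_derivative_iff_has_vector_derivative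
  by (auto intro!: vector_derivative_within_cbox[where 'a = real, unfolded cbox_interval])

lemma deriv_on_lincomb:
  assumes "f differentiable_on {a..b}" "g differentiable_on {a..b}" "t \<in> {a..b}" "a < b"
  shows "deriv_on {a..b} (\<lambda>s. p * f s + q * g s) t = p * deriv_on {a..b} f t + q * deriv_on {a..b} g t"
  using assms by (intro deriv_on_Icc_eqI) (auto intro!: derivative_eq_intros C_on_has_derivative)

lemma dx_cong:
  assumes "\<And>z. z \<in> closed_plate l \<Longrightarrow> u z = v z" "z \<in> closed_plate l"
  shows "dx u z = dx v z"
  using assms unfolding dx_def by (intro deriv_on_cong) (auto simp: closed_plate_def)

lemma dy_cong:
  assumes "\<And>z. z \<in> closed_plate l \<Longrightarrow> u z = v z" "z \<in> closed_plate l"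
  shows "dy l u z = dy l v z"
  using assms unfolding dy_def by (intro deriv_on_cong) (auto simp: closed_plate_def)

lemma laplacian_cong:
  assumes eq: "\<And>z. z \<in> closed_plate l \<Longrightarrow> u z = v z" and z: "z \<in> closed_plate l"
  shows "laplacian l u z = laplacian l v z"
proof -
  have "dx (dx u) z = dx (dx v) z" by (rule dx_cong[OF _ z]) (rule dx_cong[OF eq])
  moreover have "dy l (dy l u) z = dy l (dy l v) z" by (rule dy_cong[OF _ z]) (rule dy_cong[OF eq])
  ultimately show ?thesis by (simp add: laplacian_def)
qed

lemma dx_dy_lincomb:
  assumes l: "l > 0" and C: "C_plate (Suc k) l u" "C_plate (Suc k) l v" and z: "z \<in> closed_plate l"
  shows "dx (\<lambda>z. p * u z + q * v z) z = p * dx u z + q * dx v z"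
    and "dy l (\<lambda>z. p * u z + q * v z) z = p * dy l u z + q * dy l v z"
proof -
  have z': "fst z \<in> {0..pi}" "snd z \<in> {-l..l}" using z by (auto simp: closed_plate_def)
  show "dx (\<lambda>z. p * u z + q * v z) z = p * dx u z + q * dx v z"
    unfolding dx_def using C z' by (intro deriv_on_lincomb) auto
  show "dy l (\<lambda>z. p * u z + q * v z) z = p * dy l u z + q * dy l v z"
    unfolding dy_def using C z' l by (intro deriv_on_lincomb) auto
qed

lemma differentiable_on_transform:
  assumes "f differentiable_on S" "\<And>x. x \<in> S \<Longrightarrow> g x = f x"
  shows "g differentiable_on S"
  using assms unfolding differentiable_on_def differentiable_def
  by (metis has_derivative_transform)

lemma C_plate_cong:
  assumes "\<And>z. z \<in> closed_plate l \<Longrightarrow> u z = v z" "C_plate k l u"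
  shows "C_plate k l v"
  using assms
proof (induction k arbitrary: u v)
  case 0
  then show ?case using continuous_on_cong[of "closed_plate l" "closed_plate l" u v] by simp
next
  case (Suc k)
  have d: "C_plate k l (dx v)" "C_plate k l (dy l v)"
    using Suc.IH[OF dx_cong[OF Suc.prems(1)]] Suc.IH[OF dy_cong[OF Suc.prems(1)]] Suc.prems(2) by auto
  have c: "continuous_on (closed_plate l) v"
    using Suc.prems continuous_on_cong[of "closed_plate l" "closed_plate l" u v] by simp
  have x: "(\<lambda>x. v (x, y)) differentiable_on {0..pi}" if "y \<in> {-l..l}" for y
  proof (rule differentiable_on_transform)
    show "(\<lambda>x. u (x, y)) differentiable_on {0..pi}" using Suc.prems(2) that by simp
    show "v (x, y) = u (x, y)" if "x \<in> {0..pi}" for x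
      by (rule Suc.prems(1)[symmetric]) (use that \<open>y \<in> {-l..l}\<close> in \<open>simp add: closed_plate_def\<close>)
  qed
  have y: "(\<lambda>y. v (x, y)) differentiable_on {-l..l}" if "x \<in> {0..pi}" for x
  proof (rule differentiable_on_transform)
    show "(\<lambda>y. u (x, y)) differentiable_on {-l..l}" using Suc.prems(2) that by simp
    show "v (x, y) = u (x, y)" if "y \<in> {-l..l}" for y
      by (rule Suc.prems(1)[symmetric]) (use that \<open>x \<in> {0..pi}\<close> in \<open>simp add: closed_plate_def\<close>)
  qed
  show ?case using c x y d by simp
qed

lemma C_plate_lincomb:
  assumes "l > 0" "C_plate k l u" "C_plate k l v"
  shows "C_plate k l (\<lambda>z. p * u z + q * v z)"
  using assms(2,3)
proof (induction k arbitrary: u v)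
  case 0
  then show ?case by (auto intro!: continuous_intros)
next
  case (Suc k)
  note lin = dx_dy_lincomb[OF assms(1) Suc.prems]
  have C: "C_plate k l (\<lambda>z. p * dx u z + q * dx v z)" "C_plate k l (\<lambda>z. p * dy l u z + q * dy l v z)"
    using Suc by auto
  have d: "C_plate k l (dx (\<lambda>z. p * u z + q * v z))"
    by (rule C_plate_cong[OF _ C(1)]) (rule lin(1)[symmetric])
  have d': "C_plate k l (dy l (\<lambda>z. p * u z + q * v z))"
    by (rule C_plate_cong[OF _ C(2)]) (rule lin(2)[symmetric])
  show ?case using Suc.prems d d' by (auto intro!: continuous_intros derivative_intros)
qed

lemma laplacian_scale:
  assumes l: "l > 0" and C: "C_plate (Suc (Suc k)) l u" and z: "z \<in> closed_plate l"
  shows "laplacian l (\<lambda>z. p * u z) z = p * laplacian l u z"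
proof -
  have 1: "dx (\<lambda>z. p * u z) z = p * dx u z" "dy l (\<lambda>z. p * u z) z = p * dy l u z"
    if "C_plate (Suc k) l u" "z \<in> closed_plate l" for u z k
    using dx_dy_lincomb[OF l that(1) that(1) that(2), of p 0] by simp_all
  have "dx (dx (\<lambda>z. p * u z)) z = dx (\<lambda>z. p * dx u z) z" by (rule dx_cong[OF 1(1)[OF C] z])
  moreover have "dy l (dy l (\<lambda>z. p * u z)) z = dy l (\<lambda>z. p * dy l u z) z" by (rule dy_cong[OF 1(2)[OF C] z])
  ultimately show ?thesis
    using C 1(1)[of k "dx u" z] 1(2)[of k "dy l u" z] z by (simp add: laplacian_def distrib_left)
qed

lemma C_plate_laplacian:
  assumes "l > 0" "C_plate (Suc (Suc k)) l u"
  shows "C_plate k l (laplacian l u)"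
proof -
  have "C_plate k l (\<lambda>z. 1 * dx (dx u) z + 1 * dy l (dy l u) z)"
    using assms by (intro C_plate_lincomb) auto
  then show ?thesis by (simp add: laplacian_def[abs_def])
qed

lemma bilaplacian_scale:
  assumes l: "l > 0" and C: "C_plate 4 l u" and z: "z \<in> closed_plate l"
  shows "laplacian l (laplacian l (\<lambda>z. p * u z)) z = p * laplacian l (laplacian l u) z"
proof -
  have C': "C_plate (Suc (Suc (Suc (Suc 0)))) l u" using C by (simp add: eval_nat_numeral)
  have "laplacian l (laplacian l (\<lambda>z. p * u z)) z = laplacian l (\<lambda>z. p * laplacian l u z) z"
    by (rule laplacian_cong[OF laplacian_scale[OF l C'] z])
  also have "\<dots> = p * laplacian l (laplacian l u) z"
    by (rule laplacian_scale[OF l C_plate_laplacian[OF l C'] z])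
  finally show ?thesis .
qed

lemma dx_mode_shape:
  assumes "z \<in> closed_plate l"
  shows "dx (\<lambda>z. p * mode_shape \<psi> m i z) z = p * (\<psi> m i (snd z) * (real m * cos (real m * fst z)))"
    and "dx (dx (\<lambda>z. p * mode_shape \<psi> m i z)) z = - (real m)\<^sup>2 * (p * mode_shape \<psi> m i z)"
proof -
  have 1: "dx (\<lambda>z. p * mode_shape \<psi> m i z) z = p * (\<psi> m i (snd z) * (real m * cos (real m * fst z)))"
    if "z \<in> closed_plate l" for z
    unfolding dx_def using that
    by (intro deriv_on_Icc_eqI) (auto simp: closed_plate_def mode_shape_def intro!: derivative_eq_intros)
  show "dx (\<lambda>z. p * mode_shape \<psi> m i z) z = p * (\<psi> m i (snd z) * (real m * cos (real m * fst z)))"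
    by (rule 1[OF assms])
  have "dx (dx (\<lambda>z. p * mode_shape \<psi> m i z)) z = dx (\<lambda>z. p * (\<psi> m i (snd z) * (real m * cos (real m * fst z)))) z"
    by (rule dx_cong[OF 1 assms])
  also have "\<dots> = - (real m)\<^sup>2 * (p * mode_shape \<psi> m i z)"
    unfolding dx_def using assms
    by (intro deriv_on_Icc_eqI) (auto simp: closed_plate_def mode_shape_def power2_eq_square intro!: derivative_eq_intros)
  finally show "dx (dx (\<lambda>z. p * mode_shape \<psi> m i z)) z = - (real m)\<^sup>2 * (p * mode_shape \<psi> m i z)" .
qed

lemma integral_product_on_plate:
  fixes f g :: "real \<Rightarrow> real"
  assumes "continuous_on {0..pi} f" "continuous_on {-l..l} g"
  shows "(LINT z:plate l|lborel. f (fst z) * g (snd z)) = (LINT x:{0<..<pi}|lborel. f x) * (LINT y:{-l<..<l}|lborel. g y)"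
proof -
  let ?h = "\<lambda>z. f (fst z) * g (snd z)"
  let ?F = "\<lambda>z. indicator (plate l) z *\<^sub>R ?h z"
  have "continuous_on (closed_plate l) ?h"
    unfolding closed_plate_def
    by (intro continuous_intros continuous_on_compose2[OF assms(1)] continuous_on_compose2[OF assms(2)]) auto
  moreover have "compact (closed_plate l)" unfolding closed_plate_def by (intro compact_Times compact_Icc)
  ultimately have "set_integrable lborel (closed_plate l) ?h"
    unfolding set_integrable_def by (intro borel_integrable_compact)
  moreover have "plate l \<in> sets lborel" unfolding plate_def by (auto intro!: open_Times borel_open)
  moreover have "plate l \<subseteq> closed_plate l" by (auto simp: plate_def closed_plate_def)
  ultimately have "set_integrable lborel (plate l) ?h" by (rule set_integrable_subset)
  then have int: "integrable (lborel \<Otimes>\<^sub>M lborel) ?F" by (simp add: lborel_prod set_integrable_def)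
  have "(LINT z:plate l|lborel. ?h z) = integral\<^sup>L (lborel \<Otimes>\<^sub>M lborel) ?F"
    by (simp add: lborel_prod set_lebesgue_integral_def)
  also have "\<dots> = (\<integral>x. (\<integral>y. ?F (x, y) \<partial>lborel) \<partial>lborel)"
    by (rule lborel_pair.integral_fst'[OF int, symmetric])
  also have "\<dots> = (\<integral>x. (indicator {0<..<pi} x *\<^sub>R f x) * (\<integral>y. indicator {-l<..<l} y *\<^sub>R g y \<partial>lborel) \<partial>lborel)"
  proof (rule Bochner_Integration.integral_cong[OF HOL.refl])
    fix x
    have F: "?F (x, y) = (indicator {0<..<pi} x *\<^sub>R f x) * (indicator {-l<..<l} y *\<^sub>R g y)" for y
      by (simp add: plate_def indicator_times)
    show "(\<integral>y. ?F (x, y) \<partial>lborel) = (indicator {0<..<pi} x *\<^sub>R f x) * (\<integral>y. indicator {-l<..<l} y *\<^sub>R g y \<partial>lborel)"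
      unfolding F by (rule integral_mult_right_zero)
  qed
  also have "\<dots> = (LINT x:{0<..<pi}|lborel. f x) * (LINT y:{-l<..<l}|lborel. g y)"
    by (simp add: set_lebesgue_integral_def)
  finally show ?thesis .
qed

lemma set_integral_Ioo:
  fixes f :: "real \<Rightarrow> real"
  assumes "continuous_on {a..b} f"
  shows "set_integrable lborel {a<..<b} f" "(LINT x:{a<..<b}|lborel. f x) = integral {a..b} f"
proof -
  show i: "set_integrable lborel {a<..<b} f"
    by (rule set_integrable_subset[OF borel_integrable_atLeastAtMost'[OF assms]]) auto
  show "(LINT x:{a<..<b}|lborel. f x) = integral {a..b} f"
    using set_borel_integral_eq_integral(2)[OF i] by (simp add: integral_open_interval_real)
qed

lemma integral_cos2_eq_sin2:
  assumes "m \<ge> 1"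
  shows "(LINT x:{0<..<pi}|lborel. (cos (real m * x))\<^sup>2) = (LINT x:{0<..<pi}|lborel. (sin (real m * x))\<^sup>2)"
proof -
  have c: "continuous_on {0..pi} (\<lambda>x. (cos (real m * x))\<^sup>2)" "continuous_on {0..pi} (\<lambda>x. (sin (real m * x))\<^sup>2)"
    by (intro continuous_intros)+
  have "((\<lambda>x. (cos (real m * x))\<^sup>2 - (sin (real m * x))\<^sup>2) has_integral
      sin (real m * pi) * cos (real m * pi) / m - sin (real m * 0) * cos (real m * 0) / m) {0..pi}"
    using assms by (intro fundamental_theorem_of_calculus)
      (auto simp flip: has_real_derivative_iff_has_vector_derivative
        simp: power2_eq_square field_simps intro!: derivative_eq_intros)
  then have "integral {0..pi} (\<lambda>x. (cos (real m * x))\<^sup>2 - (sin (real m * x))\<^sup>2) = 0"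
    by (simp add: integral_unique)
  moreover have "integral {0..pi} (\<lambda>x. (cos (real m * x))\<^sup>2 - (sin (real m * x))\<^sup>2)
      = integral {0..pi} (\<lambda>x. (cos (real m * x))\<^sup>2) - integral {0..pi} (\<lambda>x. (sin (real m * x))\<^sup>2)"
    using c by (intro integral_diff integrable_continuous_real)
  ultimately show ?thesis using c by (simp add: set_integral_Ioo)
qed

text \<open>Over the interval \<open>(0, \<pi>)\<close>, the squares of \<open>sin (m x)\<close> and \<open>cos (m x)\<close> have the same integral, so the
  normalization of the mode shape determines the integral of the squared derivative.\<close>

lemma integral_dx_mode_shape:
  assumes m: "m \<ge> 1" and cont: "continuous_on (closed_plate l) (mode_shape \<psi> m i)"
    and norm: "(LINT z:plate l|lborel. (mode_shape \<psi> m i z)\<^sup>2) = 1"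
  shows "(LINT z:plate l|lborel. (dx (\<lambda>z. p * mode_shape \<psi> m i z) z)\<^sup>2) = p\<^sup>2 * (real m)\<^sup>2"
proof -
  \<comment> \<open>On the line \<open>x = \<pi> / (2 m)\<close> the sine factor is 1, which makes \<open>\<psi> m i\<close> continuous.\<close>
  have "pi / (2 * real m) \<le> pi / 1" using m by (intro divide_left_mono) auto
  then have x0: "pi / (2 * real m) \<in> {0..pi}" by simp
  have "continuous_on {-l..l} (\<lambda>y. mode_shape \<psi> m i (pi / (2 * real m), y))"
    using x0 by (intro continuous_on_compose2[OF cont] continuous_intros) (auto simp: closed_plate_def)
  moreover have "mode_shape \<psi> m i (pi / (2 * real m), y) = \<psi> m i y" for y
    using m by (simp add: mode_shape_def)
  ultimately have \<psi>: "continuous_on {-l..l} (\<psi> m i)" by simp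
  then have \<psi>2: "continuous_on {-l..l} (\<lambda>y. (\<psi> m i y)\<^sup>2)" by (intro continuous_intros)
  have "continuous_on {0..pi} (\<lambda>x. (cos (real m * x))\<^sup>2)" "continuous_on {0..pi} (\<lambda>x. (sin (real m * x))\<^sup>2)"
    by (intro continuous_intros)+
  note prod = this[THEN integral_product_on_plate[OF _ \<psi>2]]
  have "(LINT z:plate l|lborel. (dx (\<lambda>z. p * mode_shape \<psi> m i z) z)\<^sup>2)
      = (LINT z:plate l|lborel. (p\<^sup>2 * (real m)\<^sup>2) * ((cos (real m * fst z))\<^sup>2 * (\<psi> m i (snd z))\<^sup>2))"
  proof (rule set_lebesgue_integral_cong)
    show "plate l \<in> sets lborel" unfolding plate_def by (auto intro!: open_Times borel_open)
    show "\<forall>z. z \<in> plate l \<longrightarrow> (dx (\<lambda>z. p * mode_shape \<psi> m i z) z)\<^sup>2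
        = (p\<^sup>2 * (real m)\<^sup>2) * ((cos (real m * fst z))\<^sup>2 * (\<psi> m i (snd z))\<^sup>2)"
    proof (intro allI impI)
      fix z assume "z \<in> plate l"
      then have "z \<in> closed_plate l" by (auto simp: plate_def closed_plate_def)
      then show "(dx (\<lambda>z. p * mode_shape \<psi> m i z) z)\<^sup>2
        = (p\<^sup>2 * (real m)\<^sup>2) * ((cos (real m * fst z))\<^sup>2 * (\<psi> m i (snd z))\<^sup>2)"
        by (simp add: dx_mode_shape(1) power_mult_distrib mult_ac)
    qed
  qed
  also have "\<dots> = (p\<^sup>2 * (real m)\<^sup>2) * (LINT z:plate l|lborel. (cos (real m * fst z))\<^sup>2 * (\<psi> m i (snd z))\<^sup>2)"
    by (rule set_integral_mult_right)
  also have "(LINT z:plate l|lborel. (cos (real m * fst z))\<^sup>2 * (\<psi> m i (snd z))\<^sup>2)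
      = (LINT z:plate l|lborel. (sin (real m * fst z))\<^sup>2 * (\<psi> m i (snd z))\<^sup>2)"
    unfolding prod integral_cos2_eq_sin2[OF m] ..
  also have "\<dots> = 1" using norm by (simp add: mode_shape_def power_mult_distrib mult.commute)
  finally show ?thesis by simp
qed

text \<open>Evaluating the plate equation at a point where the mode shape does not vanish gives the Duffing
  equation for positive times; continuity of \<open>\<phi>''\<close> extends it to time 0.\<close>

lemma simple_mode_duffing:
  assumes l: "l > 0" and m: "m \<ge> 1" and i: "i \<ge> 1" and bs: "buckling_system \<sigma> l \<psi> \<Lambda>"
    and mode: "simple_mode \<sigma> l P S (mode_shape \<psi> m i) \<phi>"
  shows "duffing_solution ((real m)\<^sup>2 * (\<Lambda> m i - P)) (S * real m ^ 4) \<phi> (deriv_on {0..} \<phi>)"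
proof -
  let ?w = "mode_shape \<psi> m i" and ?A = "(real m)\<^sup>2 * (\<Lambda> m i - P)" and ?B = "S * real m ^ 4"
  have be: "buckling_eigenfunction \<sigma> l (\<Lambda> m i) ?w" and norm: "(LINT z:plate l|lborel. (?w z)\<^sup>2) = 1"
    using bs m i by (auto simp: buckling_system_def)
  have C4: "C_plate 4 l ?w" using be by (simp add: buckling_eigenfunction_def)
  then have cont: "continuous_on (closed_plate l) ?w" by (simp add: eval_nat_numeral)
  obtain z where z: "z \<in> plate l" "?w z \<noteq> 0" using be by (auto simp: buckling_eigenfunction_def)
  have zc: "z \<in> closed_plate l" using z(1) by (auto simp: plate_def closed_plate_def)
  have "laplacian l (laplacian l ?w) z + \<Lambda> m i * dx (dx ?w) z = 0"
    using be z(1) by (auto simp: buckling_eigenfunction_def)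
  moreover have "dx (dx ?w) z = - (real m)\<^sup>2 * ?w z"
    using dx_mode_shape(2)[OF zc, of 1 \<psi> m i] by simp
  ultimately have LL: "laplacian l (laplacian l ?w) z = \<Lambda> m i * (real m)\<^sup>2 * ?w z" by simp
  have C2: "C_on 2 {0..} \<phi>" using mode by (simp add: simple_mode_def)
  note d = C2_derivatives[OF C2]
  have pos: "deriv_on {0..} (deriv_on {0..} \<phi>) t = - (?A * \<phi> t + ?B * \<phi> t ^ 3)" if t: "t > 0" for t
  proof -
    have "deriv_on {0..} (deriv_on {0..} (\<lambda>s. \<phi> s * ?w z)) t + laplacian l (laplacian l (\<lambda>z. \<phi> t * ?w z)) z
        - nonlocal_coeff l P S (\<lambda>z. \<phi> t * ?w z) * dx (dx (\<lambda>z. \<phi> t * ?w z)) z = 0"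
      using mode t z(1) by (auto simp: simple_mode_def plate_solution_def)
    moreover have "deriv_on {0..} (deriv_on {0..} (\<lambda>s. \<phi> s * ?w z)) t = deriv_on {0..} (deriv_on {0..} \<phi>) t * ?w z"
    proof -
      have e: "deriv_on {0..} (\<lambda>s. \<phi> s * ?w z) s = deriv_on {0..} \<phi> s * ?w z" if "s \<in> {0..}" for s
        using d(1)[OF that] that by (intro deriv_on_eqI DERIV_cmult_right) auto
      have "deriv_on {0..} (deriv_on {0..} (\<lambda>s. \<phi> s * ?w z)) t = deriv_on {0..} (\<lambda>s. deriv_on {0..} \<phi> s * ?w z) t"
        using t by (intro deriv_on_cong e) auto
      also have "\<dots> = deriv_on {0..} (deriv_on {0..} \<phi>) t * ?w z"
        using d(2)[of t] t by (intro deriv_on_eqI DERIV_cmult_right) auto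
      finally show ?thesis .
    qed
    moreover have "laplacian l (laplacian l (\<lambda>z. \<phi> t * ?w z)) z = \<phi> t * (\<Lambda> m i * (real m)\<^sup>2 * ?w z)"
      unfolding bilaplacian_scale[OF l C4 zc] LL ..
    moreover have "nonlocal_coeff l P S (\<lambda>z. \<phi> t * ?w z) = - P + S * ((\<phi> t)\<^sup>2 * (real m)\<^sup>2)"
      unfolding nonlocal_coeff_def integral_dx_mode_shape[OF m cont norm] ..
    moreover note dx_mode_shape(2)[OF zc, of "\<phi> t" \<psi> m i]
    ultimately have "deriv_on {0..} (deriv_on {0..} \<phi>) t * ?w z + \<phi> t * (\<Lambda> m i * (real m)\<^sup>2 * ?w z)
        - (- P + S * ((\<phi> t)\<^sup>2 * (real m)\<^sup>2)) * (- (real m)\<^sup>2 * (\<phi> t * ?w z)) = 0" by simp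
    then have "(deriv_on {0..} (deriv_on {0..} \<phi>) t + (?A * \<phi> t + ?B * \<phi> t ^ 3)) * ?w z = 0"
      by (simp add: algebra_simps power2_eq_square power3_eq_cube power4_eq_xxxx)
    then show ?thesis using z(2) by simp
  qed
  have c: "continuous_on {0..1} (deriv_on {0..} (deriv_on {0..} \<phi>))" by (rule continuous_on_subset[OF d(3)]) auto
  have "continuous_on {0..} \<phi>" using C2 by (simp add: numeral_2_eq_2)
  then have "continuous_on {0..1} \<phi>" by (rule continuous_on_subset) auto
  then have c': "continuous_on {0..1} (\<lambda>t. - (?A * \<phi> t + ?B * \<phi> t ^ 3))" by (intro continuous_intros)
  have zero: "deriv_on {0..} (deriv_on {0..} \<phi>) 0 = - (?A * \<phi> 0 + ?B * \<phi> 0 ^ 3)"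
    by (rule eq_at_endpoint(1)[OF c' c zero_less_one pos])
  have all: "deriv_on {0..} (deriv_on {0..} \<phi>) t = - (?A * \<phi> t + ?B * \<phi> t ^ 3)" if "t \<ge> 0" for t
    using pos[of t] zero that by (cases "t = 0") auto
  show ?thesis
    unfolding duffing_solution_def
  proof (intro allI impI conjI)
    fix t :: real assume t: "t \<ge> 0"
    show "(\<phi> has_real_derivative deriv_on {0..} \<phi> t) (at t within {0..})" using d(1) t by simp
    show "(deriv_on {0..} \<phi> has_real_derivative - (?A * \<phi> t + ?B * \<phi> t ^ 3)) (at t within {0..})"
      using d(2)[of t] t by (simp add: all)
  qed
qed

section \<open>High energy modes\<close>

text \<open>The energy determines the amplitude \<open>R\<close> as \<open>R\<^sup>2 = r\<close> with \<open>r\<close> the positive root of a quadratic equation,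
  and \<open>r\<close> grows with the energy. The ratios \<open>A / (B R\<^sup>2)\<close> and \<open>A' / (B R\<^sup>2)\<close> thus become small.\<close>

lemma large_energy_in_phase:
  assumes A: "A > 0" "A' > 0" and B: "B > 0" and \<gamma>: "\<gamma> > 0" and \<rho>: "\<rho> > 0"
  obtains E where "E > 0"
    "\<And>\<phi> \<phi>'. duffing_solution A B \<phi> \<phi>' \<Longrightarrow> (\<phi>' 0)\<^sup>2 / 2 + A * (\<phi> 0)\<^sup>2 / 2 + B * \<phi> 0 ^ 4 / 4 \<ge> E \<Longrightarrow>
      \<exists>\<epsilon> \<epsilon>' \<kappa> \<theta> c c' s s'. \<epsilon> \<le> \<rho> \<and> \<epsilon>' \<le> \<rho> \<and>
        hill_in_phase \<epsilon> \<epsilon>' \<gamma> \<kappa> \<theta> (\<lambda>t. A' + \<gamma> * B * (\<phi> t)\<^sup>2) c c' s s'"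
proof -
  \<comment> \<open>For \<open>r \<ge> r0\<close>, both \<open>A / (B r)\<close> and \<open>A' / (B r)\<close> are at most \<open>\<rho>\<close>.\<close>
  define r0 where "r0 = (A + A') / (B * \<rho>)"
  have r0: "r0 > 0" using A B \<rho> by (simp add: r0_def)
  define E where "E = A * r0 / 2 + B * r0\<^sup>2 / 4"
  have E: "E > 0" using A B r0 by (simp add: E_def add_pos_pos)
  show ?thesis
  proof (rule that[OF E])
    fix \<phi> \<phi>' assume \<phi>: "duffing_solution A B \<phi> \<phi>'"
      and large: "(\<phi>' 0)\<^sup>2 / 2 + A * (\<phi> 0)\<^sup>2 / 2 + B * \<phi> 0 ^ 4 / 4 \<ge> E"
    define e where "e = (\<phi>' 0)\<^sup>2 / 2 + A * (\<phi> 0)\<^sup>2 / 2 + B * \<phi> 0 ^ 4 / 4"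
    have e: "e \<ge> E" "e > 0" using large E by (auto simp: e_def)
    define r where "r = (sqrt (A\<^sup>2 + 4 * B * e) - A) / B"
    have "A\<^sup>2 < A\<^sup>2 + 4 * B * e" using B e by simp
    then have "sqrt (A\<^sup>2) < sqrt (A\<^sup>2 + 4 * B * e)" by (rule real_sqrt_less_mono)
    then have rpos: "r > 0" using A B by (simp add: r_def)
    have re: "A * r / 2 + B * r\<^sup>2 / 4 = e"
    proof -
      have "(B * r + A)\<^sup>2 = A\<^sup>2 + 4 * B * e" using B e A by (simp add: r_def add_nonneg_nonneg)
      then have "4 * B * (A * r / 2 + B * r\<^sup>2 / 4) = 4 * B * e" by (simp add: power2_eq_square field_simps)
      then show ?thesis using B by simp
    qed
    have rr0: "r \<ge> r0"
    proof (rule ccontr)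
      assume "\<not> r \<ge> r0"
      then have "A * r < A * r0" "B * r\<^sup>2 < B * r0\<^sup>2" using A B rpos by (auto intro!: power_strict_mono)
      then show False using re e(1) unfolding E_def by linarith
    qed
    define R where "R = sqrt r"
    have R: "R > 0" "R\<^sup>2 = r" using rpos by (simp_all add: R_def)
    have R4: "R ^ 4 = r\<^sup>2" using R(2) power_mult[of R 2 2] by simp
    define \<kappa> \<epsilon> \<epsilon>' where "\<kappa> = R * sqrt B" and "\<epsilon> = A / (B * R\<^sup>2)" and "\<epsilon>' = A' / (B * R\<^sup>2)"
    obtain \<theta> where \<theta>: "\<theta> 0 \<ge> 0" "\<And>t. t \<ge> 0 \<Longrightarrow> \<phi> t = R * cos (\<theta> t)"
      "\<And>t. t \<ge> 0 \<Longrightarrow> (\<theta> has_real_derivative \<kappa> * sqrt (speed2 \<epsilon> (\<theta> t))) (at t within {0..})"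
      using duffing_phase[OF A(1) B \<phi> _ R(1)] re[unfolded e_def] unfolding \<kappa>_def \<epsilon>_def R R4 by metis
    have "r0 * (B * \<rho>) = A + A'" using B \<rho> by (simp add: r0_def)
    then have "A + A' \<le> \<rho> * (B * r)" using mult_right_mono[OF rr0, of "B * \<rho>"] B \<rho> by (simp add: mult_ac)
    then have small: "\<epsilon> \<le> \<rho>" "\<epsilon>' \<le> \<rho>"
      using A B rpos unfolding \<epsilon>_def \<epsilon>'_def R by (simp_all add: divide_le_eq)
    have nonneg: "\<epsilon> \<ge> 0" "\<epsilon>' \<ge> 0" using A B by (simp_all add: \<epsilon>_def \<epsilon>'_def)
    have kap: "\<kappa> > 0" "\<kappa>\<^sup>2 = B * R\<^sup>2" using B R by (simp_all add: \<kappa>_def power_mult_distrib)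
    obtain c c' s s' where fs: "fundamental_system (hill_k \<epsilon>) (hill_q \<gamma> \<epsilon> \<epsilon>') c c' s s'"
      by (rule hill_fundamental_system_exists[OF nonneg less_imp_le[OF \<gamma>]])
    have "hill_in_phase \<epsilon> \<epsilon>' \<gamma> \<kappa> \<theta> (\<lambda>t. A' + \<gamma> * B * (\<phi> t)\<^sup>2) c c' s s'"
    proof
      fix t :: real assume t: "t \<ge> 0"
      have "\<kappa>\<^sup>2 * \<epsilon>' = A'" using B rpos unfolding kap \<epsilon>'_def R by simp
      then show "A' + \<gamma> * B * (\<phi> t)\<^sup>2 = \<kappa>\<^sup>2 * (\<epsilon>' + \<gamma> * (cos (\<theta> t))\<^sup>2)"
        unfolding \<theta>(2)[OF t] distrib_left by (simp add: kap power_mult_distrib)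
    qed (use nonneg \<gamma> kap \<theta> fs in auto)
    then show "\<exists>\<epsilon> \<epsilon>' \<kappa> \<theta> c c' s s'. \<epsilon> \<le> \<rho> \<and> \<epsilon>' \<le> \<rho> \<and>
        hill_in_phase \<epsilon> \<epsilon>' \<gamma> \<kappa> \<theta> (\<lambda>t. A' + \<gamma> * B * (\<phi> t)\<^sup>2) c c' s s'"
      using small by blast
  qed
qed

theorem theorem12:
  fixes \<sigma> l P S \<gamma> :: real
    and \<psi> :: "nat \<Rightarrow> nat \<Rightarrow> real \<Rightarrow> real"
    and \<Lambda> :: "nat \<Rightarrow> nat \<Rightarrow> real"
    and m n i k :: nat
  assumes "0 < \<sigma>" and "\<sigma> < 1/2" and "0 < l"
    and "buckling_system \<sigma> l \<psi> \<Lambda>"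
    and "S > 0"
    and "m \<ge> 1" and "n \<ge> 1" and "i \<ge> 1" and "k \<ge> 1"
    and "P < min (\<Lambda> m i) (\<Lambda> n k)"
    and "\<gamma> = (real n)\<^sup>2 / (real m)\<^sup>2"
  shows "((\<exists>j. \<gamma> \<in> I_interval j) \<longrightarrow>
           (\<exists>E>0. \<forall>\<phi>. simple_mode \<sigma> l P S (mode_shape \<psi> m i) \<phi> \<and>
              mode_energy P S m (\<Lambda> m i) \<phi> 0 \<ge> E \<longrightarrow>
              linearly_stable P S m n (\<Lambda> n k) \<phi>)) \<and>
         ((\<exists>j. \<gamma> \<in> K_interval j) \<longrightarrow>
           (\<exists>E>0. \<forall>\<phi>. simple_mode \<sigma> l P S (mode_shape \<psi> m i) \<phi> \<and>
              mode_energy P S m (\<Lambda> m i) \<phi> 0 \<ge> E \<longrightarrow>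
              linearly_unstable P S m n (\<Lambda> n k) \<phi>))"
proof -
  define A A' B where "A = (real m)\<^sup>2 * (\<Lambda> m i - P)" and "A' = (real n)\<^sup>2 * (\<Lambda> n k - P)" and "B = S * real m ^ 4"
  have pos: "A > 0" "A' > 0" "B > 0" "\<gamma> > 0"
    using assms by (simp_all add: A_def A'_def B_def)
  have gB: "\<gamma> * B = S * (real m)\<^sup>2 * (real n)\<^sup>2"
    using assms(6) by (simp add: assms(11) B_def power4_eq_xxxx power2_eq_square)
  have coeff: "hill_coeff P S m n (\<Lambda> n k) \<phi> = (\<lambda>t. A' + \<gamma> * B * (\<phi> t)\<^sup>2)" for \<phi>
    by (rule ext) (simp only: hill_coeff_def A'_def gB)
  have duffing: "duffing_solution A B \<phi> (deriv_on {0..} \<phi>)"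
    if "simple_mode \<sigma> l P S (mode_shape \<psi> m i) \<phi>" for \<phi>
    using simple_mode_duffing[OF assms(3,6,8,4) that] by (simp only: A_def B_def)
  have energy: "mode_energy P S m (\<Lambda> m i) \<phi> 0 = (deriv_on {0..} \<phi> 0)\<^sup>2 / 2 + A * (\<phi> 0)\<^sup>2 / 2 + B * \<phi> 0 ^ 4 / 4" for \<phi>
    by (simp only: mode_energy_def A_def B_def)
  have phase: "\<exists>E>0. \<forall>\<phi>. simple_mode \<sigma> l P S (mode_shape \<psi> m i) \<phi> \<and> mode_energy P S m (\<Lambda> m i) \<phi> 0 \<ge> E \<longrightarrow>
      (\<exists>\<epsilon> \<epsilon>' \<kappa> \<theta> c c' s s'. \<epsilon> \<le> \<rho> \<and> \<epsilon>' \<le> \<rho> \<and>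
        hill_in_phase \<epsilon> \<epsilon>' \<gamma> \<kappa> \<theta> (hill_coeff P S m n (\<Lambda> n k) \<phi>) c c' s s')" if \<rho>: "\<rho> > 0" for \<rho>
  proof -
    obtain E where E: "E > 0" "\<And>\<phi> \<phi>'. duffing_solution A B \<phi> \<phi>' \<Longrightarrow> (\<phi>' 0)\<^sup>2 / 2 + A * (\<phi> 0)\<^sup>2 / 2 + B * \<phi> 0 ^ 4 / 4 \<ge> E \<Longrightarrow>
      \<exists>\<epsilon> \<epsilon>' \<kappa> \<theta> c c' s s'. \<epsilon> \<le> \<rho> \<and> \<epsilon>' \<le> \<rho> \<and>
        hill_in_phase \<epsilon> \<epsilon>' \<gamma> \<kappa> \<theta> (\<lambda>t. A' + \<gamma> * B * (\<phi> t)\<^sup>2) c c' s s'"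
      by (rule large_energy_in_phase[OF pos \<rho>]) blast
    show ?thesis
      unfolding coeff energy using E(1) E(2)[OF duffing] by (intro exI[where x = E]) blast
  qed
  show ?thesis
  proof (intro conjI impI)
    assume "\<exists>j. \<gamma> \<in> I_interval j"
    then obtain \<rho> where \<rho>: "\<rho> > 0" "\<And>\<epsilon> \<epsilon>' c c' s s'. 0 \<le> \<epsilon> \<Longrightarrow> \<epsilon> \<le> \<rho> \<Longrightarrow> 0 \<le> \<epsilon>' \<Longrightarrow> \<epsilon>' \<le> \<rho> \<Longrightarrow>
       fundamental_system (hill_k \<epsilon>) (hill_q \<gamma> \<epsilon> \<epsilon>') c c' s s' \<Longrightarrow> \<bar>c pi + s' pi\<bar> < 2"
      using discriminant_stable_range[OF pos(4)] by metis
    have "linearly_stable P S m n (\<Lambda> n k) \<phi>"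
      if "\<epsilon> \<le> \<rho>" "\<epsilon>' \<le> \<rho>" "hill_in_phase \<epsilon> \<epsilon>' \<gamma> \<kappa> \<theta> (hill_coeff P S m n (\<Lambda> n k) \<phi>) c c' s s'" for \<epsilon> \<epsilon>' \<kappa> \<theta> c c' s s' \<phi>
    proof -
      interpret hill_in_phase \<epsilon> \<epsilon>' \<gamma> \<kappa> \<theta> "hill_coeff P S m n (\<Lambda> n k) \<phi>" c c' s s' by (rule that(3))
      show ?thesis
        unfolding linearly_stable_def by (rule hill_stable[OF \<rho>(2)[OF nonneg(1) that(1) nonneg(2) that(2) fs]])
    qed
    then show "\<exists>E>0. \<forall>\<phi>. simple_mode \<sigma> l P S (mode_shape \<psi> m i) \<phi> \<and>
              mode_energy P S m (\<Lambda> m i) \<phi> 0 \<ge> E \<longrightarrow> linearly_stable P S m n (\<Lambda> n k) \<phi>"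
      using phase[OF \<rho>(1)] by meson
  next
    assume "\<exists>j. \<gamma> \<in> K_interval j"
    then obtain \<rho> where \<rho>: "\<rho> > 0" "\<And>\<epsilon> \<epsilon>' c c' s s'. 0 \<le> \<epsilon> \<Longrightarrow> \<epsilon> \<le> \<rho> \<Longrightarrow> 0 \<le> \<epsilon>' \<Longrightarrow> \<epsilon>' \<le> \<rho> \<Longrightarrow>
       fundamental_system (hill_k \<epsilon>) (hill_q \<gamma> \<epsilon> \<epsilon>') c c' s s' \<Longrightarrow> \<bar>c pi + s' pi\<bar> > 2"
      using discriminant_unstable_range[OF pos(4)] by metis
    have "linearly_unstable P S m n (\<Lambda> n k) \<phi>"
      if "\<epsilon> \<le> \<rho>" "\<epsilon>' \<le> \<rho>" "hill_in_phase \<epsilon> \<epsilon>' \<gamma> \<kappa> \<theta> (hill_coeff P S m n (\<Lambda> n k) \<phi>) c c' s s'" for \<epsilon> \<epsilon>' \<kappa> \<theta> c c' s s' \<phi>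
    proof -
      interpret hill_in_phase \<epsilon> \<epsilon>' \<gamma> \<kappa> \<theta> "hill_coeff P S m n (\<Lambda> n k) \<phi>" c c' s s' by (rule that(3))
      show ?thesis
        unfolding linearly_unstable_def by (rule hill_unstable[OF \<rho>(2)[OF nonneg(1) that(1) nonneg(2) that(2) fs]])
    qed
    then show "\<exists>E>0. \<forall>\<phi>. simple_mode \<sigma> l P S (mode_shape \<psi> m i) \<phi> \<and>
              mode_energy P S m (\<Lambda> m i) \<phi> 0 \<ge> E \<longrightarrow> linearly_unstable P S m n (\<Lambda> n k) \<phi>"
      using phase[OF \<rho>(1)] by meson
  qed
qed

end
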